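(* Let $(\mathfrak g,g,J)$ be a two-step solvable $2n$-dimensional SKT Lie algebra with $\mathfrak g'$ not $J$-invariant and of codimension two. Then $(\mathfrak g,g,J)$ is isomorphic, as an almost Hermitian Lie algebra, to one of the algebras $\mathfrak g(a,b_1,b_2,z,w,h,\tau)$ described in the context, for certain $a>0$, $b_1\in\mathbb R$, $b_2\ge 0$, $z=(z_1,\dots,z_{n-2})$, $w=(w_1,\dots,w_{n-2})\in\mathbb C^{n-2}$, $h_{jk}=\sum_{i=1}^{n-2}h^i_{jk}Y_i$ ($j,k\in\{1,2\}$, $h^i_{jk}\in\mathbb C$) and $\tau$, such that $$2a(a-b_1)+\|h_{12}-h_{21}\|^2+\|h_{12}\|^2+\|h_{21}\|^2-2\,\tilde g(h_{11},h_{12})=0$$ and such that for each $i=1,\dots,n-2$ one of the following three cases holds: (i) $\operatorname{Re}(z_i)=0$, $\operatorname{Re}(w_i)=0$, $z_i\neq0$ and $$h^i_{21}=h^i_{12}=\frac{w_i}{z_i}h^i_{11},\qquad h^i_{22}=\frac{w_i^2-b_2w_i-b_1z_i}{z_i(z_i-a)}h^i_{11};$$ (ii) $z_i=0$, $\operatorname{Re}(w_i)=0$, $w_i\neq0$ and $$h^i_{11}=0,\qquad h^i_{21}=h^i_{12},\qquad h^i_{22}=\frac{b_2-w_i}{a}h^i_{12};$$ (iii) $\operatorname{Re}(z_i)=-a/2$, $\operatorname{Re}(w_i)$ is a solution of $2x^2+b_2x-\tfrac{b_1}{2}a=0$ and $$h^i_{21}=\frac{w_i\overline z_i-a\overline w_i}{|z_i|^2-a\overline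 z_i}h^i_{11},\qquad h^i_{22}=\frac{|w_i|^2-b_1\overline z_i-b_2\overline w_i}{|z_i|^2-a\overline z_i}h^i_{11},$$ where this case may only occur if $b_1\ge -b_2^2/(4a)$. Conversely, all such $\mathfrak g(a,b_1,b_2,z,w,h,\tau)$ are two-step solvable SKT Lie algebras whose commutator ideal is not invariant under the complex structure and of codimension two.
   Context: An almost Hermitian Lie algebra $(\mathfrak g,g,J)$ is a finite-dimensional real Lie algebra with an inner product $g$ and an endomorphism $J$, $J^2=-\mathrm{id}$, with $g(J\cdot,J\cdot)=g$; put $\sigma=g(J\cdot,\cdot)$. It is SKT if $J$ is integrable ($[JX,JY]-J[JX,Y]-J[X,JY]-[X,Y]=0$) and $d(J^*d\sigma)=0$, where $d$ is the Chevalley–Eilenberg differential and $(J^*\beta)(X_1,\dots,X_k)=\beta(JX_1,\dots,JX_k)$. Isomorphisms of almost Hermitian Lie algebras preserve bracket, metric and almost complex structure. $\mathfrak g'=[\mathfrak g,\mathfrak g]$; two-step solvable means $\mathfrak g'$ is Abelian. The data $\mathfrak g(a,b_1,b_2,z,w,h,\tau)$: As a vector space it is $\mathfrak a_J\oplus\operatorname{span}_{\mathbb R}(X_1,X_2)\oplus\operatorname{span}_{\mathbb R}(IX_1,IX_2)$, where $\mathfrak a_J$ is an $(n-2)$-dimensional complex vector space with basis $Y_1,\dots,Y_{n-2}$. The almost complex structure $I$ is multiplication by $i$ on $\mathfrak a_J$ and sends $X_j\mapsto IX_j$, $IX_j\mapsto -X_j$. The inner product $\tilde g$ is such that $Y_1,\dots,Y_{n-2},iY_1,\dots,iY_{n-2}$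 is an orthonormal basis of $\mathfrak a_J$, $\mathfrak a_J$ is orthogonal to $X_1,X_2,IX_1,IX_2$, the pairs $(X_1,X_2)$ and $(IX_1,IX_2)$ are each orthonormal, $\tilde g(IX_j,X_j)=0$, and $\tilde g(IX_1,X_2)=-\tilde g(X_1,IX_2)=\tau$, where $\tau\in\mathbb R$ is such that $\tilde g$ is positive definite. Here $\|\cdot\|$ is the norm of $\tilde g$. The only non-zero brackets (up to anti-symmetry and complex-linear extension in the argument in $\mathfrak a_J$) are $$[IX_1,Y_i]=z_iY_i,\quad [IX_2,Y_i]=w_iY_i,\quad [IX_1,X_1]=aX_1+h_{11},\quad [IX_1,X_2]=aX_2+h_{12},$$ $$[IX_2,X_1]=aX_2+h_{21},\quad [IX_2,X_2]=b_1X_1+b_2X_2+h_{22},\quad [IX_1,IX_2]=i(h_{12}-h_{21}),$$ with $h_{jk}\in\mathfrak a_J$.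
   Formalization: The last term of the scalar equation is corrected to -2g(h_11,h_22) (printed: h_12), and case (iii) gains the relation h_12^i = (conj w_i / conj z_i) h_11^i, forced by the Jacobi identity; as printed, the converse fails for explicit parameters with n=3. *)

theory Defs
  imports "HOL-Analysis.Analysis" "HOL-Analysis.Finite_Function_Topology"
begin

section \<open>Almost Hermitian Lie algebras\<close>

text \<open>The underlying vector space is a subspace \<open>vs\<close> of an ambient real vector space, so that
  algebras whose dimension depends on a natural number live on one fixed type.  The three
  structure maps are only meaningful on \<open>vs\<close>.\<close>

record 'v ah_data =
  vs :: "'v set"
  bracket :: "'v \<Rightarrow> 'v \<Rightarrow> 'v"
  metric :: "'v \<Rightarrow> 'v \<Rightarrow> real"
  cplx :: "'v \<Rightarrow> 'v"

definition lin_on :: "'v::real_vector set \<Rightarrow> ('v \<Rightarrow> 'w::real_vector) \<Rightarrow> bool" where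
  "lin_on V f \<longleftrightarrow>
     (\<forall>x\<in>V. \<forall>y\<in>V. f (x + y) = f x + f y) \<and> (\<forall>c. \<forall>x\<in>V. f (c *\<^sub>R x) = c *\<^sub>R f x)"

definition bilin_on :: "'v::real_vector set \<Rightarrow> ('v \<Rightarrow> 'v \<Rightarrow> 'w::real_vector) \<Rightarrow> bool" where
  "bilin_on V f \<longleftrightarrow> (\<forall>x\<in>V. lin_on V (f x)) \<and> (\<forall>y\<in>V. lin_on V (\<lambda>x. f x y))"

definition lie_algebra :: "('v::real_vector, 'm) ah_data_scheme \<Rightarrow> bool" where
  "lie_algebra L \<longleftrightarrow>
     subspace (vs L) \<and> (\<exists>B. finite B \<and> span B = vs L) \<and>
     (\<forall>x\<in>vs L. \<forall>y\<in>vs L. bracket L x y \<in> vs L) \<and>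
     bilin_on (vs L) (bracket L) \<and>
     (\<forall>x\<in>vs L. bracket L x x = 0) \<and>
     (\<forall>x\<in>vs L. \<forall>y\<in>vs L. \<forall>u\<in>vs L.
        bracket L x (bracket L y u) + bracket L y (bracket L u x) + bracket L u (bracket L x y) = 0)"

definition inner_product :: "('v::real_vector, 'm) ah_data_scheme \<Rightarrow> bool" where
  "inner_product L \<longleftrightarrow>
     bilin_on (vs L) (metric L) \<and>
     (\<forall>x\<in>vs L. \<forall>y\<in>vs L. metric L x y = metric L y x) \<and>
     (\<forall>x\<in>vs L. x \<noteq> 0 \<longrightarrow> metric L x x > 0)"

definition almost_hermitian :: "('v::real_vector, 'm) ah_data_scheme \<Rightarrow> bool" where
  "almost_hermitian L \<longleftrightarrow>
     lie_algebra L \<and> inner_product L \<and>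
     lin_on (vs L) (cplx L) \<and> (\<forall>x\<in>vs L. cplx L x \<in> vs L) \<and>
     (\<forall>x\<in>vs L. cplx L (cplx L x) = - x) \<and>
     (\<forall>x\<in>vs L. \<forall>y\<in>vs L. metric L (cplx L x) (cplx L y) = metric L x y)"

definition mnorm :: "('v, 'm) ah_data_scheme \<Rightarrow> 'v \<Rightarrow> real" where
  "mnorm L x = sqrt (metric L x x)"

text \<open>A \<open>k\<close>-form is represented by its values on lists of length \<open>k\<close>.  In the
  Chevalley--Eilenberg differential, \<open>nths xs (- {i, j})\<close> is \<open>xs\<close> with the entries at
  positions \<open>i\<close> and \<open>j\<close> removed; counting from 0 or from 1 gives the same signs.\<close>

definition fundamental_form :: "('v, 'm) ah_data_scheme \<Rightarrow> 'v list \<Rightarrow> real" where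
  "fundamental_form L xs = metric L (cplx L (xs ! 0)) (xs ! 1)"

definition ce_d :: "('v, 'm) ah_data_scheme \<Rightarrow> ('v list \<Rightarrow> real) \<Rightarrow> 'v list \<Rightarrow> real" where
  "ce_d L \<beta> xs =
     (\<Sum>j<length xs. \<Sum>i<j.
        (-1) ^ (i + j) * \<beta> (bracket L (xs ! i) (xs ! j) # nths xs (- {i, j})))"

definition cplx_pullback :: "('v, 'm) ah_data_scheme \<Rightarrow> ('v list \<Rightarrow> real) \<Rightarrow> 'v list \<Rightarrow> real" where
  "cplx_pullback L \<beta> xs = \<beta> (map (cplx L) xs)"

definition integrable_cplx :: "('v::real_vector, 'm) ah_data_scheme \<Rightarrow> bool" where
  "integrable_cplx L \<longleftrightarrow>
     (\<forall>x\<in>vs L. \<forall>y\<in>vs L.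
        bracket L (cplx L x) (cplx L y) - cplx L (bracket L (cplx L x) y)
          - cplx L (bracket L x (cplx L y)) - bracket L x y = 0)"

definition skt :: "('v::real_vector, 'm) ah_data_scheme \<Rightarrow> bool" where
  "skt L \<longleftrightarrow>
     almost_hermitian L \<and> integrable_cplx L \<and>
     (\<forall>xs. length xs = 4 \<and> set xs \<subseteq> vs L \<longrightarrow>
        ce_d L (cplx_pullback L (ce_d L (fundamental_form L))) xs = 0)"

definition commutator_ideal :: "('v::real_vector, 'm) ah_data_scheme \<Rightarrow> 'v set" where
  "commutator_ideal L = span {bracket L x y | x y. x \<in> vs L \<and> y \<in> vs L}"

definition two_step_solvable :: "('v::real_vector, 'm) ah_data_scheme \<Rightarrow> bool" where
  "two_step_solvable L \<longleftrightarrow>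
     (\<forall>x\<in>commutator_ideal L. \<forall>y\<in>commutator_ideal L. bracket L x y = 0)"

definition commutator_cplx_invariant :: "('v::real_vector, 'm) ah_data_scheme \<Rightarrow> bool" where
  "commutator_cplx_invariant L \<longleftrightarrow> cplx L ` commutator_ideal L \<subseteq> commutator_ideal L"

definition commutator_codim_two :: "('v::real_vector, 'm) ah_data_scheme \<Rightarrow> bool" where
  "commutator_codim_two L \<longleftrightarrow> dim (vs L) = dim (commutator_ideal L) + 2"

definition ah_isomorphic ::
    "('v::real_vector, 'm) ah_data_scheme \<Rightarrow> ('w::real_vector, 'k) ah_data_scheme \<Rightarrow> bool" where
  "ah_isomorphic L M \<longleftrightarrow>
     (\<exists>\<phi>. lin_on (vs L) \<phi> \<and> bij_betw \<phi> (vs L) (vs M) \<and>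
        (\<forall>x\<in>vs L. \<forall>y\<in>vs L. \<phi> (bracket L x y) = bracket M (\<phi> x) (\<phi> y)) \<and>
        (\<forall>x\<in>vs L. \<forall>y\<in>vs L. metric L x y = metric M (\<phi> x) (\<phi> y)) \<and>
        (\<forall>x\<in>vs L. \<phi> (cplx L x) = cplx M (\<phi> x)))"


section \<open>The algebras \<open>\<gg>(a, b\<^sub>1, b\<^sub>2, z, w, h, \<tau>)\<close>\<close>

text \<open>The tuple \<open>(y, x1, x2, u1, u2)\<close> stands for
  \<open>y + x1 X\<^sub>1 + x2 X\<^sub>2 + u1 IX\<^sub>1 + u2 IX\<^sub>2\<close>, and \<open>y \<in> \<aa>\<^sub>J\<close> is given by its complex coordinates
  with respect to \<open>Y\<^sub>1, \<dots>, Y\<^sub>m\<close>, where \<open>m = n - 2\<close>; these are supported in \<open>{1..m}\<close>.  Only the values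
  at \<open>1, \<dots>, m\<close> of the parameters \<open>z\<close>, \<open>w\<close> and \<open>h j k\<close> matter; \<open>h j k i\<close> is the coefficient
  of \<open>Y\<^sub>i\<close> in \<open>h\<^sub>j\<^sub>k\<close>, for \<open>j, k \<in> {1, 2}\<close>.\<close>

type_synonym std_vec = "(nat \<Rightarrow>\<^sub>0 complex) \<times> real \<times> real \<times> real \<times> real"

definition aJ :: "nat \<Rightarrow> (nat \<Rightarrow> complex) \<Rightarrow> (nat \<Rightarrow>\<^sub>0 complex)" where
  "aJ m c = (\<Sum>i\<in>{1..m}. Poly_Mapping.single i (c i))"

definition aJ_vec :: "nat \<Rightarrow> (nat \<Rightarrow> complex) \<Rightarrow> std_vec" where
  "aJ_vec m c = (aJ m c, 0, 0, 0, 0)"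

fun std_bracket :: "nat \<Rightarrow> real \<Rightarrow> real \<Rightarrow> real \<Rightarrow> (nat \<Rightarrow> complex) \<Rightarrow> (nat \<Rightarrow> complex) \<Rightarrow>
    (nat \<Rightarrow> nat \<Rightarrow> nat \<Rightarrow> complex) \<Rightarrow> std_vec \<Rightarrow> std_vec \<Rightarrow> std_vec" where
  "std_bracket m a b1 b2 z w h (y, x1, x2, u1, u2) (y', x1', x2', u1', u2') =
     (let p11 = u1 * x1' - u1' * x1;  p12 = u1 * x2' - u1' * x2;
          p21 = u2 * x1' - u2' * x1;  p22 = u2 * x2' - u2' * x2;
          q = u1 * u2' - u1' * u2
      in (aJ m (\<lambda>i.
             (of_real u1 * z i + of_real u2 * w i) * Poly_Mapping.lookup y' i
           - (of_real u1' * z i + of_real u2' * w i) * Poly_Mapping.lookup y i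
           + of_real p11 * h 1 1 i + of_real p12 * h 1 2 i
           + of_real p21 * h 2 1 i + of_real p22 * h 2 2 i
           + of_real q * (\<i> * (h 1 2 i - h 2 1 i))),
          a * p11 + b1 * p22,
          a * p12 + a * p21 + b2 * p22,
          0, 0))"

fun std_metric :: "nat \<Rightarrow> real \<Rightarrow> std_vec \<Rightarrow> std_vec \<Rightarrow> real" where
  "std_metric m \<tau> (y, x1, x2, u1, u2) (y', x1', x2', u1', u2') =
     (\<Sum>i\<in>{1..m}. Re (Poly_Mapping.lookup y i * cnj (Poly_Mapping.lookup y' i)))
       + x1 * x1' + x2 * x2' + u1 * u1' + u2 * u2'
       + \<tau> * (u1 * x2' + x2 * u1') - \<tau> * (x1 * u2' + u2 * x1')"

fun std_cplx :: "std_vec \<Rightarrow> std_vec" where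
  "std_cplx (y, x1, x2, u1, u2) = (Poly_Mapping.map ((*) \<i>) y, - u1, - u2, x1, x2)"

definition std_alg :: "nat \<Rightarrow> real \<Rightarrow> real \<Rightarrow> real \<Rightarrow> (nat \<Rightarrow> complex) \<Rightarrow> (nat \<Rightarrow> complex) \<Rightarrow>
    (nat \<Rightarrow> nat \<Rightarrow> nat \<Rightarrow> complex) \<Rightarrow> real \<Rightarrow> std_vec ah_data" where
  "std_alg n a b1 b2 z w h \<tau> =
     \<lparr> vs = {y. Poly_Mapping.keys y \<subseteq> {1..n - 2}} \<times> UNIV,
       bracket = std_bracket (n - 2) a b1 b2 z w h,
       metric = std_metric (n - 2) \<tau>,
       cplx = std_cplx \<rparr>"

text \<open>The encoding reproduces the defining brackets and scalar products on generators.\<close>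

lemma lookup_aJ: "Poly_Mapping.lookup (aJ m c) i = (if i \<in> {1..m} then c i else 0)"
  by (simp add: aJ_def lookup_sum lookup_single when_def)

lemma aJ_cong: "(\<And>i. i \<in> {1..m} \<Longrightarrow> c i = d i) \<Longrightarrow> aJ m c = aJ m d"
  by (simp add: aJ_def)

lemma aJ_zero [simp]: "aJ m (\<lambda>_. 0) = 0"
  by (simp add: aJ_def)

context
  fixes m :: nat and a b1 b2 \<tau> :: real and z w :: "nat \<Rightarrow> complex"
    and h :: "nat \<Rightarrow> nat \<Rightarrow> nat \<Rightarrow> complex"
    and X1 X2 IX1 IX2 :: std_vec and br :: "std_vec \<Rightarrow> std_vec \<Rightarrow> std_vec"
    and g :: "std_vec \<Rightarrow> std_vec \<Rightarrow> real"
  defines "X1 \<equiv> (0, 1, 0, 0, 0)" and "X2 \<equiv> (0, 0, 1, 0, 0)"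
    and "IX1 \<equiv> (0, 0, 0, 1, 0)" and "IX2 \<equiv> (0, 0, 0, 0, 1)"
    and "br \<equiv> std_bracket m a b1 b2 z w h" and "g \<equiv> std_metric m \<tau>"
begin

private lemmas gens = X1_def X2_def IX1_def IX2_def br_def g_def aJ_vec_def

lemma std_cplx_generators:
  "std_cplx X1 = IX1" "std_cplx IX1 = - X1" "std_cplx X2 = IX2" "std_cplx IX2 = - X2"
  "std_cplx (aJ_vec m c) = aJ_vec m (\<lambda>i. \<i> * c i)"
  by (auto simp: gens zero_prod_def lookup_aJ map.rep_eq when_def intro!: poly_mapping_eqI)

lemma std_bracket_generators:
  "br IX1 (aJ_vec m c) = aJ_vec m (\<lambda>i. z i * c i)"
  "br IX2 (aJ_vec m c) = aJ_vec m (\<lambda>i. w i * c i)"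
  "br IX1 X1 = a *\<^sub>R X1 + aJ_vec m (h 1 1)"
  "br IX1 X2 = a *\<^sub>R X2 + aJ_vec m (h 1 2)"
  "br IX2 X1 = a *\<^sub>R X2 + aJ_vec m (h 2 1)"
  "br IX2 X2 = b1 *\<^sub>R X1 + b2 *\<^sub>R X2 + aJ_vec m (h 2 2)"
  "br IX1 IX2 = std_cplx (aJ_vec m (h 1 2) - aJ_vec m (h 2 1))"
  "br X1 X2 = 0" "br X1 (aJ_vec m c) = 0" "br X2 (aJ_vec m c) = 0"
  "br (aJ_vec m c) (aJ_vec m d) = 0"
  by (auto simp: gens zero_prod_def lookup_aJ map.rep_eq when_def lookup_minus
      intro!: poly_mapping_eqI aJ_cong)

lemma std_bracket_antisym: "br p q = - br q p"
proof -
  have minus: "aJ m c = - aJ m d" if "\<And>i. c i = - d i" for c d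
    using that by (auto simp: lookup_aJ intro!: poly_mapping_eqI)
  show ?thesis
    by (cases p; cases q) (auto simp: br_def Let_def algebra_simps intro!: minus)
qed

lemma std_metric_generators:
  "g X1 X1 = 1" "g X2 X2 = 1" "g X1 X2 = 0" "g IX1 IX1 = 1" "g IX2 IX2 = 1" "g IX1 IX2 = 0"
  "g IX1 X1 = 0" "g IX2 X2 = 0" "g IX1 X2 = \<tau>" "g X1 IX2 = - \<tau>"
  "g (aJ_vec m c) X1 = 0" "g (aJ_vec m c) X2 = 0"
  "g (aJ_vec m c) IX1 = 0" "g (aJ_vec m c) IX2 = 0"
  "g (aJ_vec m c) (aJ_vec m d) = (\<Sum>i\<in>{1..m}. Re (c i * cnj (d i)))"
  by (auto simp: gens lookup_aJ)

end


section \<open>Conditions on the parameters\<close>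

definition case_i :: "real \<Rightarrow> real \<Rightarrow> real \<Rightarrow> (nat \<Rightarrow> complex) \<Rightarrow> (nat \<Rightarrow> complex) \<Rightarrow>
    (nat \<Rightarrow> nat \<Rightarrow> nat \<Rightarrow> complex) \<Rightarrow> nat \<Rightarrow> bool" where
  "case_i a b1 b2 z w h i \<longleftrightarrow>
     Re (z i) = 0 \<and> Re (w i) = 0 \<and> z i \<noteq> 0 \<and>
     h 2 1 i = h 1 2 i \<and> h 1 2 i = w i / z i * h 1 1 i \<and>
     h 2 2 i = ((w i)\<^sup>2 - of_real b2 * w i - of_real b1 * z i) / (z i * (z i - of_real a)) * h 1 1 i"

definition case_ii :: "real \<Rightarrow> real \<Rightarrow> real \<Rightarrow> (nat \<Rightarrow> complex) \<Rightarrow> (nat \<Rightarrow> complex) \<Rightarrow>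
    (nat \<Rightarrow> nat \<Rightarrow> nat \<Rightarrow> complex) \<Rightarrow> nat \<Rightarrow> bool" where
  "case_ii a b1 b2 z w h i \<longleftrightarrow>
     z i = 0 \<and> Re (w i) = 0 \<and> w i \<noteq> 0 \<and>
     h 1 1 i = 0 \<and> h 2 1 i = h 1 2 i \<and>
     h 2 2 i = (of_real b2 - w i) / of_real a * h 1 2 i"

text \<open>The formula for \<open>h 1 2 i\<close> in the third case cannot be dropped: given the one for
  \<open>h 2 1 i\<close>, it is equivalent to the \<open>Y\<^sub>i\<close>-component of the Jacobi identity for
  \<open>IX\<^sub>1, IX\<^sub>2, X\<^sub>1\<close>, namely \<open>a h\<^sub>1\<^sub>2 + z\<^sub>i h\<^sub>2\<^sub>1 = a h\<^sub>2\<^sub>1 + w\<^sub>i h\<^sub>1\<^sub>1\<close>.\<close>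

definition case_iii :: "real \<Rightarrow> real \<Rightarrow> real \<Rightarrow> (nat \<Rightarrow> complex) \<Rightarrow> (nat \<Rightarrow> complex) \<Rightarrow>
    (nat \<Rightarrow> nat \<Rightarrow> nat \<Rightarrow> complex) \<Rightarrow> nat \<Rightarrow> bool" where
  "case_iii a b1 b2 z w h i \<longleftrightarrow>
     Re (z i) = - a / 2 \<and>
     2 * (Re (w i))\<^sup>2 + b2 * Re (w i) - b1 / 2 * a = 0 \<and>
     b1 \<ge> - b2\<^sup>2 / (4 * a) \<and>
     h 1 2 i = cnj (w i) / cnj (z i) * h 1 1 i \<and>
     h 2 1 i = (w i * cnj (z i) - of_real a * cnj (w i))
                 / (of_real ((cmod (z i))\<^sup>2) - of_real a * cnj (z i)) * h 1 1 i \<and>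
     h 2 2 i = (of_real ((cmod (w i))\<^sup>2) - of_real b1 * cnj (z i) - of_real b2 * cnj (w i))
                 / (of_real ((cmod (z i))\<^sup>2) - of_real a * cnj (z i)) * h 1 1 i"

text \<open>The scalar equation is the component of \<open>d(J\<^sup>*d\<sigma>) = 0\<close> on \<open>X\<^sub>1, X\<^sub>2, IX\<^sub>1, IX\<^sub>2\<close>.\<close>

definition admissible :: "nat \<Rightarrow> real \<Rightarrow> real \<Rightarrow> real \<Rightarrow> (nat \<Rightarrow> complex) \<Rightarrow> (nat \<Rightarrow> complex) \<Rightarrow>
    (nat \<Rightarrow> nat \<Rightarrow> nat \<Rightarrow> complex) \<Rightarrow> real \<Rightarrow> bool" where
  "admissible n a b1 b2 z w h \<tau> \<longleftrightarrow>
     (let G = std_alg n a b1 b2 z w h \<tau>; H = (\<lambda>j k. aJ_vec (n - 2) (h j k))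
      in a > 0 \<and> b2 \<ge> 0 \<and>
         (\<forall>x\<in>vs G. x \<noteq> 0 \<longrightarrow> metric G x x > 0) \<and>
         2 * a * (a - b1) + (mnorm G (H 1 2 - H 2 1))\<^sup>2 + (mnorm G (H 1 2))\<^sup>2
           + (mnorm G (H 2 1))\<^sup>2 - 2 * metric G (H 1 1) (H 2 2) = 0 \<and>
         (\<forall>i\<in>{1..n - 2}. case_i a b1 b2 z w h i \<or> case_ii a b1 b2 z w h i
                          \<or> case_iii a b1 b2 z w h i))"

end

theory Submission
  imports Defs "HOL-Computational_Algebra.Fundamental_Theorem_Algebra"
begin

text \<open>Let \<open>A\<close> be the commutator ideal and \<open>W = A \<inter> JA\<close>.  Integrability of \<open>J\<close> makes the product
  \<open>X \<cdot> Y = [JX, Y]\<close> on the plane \<open>A / W\<close> commutative and associative, and \<open>A = [\<gg>, \<gg>]\<close> makes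
  it surjective, so there is a unit.  Its direction is \<open>X\<^sub>1\<close>, the inverse of its length is \<open>a\<close>,
  and \<open>X\<^sub>2\<close> is orthogonal to it.  On \<open>W\<close> the operators \<open>D\<^sub>j = [JX\<^sub>j, _]\<close> are complex linear and
  commute, and the SKT condition on \<open>W, W, X\<^sub>j, JX\<^sub>k\<close> reads
  \<open>S(X) D(X') + D(X')\<^sup>* S(X) + S(X' \<cdot> X) = 0\<close> with \<open>S = D + D\<^sup>*\<close>; this forces \<open>D\<^sub>1\<close> and
  \<open>D\<^sub>2\<close> to be simultaneously unitarily diagonalizable.  In the resulting coordinates \<open>J\<^sup>*d\<sigma>\<close> splits
  into one summand for each \<open>Y\<^sub>i\<close> and one for the plane, and \<open>d(J\<^sup>*d\<sigma>) = 0\<close>, being alternating,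
  only has to be compared on basis vectors.\<close>

section \<open>Finite-dimensional subspaces\<close>

text \<open>The unit \<open>e\<close> of the plane dictates the bracket table. For X1 = e/|e|,
  multiplication by X1 is 1/|e| times the identity, commutativity gives the entry for X2 X1, only X2
  X2 = b1 X1 + b2 X2 stays free, and the sign of X2 makes b2 nonnegative. Perfectness acts twice: it
  produces the unit, and it excludes z_i = w_i = 0, which together with the other equations would
  leave Y_i outside the commutator ideal. The obstacle is that the D_j are not known to be normal.
  In a triangular form the SKT identity expresses the squared length of an off-diagonal column as a
  nonpositive quantity, so the column vanishes. Once the D_j are diagonal, projecting to one
  coordinate Y_i and the plane is a homomorphism onto an algebra on C x R^4. Jacobi and SKT then
  hold coordinate by coordinate; the only coupling is the value on X1, X2, IX1, IX2, where all
  contributions add up to the scalar equation. Both directions of the theorem pass through the same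
  equations \<open>diagonal_eqs\<close>, \<open>jacobi_eqs\<close>, \<open>skt_eqs\<close>, so each
  expansion is done once.\<close>

definition fin_dim :: "'v::real_vector set \<Rightarrow> bool" where
  "fin_dim V \<longleftrightarrow> (\<exists>B. finite B \<and> V \<subseteq> span B)"

lemma fin_dim_subset: "fin_dim V \<Longrightarrow> W \<subseteq> V \<Longrightarrow> fin_dim W"
  unfolding fin_dim_def by blast

text \<open>The ambient type may be infinite-dimensional, where \<open>dim\<close> alone guarantees
  no finite basis. The finite spanning set behind \<open>fin_dim\<close> bounds every independent
  subset, and the dimension counts below start from the basis obtained here.\<close>

lemma fin_dim_basis:
  assumes "fin_dim V"
  obtains B where "B \<subseteq> V" "independent B" "V \<subseteq> span B" "finite B" "card B = dim V"
proof -
  obtain B where B: "B \<subseteq> V" "independent B" "V \<subseteq> span B" "card B = dim V"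
    using basis_exists by metis
  obtain C where C: "finite C" "V \<subseteq> span C"
    using assms unfolding fin_dim_def by blast
  have "finite B"
    using independent_span_bound[OF C(1) B(2)] B(1) C(2) by auto
  then show ?thesis using B that by blast
qed

lemma dim_mono_fin:
  assumes "fin_dim W" "V \<subseteq> W"
  shows "dim V \<le> dim W"
proof -
  obtain B where B: "W \<subseteq> span B" "finite B" "card B = dim W"
    using fin_dim_basis[OF assms(1)] by metis
  then show ?thesis using dim_le_card[of V B] assms(2) by auto
qed

lemma fin_dim_span_insert:
  assumes "fin_dim S"
  shows "fin_dim (span (insert x S))"
proof -
  obtain B where B: "finite B" "S \<subseteq> span B" using assms unfolding fin_dim_def by blast
  have "insert x S \<subseteq> span (insert x B)"
    using B span_mono[of B "insert x B"] span_base[of x "insert x B"] by auto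
  then have "span (insert x S) \<subseteq> span (insert x B)" by (rule span_minimal) simp
  then show ?thesis using B(1) unfolding fin_dim_def by blast
qed

lemma dim_span_insert:
  assumes "fin_dim S" "subspace S" "x \<notin> S"
  shows "dim (span (insert x S)) = dim S + 1"
proof -
  obtain B where B: "B \<subseteq> S" "independent B" "S \<subseteq> span B" "finite B" "card B = dim S"
    using fin_dim_basis[OF assms(1)] by metis
  have sB: "span B = S" using B(1,3) assms(2) by (simp add: span_subspace)
  have ind: "independent (insert x B)"
    using B(2) sB assms(3) by (simp add: independent_insertI)
  have "span (insert x S) = span (insert x B)"
  proof (rule antisym)
    show "span (insert x S) \<subseteq> span (insert x B)"
      using sB span_mono[of B "insert x B"] by (intro span_minimal) (auto intro: span_base)
    show "span (insert x B) \<subseteq> span (insert x S)" using B(1) by (intro span_mono) auto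
  qed
  moreover have "x \<notin> B" using B(1) assms(3) by auto
  ultimately show ?thesis
    using dim_span_eq_card_independent[OF ind] B(4,5) by simp
qed

text \<open>Adjoining \<open>e1\<close> and then \<open>e2\<close> raises the dimension by one each
  time. This serves both for IX1, IX2 over the commutator ideal and for one further complex
  coordinate.\<close>

lemma dim_codim_two:
  assumes T: "fin_dim T" "subspace T" and S: "subspace S" "S \<subseteq> T" and e: "e1 \<in> T" "e2 \<in> T"
    and dec: "\<And>p. p \<in> T \<Longrightarrow> \<exists>c d. p - (c *\<^sub>R e1 + d *\<^sub>R e2) \<in> S"
    and ind: "\<And>c d. c *\<^sub>R e1 + d *\<^sub>R e2 \<in> S \<Longrightarrow> c = 0 \<and> d = 0"
  shows "dim T = dim S + 2"
proof -
  have fS: "fin_dim S" using fin_dim_subset T S by blast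
  define U where "U = span (insert e1 S)"
  have "e1 \<notin> S" using ind[of 1 0] by auto
  then have "dim U = dim S + 1" unfolding U_def by (rule dim_span_insert[OF fS S(1)])
  moreover have "e2 \<notin> U"
  proof
    assume "e2 \<in> U"
    then obtain k where "e2 - k *\<^sub>R e1 \<in> span S" unfolding U_def span_breakdown_eq by blast
    then have "(- k) *\<^sub>R e1 + 1 *\<^sub>R e2 \<in> S" using span_eq_iff[THEN iffD2, OF S(1)] by simp
    then show False using ind[of "- k" 1] by simp
  qed
  then have "dim (span (insert e2 U)) = dim U + 1"
    using fin_dim_span_insert[OF fS] by (intro dim_span_insert) (auto simp: U_def)
  moreover have "span (insert e2 U) = T"
  proof (rule antisym)
    have "U \<subseteq> T" unfolding U_def by (rule span_minimal[OF _ T(2)]) (use S e in auto)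
    then show "span (insert e2 U) \<subseteq> T" by (intro span_minimal[OF _ T(2)]) (use e in auto)
    show "T \<subseteq> span (insert e2 U)"
    proof
      fix p assume "p \<in> T"
      then obtain c d where q: "p - (c *\<^sub>R e1 + d *\<^sub>R e2) \<in> S" using dec by blast
      have "S \<union> {e1, e2} \<subseteq> span (insert e2 U)" unfolding U_def by (auto intro!: span_base)
      then have "(p - (c *\<^sub>R e1 + d *\<^sub>R e2)) + (c *\<^sub>R e1 + d *\<^sub>R e2) \<in> span (insert e2 U)"
        using q by (intro span_add span_scale) auto
      then show "p \<in> span (insert e2 U)" by simp
    qed
  qed
  ultimately show ?thesis by simp
qed

lemma dim_less_fin:
  assumes "subspace V" "subspace W" "fin_dim W" "V \<subset> W"
  shows "dim V < dim W"
proof -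
  obtain x where x: "x \<in> W" "x \<notin> V" using assms(4) by blast
  have f: "fin_dim V" using fin_dim_subset assms(3,4) by blast
  have "span (insert x V) \<subseteq> W"
    using x assms by (intro span_minimal) auto
  then have "dim (span (insert x V)) \<le> dim W" by (rule dim_mono_fin[OF assms(3)])
  then show ?thesis using dim_span_insert[OF f assms(1) x(2)] by simp
qed

lemma dim_image_inj_fin:
  fixes f :: "'a::real_vector \<Rightarrow> 'b::real_vector"
  assumes lf: "linear f" and S: "subspace S" "fin_dim S" and inj: "inj_on f S"
  shows "dim (f ` S) = dim S"
proof -
  obtain B where B: "B \<subseteq> S" "independent B" "S \<subseteq> span B" "finite B" "card B = dim S"
    using fin_dim_basis[OF S(2)] by metis
  have sB: "span B = S" using B S by (simp add: span_subspace)
  have ind: "independent (f ` B)"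
    using linear_independent_injective_image[OF lf B(2)] inj sB by simp
  have "f ` S = span (f ` B)" using linear_span_image[OF lf] sB by metis
  then have "dim (f ` S) = card (f ` B)" using dim_span_eq_card_independent[OF ind] by simp
  also have "\<dots> = card B" using inj B(1) by (meson card_image inj_on_subset)
  finally show ?thesis using B by simp
qed

text \<open>The structure maps of a record are controlled only on its carrier. Composing them with
  such a projection makes them linear on the whole type.\<close>

lemma subspace_projection:
  fixes V :: "'a::real_vector set"
  assumes "subspace V"
  obtains p where "linear p" "\<And>x. p x \<in> V" "\<And>x. x \<in> V \<Longrightarrow> p x = x"
proof -
  obtain B where B: "B \<subseteq> V" "independent B" "V \<subseteq> span B" using basis_exists by metis
  have sB: "span B = V" using B assms by (simp add: span_subspace)
  obtain p where p: "range p \<subseteq> span B" "linear p" "\<forall>x\<in>B. p x = id x"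
    using linear_independent_extend_subspace[OF B(2), of id] by auto
  have "p x = id x" if "x \<in> span B" for x
    using linear_eq_on_span[OF p(2) linear_id] p(3) that by blast
  then show ?thesis using that[of p] p(1,2) sB by (metis eq_id_iff id_apply range_subsetD)
qed


section \<open>Hermitian spaces\<close>

text \<open>Linearity and symmetry are required on the whole ambient type, while positivity and the
  remaining properties of \<open>J\<close> are confined to \<open>V\<close>. Expanding sums and
  scalars therefore creates no membership conditions.\<close>

locale hermitian_space =
  fixes V :: "'v::real_vector set" and g :: "'v \<Rightarrow> 'v \<Rightarrow> real" and J :: "'v \<Rightarrow> 'v"
  assumes subspace_V: "subspace V" and fin_dim_V: "fin_dim V"
    and g_add_left: "g (x + y) u = g x u + g y u"
    and g_add_right: "g u (x + y) = g u x + g u y"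
    and g_scale_left: "g (r *\<^sub>R x) y = r * g x y"
    and g_scale_right: "g x (r *\<^sub>R y) = r * g x y"
    and g_sym: "g x y = g y x"
    and g_pos: "x \<in> V \<Longrightarrow> x \<noteq> 0 \<Longrightarrow> g x x > 0"
    and linear_J: "linear J"
    and J_in: "x \<in> V \<Longrightarrow> J x \<in> V"
    and J_J: "x \<in> V \<Longrightarrow> J (J x) = - x"
    and g_J_J: "x \<in> V \<Longrightarrow> y \<in> V \<Longrightarrow> g (J x) (J y) = g x y"
begin

lemmas J_add = linear_add[OF linear_J] and J_scale = linear_scale[OF linear_J]
  and J_diff = linear_diff[OF linear_J] and J_neg = linear_neg[OF linear_J]
  and J_zero [simp] = linear_0[OF linear_J] and J_sum = linear_sum[OF linear_J]

lemmas V_add = subspace_add[OF subspace_V] and V_scale = subspace_scale[OF subspace_V]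
  and V_diff = subspace_diff[OF subspace_V]
  and V_zero [simp] = subspace_0[OF subspace_V] and V_sum = subspace_sum[OF subspace_V]

lemma linear_g_left: "linear (\<lambda>x. g x y)"
  by (rule linearI) (simp_all add: g_add_left g_scale_left)

lemma linear_g_right: "linear (g x)"
  by (rule linearI) (simp_all add: g_add_right g_scale_right)

lemmas g_zero_left [simp] = linear_0[OF linear_g_left]
  and g_zero_right [simp] = linear_0[OF linear_g_right]
  and g_neg_left = linear_neg[OF linear_g_left] and g_neg_right = linear_neg[OF linear_g_right]
  and g_diff_left = linear_diff[OF linear_g_left] and g_diff_right = linear_diff[OF linear_g_right]

lemmas g_linear = g_add_left g_add_right g_scale_left g_scale_right g_neg_left g_neg_right
  g_diff_left g_diff_right

lemma g_eq_0_iff: "x \<in> V \<Longrightarrow> g x x = 0 \<longleftrightarrow> x = 0"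
  using g_pos[of x] by (cases "x = 0") auto

lemma g_nonneg: "x \<in> V \<Longrightarrow> g x x \<ge> 0"
  using g_pos[of x] by (cases "x = 0") auto

lemma g_J_left: "x \<in> V \<Longrightarrow> y \<in> V \<Longrightarrow> g (J x) y = - g x (J y)"
  using g_J_J[of x "J y"] J_J[of y] J_in[of y] by (simp add: g_linear)

lemma g_J_self [simp]: "x \<in> V \<Longrightarrow> g x (J x) = 0" "x \<in> V \<Longrightarrow> g (J x) x = 0"
  using g_J_left[of x x] g_sym[of x "J x"] by auto

text \<open>Multiplication by a complex number on a real vector space in which \<open>J\<close>
  plays the part of i.\<close>

definition cs :: "complex \<Rightarrow> 'v \<Rightarrow> 'v" where
  "cs c x = Re c *\<^sub>R x + Im c *\<^sub>R J x"

text \<open>The Hermitian form with real part \<open>g\<close>. The sign of the imaginary part makes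
  it complex linear in the first argument and conjugate linear in the second.\<close>

definition hm :: "'v \<Rightarrow> 'v \<Rightarrow> complex" where
  "hm x y = Complex (g x y) (g x (J y))"

lemma cs_in: "subspace W \<Longrightarrow> (\<And>y. y \<in> W \<Longrightarrow> J y \<in> W) \<Longrightarrow> x \<in> W \<Longrightarrow> cs c x \<in> W"
  unfolding cs_def by (simp add: subspace_add subspace_scale)

lemma cs_in_V: "x \<in> V \<Longrightarrow> cs c x \<in> V"
  by (rule cs_in) (auto simp: subspace_V J_in)

lemma linear_cs: "linear (cs c)"
  unfolding cs_def by (rule linearI) (simp_all add: J_add J_scale algebra_simps)

lemmas cs_add = linear_add[OF linear_cs] and cs_scale = linear_scale[OF linear_cs]
  and cs_zero_right [simp] = linear_0[OF linear_cs] and cs_sum = linear_sum[OF linear_cs]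

lemma cs_add_left: "cs (c + d) x = cs c x + cs d x"
  unfolding cs_def by (simp add: algebra_simps)

lemma cs_zero_left [simp]: "cs 0 x = 0"
  unfolding cs_def by simp

lemma cs_one [simp]: "cs 1 x = x"
  unfolding cs_def by simp

lemma cs_scale_left: "cs (of_real r * c) x = r *\<^sub>R cs c x"
  unfolding cs_def by (simp add: algebra_simps)

lemma cs_of_real: "cs (of_real r) x = r *\<^sub>R x"
  unfolding cs_def by simp

lemma cs_i: "cs \<i> x = J x"
  unfolding cs_def by simp

lemma cs_neg_left: "cs (- c) x = - cs c x"
  unfolding cs_def by simp

lemma cs_diff_left: "cs (c - d) x = cs c x - cs d x"
  unfolding cs_def by (simp add: algebra_simps)

lemma cs_cs: "x \<in> V \<Longrightarrow> cs c (cs d x) = cs (c * d) x"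
  unfolding cs_def by (simp add: J_add J_scale J_J algebra_simps)

lemma cs_J: "cs c (J x) = J (cs c x)"
  unfolding cs_def by (simp add: J_add J_scale)

lemma cs_eq_0:
  assumes "x \<in> V" "cs c x = 0" "c \<noteq> 0" shows "x = 0"
  using cs_cs[of x "inverse c" c] assms by simp

lemma commutes_cs:
  assumes "linear T" "T (J x) = J (T x)"
  shows "T (cs c x) = cs c (T x)"
  using assms unfolding cs_def by (simp add: linear_add linear_scale)

lemma hm_add_left: "hm (x + y) u = hm x u + hm y u"
  unfolding hm_def by (simp add: g_linear complex_eq_iff)

lemma hm_add_right: "hm u (x + y) = hm u x + hm u y"
  unfolding hm_def by (simp add: g_linear J_add complex_eq_iff)

lemma linear_hm_left: "linear (\<lambda>x. hm x u)"
  unfolding hm_def by (rule linearI) (simp_all add: g_linear complex_eq_iff)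

lemma linear_hm_right: "linear (hm u)"
  unfolding hm_def by (rule linearI) (simp_all add: g_linear J_add J_scale complex_eq_iff)

lemmas hm_sum_left = linear_sum[OF linear_hm_left] and hm_sum_right = linear_sum[OF linear_hm_right]
  and hm_diff_left = linear_diff[OF linear_hm_left] and hm_diff_right = linear_diff[OF linear_hm_right]
  and hm_scale_left = linear_scale[OF linear_hm_left]
  and hm_scale_right = linear_scale[OF linear_hm_right]
  and hm_zero_left [simp] = linear_0[OF linear_hm_left]
  and hm_zero_right [simp] = linear_0[OF linear_hm_right]

lemma hm_J_left: "x \<in> V \<Longrightarrow> y \<in> V \<Longrightarrow> hm (J x) y = \<i> * hm x y"
  unfolding hm_def by (simp add: complex_eq_iff g_J_left g_J_J)

lemma hm_commute: "x \<in> V \<Longrightarrow> y \<in> V \<Longrightarrow> hm y x = cnj (hm x y)"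
  unfolding hm_def using g_J_left[of x y] by (simp add: complex_eq_iff g_sym[of y])

lemma hm_J_right: "x \<in> V \<Longrightarrow> y \<in> V \<Longrightarrow> hm x (J y) = - \<i> * hm x y"
  unfolding hm_def by (simp add: complex_eq_iff J_J g_linear)

lemma hm_cs_left: "x \<in> V \<Longrightarrow> y \<in> V \<Longrightarrow> hm (cs c x) y = c * hm x y"
  unfolding cs_def
  by (simp add: hm_add_left hm_scale_left hm_J_left scaleR_conv_of_real)
     (simp add: complex_eq_iff algebra_simps)

lemma hm_cs_right: "x \<in> V \<Longrightarrow> y \<in> V \<Longrightarrow> hm x (cs c y) = cnj c * hm x y"
  unfolding cs_def
  by (simp add: hm_add_right hm_scale_right hm_J_right scaleR_conv_of_real)
     (simp add: complex_eq_iff algebra_simps)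

lemma hm_self: "x \<in> V \<Longrightarrow> hm x x = of_real (g x x)"
  unfolding hm_def by (simp add: complex_eq_iff)

lemma hm_self_eq_0: "x \<in> V \<Longrightarrow> hm x x = 0 \<longleftrightarrow> x = 0"
  by (simp add: hm_self g_eq_0_iff)

definition complex_subspace :: "'v set \<Rightarrow> bool" where
  "complex_subspace W \<longleftrightarrow> subspace W \<and> W \<subseteq> V \<and> (\<forall>x\<in>W. J x \<in> W)"

lemma complex_subspace_cs: "complex_subspace W \<Longrightarrow> x \<in> W \<Longrightarrow> cs c x \<in> W"
  unfolding complex_subspace_def using cs_in by blast

lemma complex_subspace_perp:
  assumes "complex_subspace W" "v \<in> V"
  shows "complex_subspace {y \<in> W. hm y v = 0}"
  unfolding complex_subspace_def
proof (intro conjI ballI)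
  show "subspace {y \<in> W. hm y v = 0}"
    using assms(1) unfolding complex_subspace_def subspace_def
    by (auto simp: hm_add_left hm_scale_left)
qed (use assms in \<open>auto simp: complex_subspace_def hm_J_left subsetD\<close>)

lemma dim_perp_less:
  assumes "complex_subspace W" "v \<in> W" "v \<noteq> 0"
  shows "dim {y \<in> W. hm y v = 0} < dim W"
proof (rule dim_less_fin)
  have v: "v \<in> V" using assms unfolding complex_subspace_def by blast
  show "subspace {y \<in> W. hm y v = 0}"
    using complex_subspace_perp[OF assms(1) v] unfolding complex_subspace_def by blast
  show "subspace W" "fin_dim W"
    using assms fin_dim_subset[OF fin_dim_V] unfolding complex_subspace_def by blast+
  show "{y \<in> W. hm y v = 0} \<subset> W"
    using assms(2,3) v hm_self_eq_0 by auto
qed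

text \<open>The indices are those of the Y_i in the standard algebra. Spanning is stated as the
  Fourier expansion, the form in which it is applied.\<close>

definition unitary_basis :: "'v set \<Rightarrow> nat \<Rightarrow> (nat \<Rightarrow> 'v) \<Rightarrow> bool" where
  "unitary_basis W m Y \<longleftrightarrow> (\<forall>i\<in>{1..m}. Y i \<in> W) \<and>
     (\<forall>i\<in>{1..m}. \<forall>j\<in>{1..m}. hm (Y i) (Y j) = (if i = j then 1 else 0)) \<and>
     (\<forall>x\<in>W. x = (\<Sum>i\<in>{1..m}. cs (hm x (Y i)) (Y i)))"

lemma exists_unit:
  assumes "complex_subspace W" "x \<in> W" "x \<noteq> 0"
  obtains c where "c > 0" "hm (c *\<^sub>R x) (c *\<^sub>R x) = 1"
proof -
  have x: "x \<in> V" using assms unfolding complex_subspace_def by blast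
  have p: "g x x > 0" using g_pos x assms(3) by blast
  have "hm ((1 / sqrt (g x x)) *\<^sub>R x) ((1 / sqrt (g x x)) *\<^sub>R x) = of_real (1 / sqrt (g x x) * (1 / sqrt (g x x)) * g x x)"
    using V_scale[OF x] by (simp add: hm_self g_linear)
  also have "1 / sqrt (g x x) * (1 / sqrt (g x x)) * g x x = 1"
    using p by (simp add: field_simps)
  finally show ?thesis using that[of "1 / sqrt (g x x)"] p by simp
qed

lemma unitary_basis_extend:
  assumes W: "complex_subspace W" and v: "v \<in> W" "hm v v = 1"
    and Y: "unitary_basis {y \<in> W. hm y v = 0} m Y"
  shows "unitary_basis W (Suc m) (Y(Suc m := v))"
proof -
  have WV: "x \<in> W \<Longrightarrow> x \<in> V" for x using W unfolding complex_subspace_def by blast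
  have YW: "Y i \<in> W" "hm (Y i) v = 0" "Y i \<in> V" if "i \<in> {1..m}" for i
    using Y that WV unfolding unitary_basis_def by auto
  have Yv: "hm v (Y i) = 0" if "i \<in> {1..m}" for i
    using hm_commute[of "Y i" v] YW[OF that] v WV by simp
  have *: "{1..Suc m} = insert (Suc m) {1..m}" by auto
  have ne: "i \<in> {1..m} \<Longrightarrow> i \<noteq> Suc m" for i by auto
  have "x = (\<Sum>i\<in>{1..Suc m}. cs (hm x ((Y(Suc m := v)) i)) ((Y(Suc m := v)) i))" if "x \<in> W" for x
  proof -
    define y where "y = x - cs (hm x v) v"
    have yW: "y \<in> W" unfolding y_def using W that v complex_subspace_cs[OF W]
      unfolding complex_subspace_def by (simp add: subspace_diff)
    have "hm y v = 0" unfolding y_def using v WV by (simp add: hm_diff_left hm_cs_left)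
    then have "y = (\<Sum>i\<in>{1..m}. cs (hm y (Y i)) (Y i))"
      using Y yW unfolding unitary_basis_def by simp
    also have "\<dots> = (\<Sum>i\<in>{1..m}. cs (hm x (Y i)) (Y i))"
      unfolding y_def using v WV YW Yv by (intro sum.cong) (auto simp: hm_diff_left hm_cs_left)
    finally have "x = cs (hm x v) v + (\<Sum>i\<in>{1..m}. cs (hm x (Y i)) (Y i))"
      unfolding y_def by (simp add: algebra_simps)
    also have "(\<Sum>i\<in>{1..m}. cs (hm x (Y i)) (Y i)) =
        (\<Sum>i\<in>{1..m}. cs (hm x ((Y(Suc m := v)) i)) ((Y(Suc m := v)) i))"
      by (intro sum.cong) auto
    finally show ?thesis unfolding * by simp
  qed
  then show ?thesis
    using Y v YW Yv unfolding unitary_basis_def * by (auto simp: ne)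
qed

text \<open>Induction on the real dimension: a normalized vector is split off, and its
  \<open>hm\<close>-complement is again a complex subspace, of smaller dimension.\<close>

lemma unitary_basis_exists:
  assumes "complex_subspace W"
  obtains m Y where "unitary_basis W m Y"
proof -
  have "\<exists>m Y. unitary_basis W m Y"
    using assms
  proof (induction "dim W" arbitrary: W rule: less_induct)
    case less
    show ?case
    proof (cases "W = {0}")
      case True
      then have "unitary_basis W 0 (\<lambda>_. 0)" unfolding unitary_basis_def by simp
      then show ?thesis by blast
    next
      case False
      have sub: "subspace W" using less(2) unfolding complex_subspace_def by blast
      then obtain x where x: "x \<in> W" "x \<noteq> 0" using False subspace_0 by blast
      then obtain c where c: "c > 0" "hm (c *\<^sub>R x) (c *\<^sub>R x) = 1"
        using exists_unit[OF less(2)] by metis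
      have v: "c *\<^sub>R x \<in> W" "c *\<^sub>R x \<noteq> 0" "c *\<^sub>R x \<in> V"
        using x c sub less(2) unfolding complex_subspace_def by (auto simp: subspace_scale)
      obtain m Y where "unitary_basis {y \<in> W. hm y (c *\<^sub>R x) = 0} m Y"
        using less(1)[OF dim_perp_less[OF less(2) v(1,2)] complex_subspace_perp[OF less(2) v(3)]] by blast
      from unitary_basis_extend[OF less(2) v(1) c(2) this] show ?thesis by blast
    qed
  qed
  then show ?thesis using that by blast
qed

end

section \<open>Simultaneous diagonalization\<close>

text \<open>Half of the SKT identity on W at a common unit eigenvector with eigenvalues z, w, for
  the pairs (X1, X1), (X1, X2), (X2, X2). For a > 0 the first equation leaves Re z = 0 or Re z =
  -a/2, which is the origin of the case distinction.\<close>

definition diagonal_eqs :: "real \<Rightarrow> real \<Rightarrow> real \<Rightarrow> complex \<Rightarrow> complex \<Rightarrow> bool" where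
  "diagonal_eqs a b1 b2 z w \<longleftrightarrow> 2 * (Re z)\<^sup>2 + a * Re z = 0 \<and> 2 * Re z * Re w + a * Re w = 0 \<and>
     2 * (Re w)\<^sup>2 + b1 * Re z + b2 * Re w = 0"

context hermitian_space
begin

text \<open>Linearity is global, invariance and commutation with \<open>J\<close> are local to
  \<open>W\<close>. The same map can thus be restricted to a smaller subspace without being
  redefined.\<close>

definition complex_endo :: "'v set \<Rightarrow> ('v \<Rightarrow> 'v) \<Rightarrow> bool" where
  "complex_endo W T \<longleftrightarrow> linear T \<and> (\<forall>x\<in>W. T x \<in> W) \<and> (\<forall>x\<in>W. T (J x) = J (T x))"

lemma complex_endo_cs: "complex_endo W T \<Longrightarrow> x \<in> W \<Longrightarrow> T (cs c x) = cs c (T x)"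
  unfolding complex_endo_def by (simp add: commutes_cs)

lemma complex_endo_in: "complex_endo W T \<Longrightarrow> x \<in> W \<Longrightarrow> T x \<in> W"
  unfolding complex_endo_def by blast

lemma complex_endo_sum:
  assumes T: "complex_endo W T" and y: "\<And>i. i \<in> I \<Longrightarrow> y i \<in> W"
  shows "T (\<Sum>i\<in>I. cs (c i) (y i)) = (\<Sum>i\<in>I. cs (c i) (T (y i)))"
proof -
  have "T (\<Sum>i\<in>I. cs (c i) (y i)) = (\<Sum>i\<in>I. T (cs (c i) (y i)))"
    using T unfolding complex_endo_def by (simp add: linear_sum)
  also have "\<dots> = (\<Sum>i\<in>I. cs (c i) (T (y i)))"
    by (intro sum.cong refl complex_endo_cs[OF T y])
  finally show ?thesis .
qed

section \<open>Eigenvectors and adjoints of complex linear maps\<close>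

lemma funpow_in:
  assumes "complex_endo W T" "x \<in> W"
  shows "(T ^^ i) x \<in> W"
  by (induction i) (simp_all add: assms complex_endo_in[OF assms(1)])

definition poly_act :: "('v \<Rightarrow> 'v) \<Rightarrow> complex poly \<Rightarrow> 'v \<Rightarrow> 'v" where
  "poly_act T p x = (\<Sum>i\<le>degree p. cs (coeff p i) ((T ^^ i) x))"

lemma poly_act_bound:
  assumes "degree p \<le> N"
  shows "poly_act T p x = (\<Sum>i\<le>N. cs (coeff p i) ((T ^^ i) x))"
  unfolding poly_act_def using assms
  by (intro sum.mono_neutral_left) (auto simp: coeff_eq_0)

lemma poly_act_linear_factor:
  assumes T: "complex_endo W T" and W: "complex_subspace W" and x: "x \<in> W"
  shows "poly_act T ([:- l, 1:] * q) x = T (poly_act T q x) - cs l (poly_act T q x)"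
proof -
  define N where "N = degree q"
  have WV: "y \<in> W \<Longrightarrow> y \<in> V" for y using W unfolding complex_subspace_def by blast
  have pw: "(T ^^ i) x \<in> W" for i
    by (rule funpow_in[OF T x])
  have deg: "degree ([:- l, 1:] * q) \<le> Suc N"
    by (rule order.trans[OF degree_mult_le]) (simp add: N_def)
  have "poly_act T ([:- l, 1:] * q) x
      = (\<Sum>i\<le>Suc N. cs (coeff (pCons 0 q) i) ((T ^^ i) x)) - (\<Sum>i\<le>Suc N. cs (l * coeff q i) ((T ^^ i) x))"
    unfolding poly_act_bound[OF deg] sum_subtractf[symmetric]
    by (intro sum.cong) (simp_all add: cs_diff_left[symmetric] cs_neg_left[symmetric] cs_add_left[symmetric] algebra_simps)
  also have "(\<Sum>i\<le>Suc N. cs (coeff (pCons 0 q) i) ((T ^^ i) x)) = T (poly_act T q x)"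
    unfolding sum.atMost_Suc_shift poly_act_def N_def
    using T by (simp add: complex_endo_def linear_sum complex_endo_cs[OF T pw])
  also have "(\<Sum>i\<le>Suc N. cs (l * coeff q i) ((T ^^ i) x)) = cs l (poly_act T q x)"
  proof -
    have "poly_act T q x = (\<Sum>i\<le>Suc N. cs (coeff q i) ((T ^^ i) x))"
      by (rule poly_act_bound) (simp add: N_def)
    then have "cs l (poly_act T q x) = (\<Sum>i\<le>Suc N. cs l (cs (coeff q i) ((T ^^ i) x)))"
      by (simp only: cs_sum)
    also have "\<dots> = (\<Sum>i\<le>Suc N. cs (l * coeff q i) ((T ^^ i) x))"
      by (intro sum.cong refl cs_cs WV pw)
    finally show ?thesis by simp
  qed
  finally show ?thesis .
qed

lemma poly_act_in:
  assumes "complex_endo W T" "complex_subspace W" "x \<in> W"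
  shows "poly_act T q x \<in> W"
proof -
  have "(T ^^ i) x \<in> W" for i
    by (rule funpow_in[OF assms(1,3)])
  then show ?thesis unfolding poly_act_def
    using assms(2) complex_subspace_cs[OF assms(2)] by (intro subspace_sum) (auto simp: complex_subspace_def)
qed

text \<open>Write p = (X - l) q for a root l. Either q(T) x vanishes and q has smaller degree, or
  q(T) x is an eigenvector for l.\<close>

lemma eigenvector_of_annihilator:
  assumes T: "complex_endo W T" and W: "complex_subspace W" and x: "x \<in> W" "x \<noteq> 0"
    and p: "p \<noteq> 0" "poly_act T p x = 0"
  shows "\<exists>y l. y \<in> W \<and> y \<noteq> 0 \<and> T y = cs l y"
  using p
proof (induction "degree p" arbitrary: p rule: less_induct)
  case less
  show ?case
  proof (cases "degree p = 0")
    case True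
    then obtain c where c: "p = [:c:]" by (meson degree_eq_zeroE)
    then have "cs c x = 0" using less(3) by (simp add: poly_act_def)
    then have False using cs_eq_0[of x c] c less(2) x W unfolding complex_subspace_def by auto
    then show ?thesis ..
  next
    case False
    then have "\<not> constant (poly p)" by (simp add: constant_degree)
    then obtain l where "poly p l = 0" using fundamental_theorem_of_algebra by blast
    then obtain q where q: "p = [:- l, 1:] * q" by (metis dvdE poly_eq_0_iff_dvd)
    have q0: "q \<noteq> 0" using q less(2) by auto
    have dq: "degree q < degree p" unfolding q using q0 by (subst degree_mult_eq) auto
    show ?thesis
    proof (cases "poly_act T q x = 0")
      case True
      then show ?thesis using less(1)[OF dq q0] by blast
    next
      case False
      have "T (poly_act T q x) = cs l (poly_act T q x)"
        using poly_act_linear_factor[OF T W x(1)] less(3) q by simp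
      then show ?thesis using poly_act_in[OF T W x(1)] False by blast
    qed
  qed
qed

text \<open>The N + 1 vectors x, T x, ..., T^N x, with N the real dimension of \<open>W\<close>,
  satisfy a real linear relation. Its coefficients form an annihilating polynomial, whose roots are
  then taken in the complex numbers.\<close>

lemma eigenvector_exists:
  assumes T: "complex_endo W T" and W: "complex_subspace W" and ne: "W \<noteq> {0}"
  obtains v l where "v \<in> W" "v \<noteq> 0" "T v = cs l v"
proof -
  have sub: "subspace W" using W unfolding complex_subspace_def by blast
  then obtain x where x: "x \<in> W" "x \<noteq> 0" using ne subspace_0 by blast
  have fd: "fin_dim W" using W fin_dim_subset[OF fin_dim_V] unfolding complex_subspace_def by blast
  define N where "N = dim W"
  have pw: "(T ^^ i) x \<in> W" for i
    by (rule funpow_in[OF T x(1)])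
  have "\<exists>u. (\<exists>i\<le>N. u i \<noteq> 0) \<and> (\<Sum>i\<le>N. u i *\<^sub>R (T ^^ i) x) = 0"
  proof (cases "inj_on (\<lambda>i. (T ^^ i) x) {..N}")
    case True
    define S where "S = (\<lambda>i. (T ^^ i) x) ` {..N}"
    obtain B where B: "W \<subseteq> span B" "finite B" "card B = dim W" using fin_dim_basis[OF fd] by metis
    have cS: "card S = Suc N" unfolding S_def using True by (simp add: card_image)
    have "dependent S"
    proof (rule ccontr)
      assume "independent S"
      moreover have "S \<subseteq> span B" unfolding S_def using pw B by auto
      ultimately show False using independent_span_bound[OF B(2)] B(3) cS N_def by fastforce
    qed
    then obtain u where u: "\<exists>v\<in>S. u v \<noteq> 0" "(\<Sum>v\<in>S. u v *\<^sub>R v) = 0"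
      using dependent_finite[of S] unfolding S_def by auto
    have "(\<Sum>i\<le>N. u ((T ^^ i) x) *\<^sub>R (T ^^ i) x) = 0"
      using u(2) True unfolding S_def by (simp add: sum.reindex)
    then show ?thesis using u(1) unfolding S_def by (intro exI[of _ "\<lambda>i. u ((T ^^ i) x)"]) auto
  next
    case False
    then obtain i j where ij: "i \<le> N" "j \<le> N" "i \<noteq> j" "(T ^^ i) x = (T ^^ j) x"
      unfolding inj_on_def by auto
    \<comment> \<open>Linear dependence speaks of a set of vectors, so coinciding powers are a case
      of their own; the relation is then X^i - X^j.\<close>
    define u where "u = (\<lambda>k. (if k = i then 1 else 0) - (if k = j then 1 else (0::real)))"
    have "(\<Sum>k\<le>N. u k *\<^sub>R (T ^^ k) x)
        = (\<Sum>k\<le>N. (if k = i then (T ^^ k) x else 0)) - (\<Sum>k\<le>N. (if k = j then (T ^^ k) x else 0))"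
      unfolding u_def sum_subtractf[symmetric] by (intro sum.cong) (auto simp: algebra_simps)
    also have "\<dots> = 0" using ij by (simp add: sum.delta)
    finally show ?thesis using ij by (intro exI[of _ u]) (auto simp: u_def)
  qed
  then obtain u where u: "\<exists>i\<le>N. u i \<noteq> 0" "(\<Sum>i\<le>N. u i *\<^sub>R (T ^^ i) x) = 0" by blast
  define p where "p = (\<Sum>i\<le>N. monom (complex_of_real (u i)) i)"
  have cp: "coeff p i = (if i \<le> N then of_real (u i) else 0)" for i
    unfolding p_def by (simp add: coeff_sum sum.delta')
  have deg: "degree p \<le> N" by (rule degree_le) (simp add: cp)
  have "poly_act T p x = 0"
    unfolding poly_act_bound[OF deg] using u(2) by (simp add: cp cs_of_real)
  moreover have "p \<noteq> 0" using u(1) cp by (metis coeff_0 of_real_eq_0_iff)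
  ultimately show ?thesis using eigenvector_of_annihilator[OF T W x] that by blast
qed

text \<open>An eigenspace of \<open>T\<close> is a complex subspace preserved by every
  \<open>S\<close> commuting with \<open>T\<close>, so \<open>S\<close> has an eigenvector in
  it.\<close>

lemma common_eigenvector_exists:
  assumes T: "complex_endo W T" and S: "complex_endo W S" and W: "complex_subspace W"
    and ne: "W \<noteq> {0}" and comm: "\<And>x. x \<in> W \<Longrightarrow> T (S x) = S (T x)"
  obtains v l k where "v \<in> W" "v \<noteq> 0" "T v = cs l v" "S v = cs k v"
proof -
  obtain v l where v: "v \<in> W" "v \<noteq> 0" "T v = cs l v" using eigenvector_exists[OF T W ne] by blast
  define E where "E = {x \<in> W. T x = cs l x}"
  have lin: "linear T" "linear S" using T S unfolding complex_endo_def by auto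
  have E: "complex_subspace E"
    unfolding complex_subspace_def
  proof (intro conjI ballI)
    show "subspace E" using W lin unfolding complex_subspace_def E_def subspace_def
      by (auto simp: linear_0 linear_add linear_scale cs_add cs_scale)
    show "E \<subseteq> V" using W unfolding complex_subspace_def E_def by auto
    show "J x \<in> E" if "x \<in> E" for x
      using W T that unfolding complex_subspace_def E_def complex_endo_def by (auto simp: cs_J)
  qed
  have "complex_endo E S" using S comm complex_endo_cs[OF S] unfolding complex_endo_def E_def
    by auto
  moreover have "E \<noteq> {0}" using v unfolding E_def by auto
  ultimately obtain y k where "y \<in> E" "y \<noteq> 0" "S y = cs k y" using eigenvector_exists[OF _ E] by blast
  then show ?thesis using that unfolding E_def by blast
qed

text \<open>On a unitary basis the adjoint is forced to be y |-> sum of <y, T Y_i> Y_i, and this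
  formula is taken as its definition.\<close>

lemma adjoint_exists:
  assumes T: "complex_endo W T" and W: "complex_subspace W"
  obtains A where "complex_endo W A" "\<And>x y. x \<in> W \<Longrightarrow> y \<in> W \<Longrightarrow> hm (T x) y = hm x (A y)"
proof -
  obtain m Y where Y: "unitary_basis W m Y" using unitary_basis_exists[OF W] by blast
  have WV: "y \<in> W \<Longrightarrow> y \<in> V" for y using W unfolding complex_subspace_def by blast
  have YW: "i \<in> {1..m} \<Longrightarrow> Y i \<in> W" for i using Y unfolding unitary_basis_def by blast
  have TW: "x \<in> W \<Longrightarrow> T x \<in> W" for x using T unfolding complex_endo_def by blast
  define A where "A = (\<lambda>y. \<Sum>i\<in>{1..m}. cs (hm y (T (Y i))) (Y i))"
  have "complex_endo W A"
    unfolding complex_endo_def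
  proof (intro conjI ballI)
    show "linear A" unfolding A_def
      by (rule linearI) (simp_all add: hm_add_left cs_add_left sum.distrib hm_scale_left
          scaleR_conv_of_real cs_scale_left scaleR_sum_right)
    show "A x \<in> W" if "x \<in> W" for x
      unfolding A_def using W complex_subspace_cs[OF W YW]
      by (intro subspace_sum) (auto simp: complex_subspace_def)
    show "A (J x) = J (A x)" if "x \<in> W" for x
      unfolding A_def J_sum using that WV TW YW
      by (intro sum.cong) (simp_all add: hm_J_left cs_cs[symmetric] cs_i)
  qed
  moreover have "hm (T x) y = hm x (A y)" if "x \<in> W" "y \<in> W" for x y
  proof -
    have "x = (\<Sum>i\<in>{1..m}. cs (hm x (Y i)) (Y i))" using Y that unfolding unitary_basis_def by blast
    then have "T x = T (\<Sum>i\<in>{1..m}. cs (hm x (Y i)) (Y i))" by (rule arg_cong)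
    also have "\<dots> = (\<Sum>i\<in>{1..m}. cs (hm x (Y i)) (T (Y i)))" by (rule complex_endo_sum[OF T YW])
    finally have "hm (T x) y = (\<Sum>i\<in>{1..m}. hm x (Y i) * hm (T (Y i)) y)"
      using that WV TW YW by (simp add: hm_sum_left hm_cs_left)
    also have "\<dots> = (\<Sum>i\<in>{1..m}. cnj (hm y (T (Y i))) * hm x (Y i))"
      using that WV TW YW by (intro sum.cong) (simp_all add: hm_commute[of y])
    also have "\<dots> = hm x (A y)" unfolding A_def
      using that WV YW by (simp add: hm_sum_right hm_cs_right)
    finally show ?thesis .
  qed
  ultimately show ?thesis using that by blast
qed

text \<open>The common eigenvector is one of the adjoints, so that its complement is invariant.\<close>

lemma invariant_hyperplane_exists:
  assumes T: "complex_endo W T" and S: "complex_endo W S" and W: "complex_subspace W"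
    and ne: "W \<noteq> {0}" and comm: "\<And>x. x \<in> W \<Longrightarrow> T (S x) = S (T x)"
  obtains v where "v \<in> W" "hm v v = 1" "complex_endo {y \<in> W. hm y v = 0} T"
    "complex_endo {y \<in> W. hm y v = 0} S"
proof -
  have WV: "y \<in> W \<Longrightarrow> y \<in> V" for y using W unfolding complex_subspace_def by blast
  obtain A where A: "complex_endo W A" "\<And>x y. x \<in> W \<Longrightarrow> y \<in> W \<Longrightarrow> hm (T x) y = hm x (A y)"
    using adjoint_exists[OF T W] by metis
  obtain B where B: "complex_endo W B" "\<And>x y. x \<in> W \<Longrightarrow> y \<in> W \<Longrightarrow> hm (S x) y = hm x (B y)"
    using adjoint_exists[OF S W] by metis
  have in_W: "x \<in> W \<Longrightarrow> T x \<in> W" "x \<in> W \<Longrightarrow> S x \<in> W" "x \<in> W \<Longrightarrow> A x \<in> W" "x \<in> W \<Longrightarrow> B x \<in> W" for x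
    using T S A(1) B(1) unfolding complex_endo_def by auto
  have sub: "subspace W" using W unfolding complex_subspace_def by blast
  have "A (B x) = B (A x)" if x: "x \<in> W" for x
  proof -
    \<comment> \<open>The commutator of the adjoints is tested against itself: moving both adjoints
      to the other side turns hm d d into the commutator of \<open>T\<close> and \<open>S\<close> at
      \<open>d\<close>.\<close>
    define d where "d = A (B x) - B (A x)"
    have d: "d \<in> W" unfolding d_def using in_W x sub by (simp add: subspace_diff)
    have "hm d d = hm d (A (B x)) - hm d (B (A x))" unfolding d_def by (simp add: hm_diff_right)
    also have "\<dots> = hm (S (T d)) x - hm (T (S d)) x"
      using A(2) B(2) in_W x d by metis
    also have "\<dots> = 0" using comm[OF d] by simp
    finally show ?thesis using hm_self_eq_0[of d] WV d unfolding d_def by simp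
  qed
  then obtain v l k where v: "v \<in> W" "v \<noteq> 0" "A v = cs l v" "B v = cs k v"
    using common_eigenvector_exists[OF A(1) B(1) W ne] by blast
  obtain c where c: "c > 0" "hm (c *\<^sub>R v) (c *\<^sub>R v) = 1" using exists_unit[OF W v(1,2)] by metis
  define u where "u = c *\<^sub>R v"
  have u: "u \<in> W" "u \<in> V" unfolding u_def using v(1) sub WV by (auto simp: subspace_scale)
  have lin: "linear A" "linear B" using A(1) B(1) unfolding complex_endo_def by auto
  have Au: "A u = cs l u" "B u = cs k u"
    unfolding u_def using v lin by (simp_all add: linear_scale cs_scale)
  have "hm (T y) u = 0" "hm (S y) u = 0" if "y \<in> W" "hm y u = 0" for y
    using A(2)[of y u] B(2)[of y u] Au u that WV by (simp_all add: hm_cs_right)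
  then have "complex_endo {y \<in> W. hm y u = 0} T" "complex_endo {y \<in> W. hm y u = 0} S"
    using T S unfolding complex_endo_def by auto
  then show ?thesis using that u c unfolding u_def by blast
qed

text \<open>The sesquilinear form of \<open>D + D\<^sup>*\<close>, written without choosing an
  adjoint, so that the operator identity becomes an equation between forms.\<close>

definition sym_form :: "('v \<Rightarrow> 'v) \<Rightarrow> 'v \<Rightarrow> 'v \<Rightarrow> complex" where
  "sym_form D x y = hm (D x) y + hm x (D y)"

lemma unitary_basis_eigen_component:
  assumes W: "complex_subspace W" and Y: "unitary_basis W m Y" and D: "complex_endo W D"
    and e: "\<And>i. i \<in> {1..m} \<Longrightarrow> D (Y i) = cs (z i) (Y i)"
    and r: "r \<in> W" and i: "i \<in> {1..m}"
  shows "hm (D r) (Y i) = z i * hm r (Y i)"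
proof -
  have YV: "j \<in> {1..m} \<Longrightarrow> Y j \<in> W" "j \<in> {1..m} \<Longrightarrow> Y j \<in> V" for j
    using Y W unfolding unitary_basis_def complex_subspace_def by auto
  have "r = (\<Sum>j\<in>{1..m}. cs (hm r (Y j)) (Y j))" using Y r unfolding unitary_basis_def by blast
  then have "D r = D (\<Sum>j\<in>{1..m}. cs (hm r (Y j)) (Y j))" by (rule arg_cong)
  also have "\<dots> = (\<Sum>j\<in>{1..m}. cs (hm r (Y j)) (D (Y j)))" by (rule complex_endo_sum[OF D YV(1)])
  also have "\<dots> = (\<Sum>j\<in>{1..m}. cs (hm r (Y j) * z j) (Y j))"
    using YV by (intro sum.cong) (simp_all add: e cs_cs)
  finally have "hm (D r) (Y i) = (\<Sum>j\<in>{1..m}. hm r (Y j) * z j * hm (Y j) (Y i))"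
    using YV i by (simp add: hm_sum_left hm_cs_left)
  also have "\<dots> = (\<Sum>j\<in>{1..m}. if j = i then hm r (Y j) * z j else 0)"
    using Y i unfolding unitary_basis_def by (intro sum.cong) auto
  finally show ?thesis using i by simp
qed

lemma unitary_basis_nonzero_component:
  assumes "unitary_basis W m Y" "r \<in> W" "r \<noteq> 0"
  obtains i where "i \<in> {1..m}" "hm r (Y i) \<noteq> 0"
proof -
  have "r = (\<Sum>i\<in>{1..m}. cs (hm r (Y i)) (Y i))" using assms unfolding unitary_basis_def by blast
  then show ?thesis using that assms(3) by (metis (no_types, lifting) cs_zero_left sum.neutral)
qed

text \<open>Induction on the dimension. An invariant hyperplane \<open>U\<close> with unit normal
  \<open>v\<close> is diagonalized by the induction hypothesis; what remains are the
  \<open>U\<close>-components \<open>r\<close> and \<open>q\<close> of \<open>D1 v\<close> and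
  \<open>D2 v\<close>. The identities at (v, Y_i) tie the real parts of the eigenvalues together,
  and those at (v, v) then leave no room for a nonzero length. The component \<open>r\<close> is
  removed before \<open>q\<close>, since the treatment of \<open>q\<close> compares the eigenvalues
  of \<open>D1\<close>.\<close>

lemma simultaneous_diagonalization:
  assumes "complex_subspace W" "complex_endo W D1" "complex_endo W D2"
    and "\<And>x. x \<in> W \<Longrightarrow> D1 (D2 x) = D2 (D1 x)"
    and "\<And>x y. x \<in> W \<Longrightarrow> y \<in> W \<Longrightarrow>
      sym_form D1 (D1 x) y + sym_form D1 x (D1 y) + of_real a * sym_form D1 x y = 0"
    and "\<And>x y. x \<in> W \<Longrightarrow> y \<in> W \<Longrightarrow>
      sym_form D1 (D2 x) y + sym_form D1 x (D2 y) + of_real a * sym_form D2 x y = 0"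
    and "\<And>x y. x \<in> W \<Longrightarrow> y \<in> W \<Longrightarrow>
      sym_form D2 (D2 x) y + sym_form D2 x (D2 y)
        + of_real b1 * sym_form D1 x y + of_real b2 * sym_form D2 x y = 0"
    and a: "a > 0"
  shows "\<exists>m Y z w. unitary_basis W m Y \<and> (\<forall>i\<in>{1..m}.
      D1 (Y i) = cs (z i) (Y i) \<and> D2 (Y i) = cs (w i) (Y i) \<and> diagonal_eqs a b1 b2 (z i) (w i))"
  using assms(1-7)
proof (induction "dim W" arbitrary: W rule: less_induct)
  case less
  note W = less.prems(1) and D1 = less.prems(2) and D2 = less.prems(3) and comm = less.prems(4)
    and K11 = less.prems(5) and K12 = less.prems(6) and K22 = less.prems(7)
  show ?case
  proof (cases "W = {0}")
    case True
    then have "unitary_basis W 0 (\<lambda>_. 0)" unfolding unitary_basis_def by simp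
    then show ?thesis by fastforce
  next
    case False
    obtain v where v: "v \<in> W" "hm v v = 1"
      and D1U: "complex_endo {y \<in> W. hm y v = 0} D1" and D2U: "complex_endo {y \<in> W. hm y v = 0} D2"
      using invariant_hyperplane_exists[OF D1 D2 W False comm] by blast
    define U where "U = {y \<in> W. hm y v = 0}"
    note D1U = D1U[folded U_def] and D2U = D2U[folded U_def]
    have WV: "y \<in> W \<Longrightarrow> y \<in> V" for y using W unfolding complex_subspace_def by blast
    have UW: "y \<in> U \<Longrightarrow> y \<in> W" for y unfolding U_def by blast
    have v0: "v \<noteq> 0" using v(2) by auto
    have sub: "subspace W" using W unfolding complex_subspace_def by blast
    have U: "complex_subspace U" "dim U < dim W"
      unfolding U_def using complex_subspace_perp[OF W] dim_perp_less[OF W] v(1) v0 WV by auto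
    have "\<exists>m Y z w. unitary_basis U m Y \<and> (\<forall>i\<in>{1..m}.
      D1 (Y i) = cs (z i) (Y i) \<and> D2 (Y i) = cs (w i) (Y i) \<and> diagonal_eqs a b1 b2 (z i) (w i))"
      by (rule less.hyps[OF U(2) U(1) D1U D2U]) (auto intro!: comm K11 K12 K22 UW)
    then obtain m Y z w where Y: "unitary_basis U m Y"
      and e1: "\<And>i. i \<in> {1..m} \<Longrightarrow> D1 (Y i) = cs (z i) (Y i)"
      and e2: "\<And>i. i \<in> {1..m} \<Longrightarrow> D2 (Y i) = cs (w i) (Y i)"
      and R: "\<And>i. i \<in> {1..m} \<Longrightarrow> diagonal_eqs a b1 b2 (z i) (w i)"
      by metis
    have lin: "linear D1" "linear D2" using D1 D2 unfolding complex_endo_def by auto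
    have DW: "x \<in> W \<Longrightarrow> D1 x \<in> W" "x \<in> W \<Longrightarrow> D2 x \<in> W" "x \<in> U \<Longrightarrow> D1 x \<in> U" "x \<in> U \<Longrightarrow> D2 x \<in> U" for x
      using D1 D2 D1U D2U unfolding complex_endo_def by auto
    have YU: "i \<in> {1..m} \<Longrightarrow> Y i \<in> U" for i using Y unfolding unitary_basis_def by blast
    have Uv: "hm y v = 0" "hm v y = 0" if "y \<in> U" for y
      using that hm_commute[of y v] v WV unfolding U_def by auto
    define zv where "zv = hm (D1 v) v"
    define wv where "wv = hm (D2 v) v"
    define r where "r = D1 v - cs zv v"
    define q where "q = D2 v - cs wv v"
    have rW: "r \<in> W" "q \<in> W" unfolding r_def q_def using DW v(1) sub complex_subspace_cs[OF W]
      by (auto simp: subspace_diff)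
    have rU: "r \<in> U" "q \<in> U"
      using rW v WV unfolding U_def by (auto simp: r_def q_def hm_diff_left hm_cs_left zv_def wv_def)
    have D1v: "D1 v = cs zv v + r" and D2v: "D2 v = cs wv v + q" unfolding r_def q_def by auto
    note hm_simps = cs_add cs_in_V V_add hm_add_left hm_add_right hm_cs_left hm_cs_right Uv WV UW v rU rW DW
    have vv: "hm (D1 (D1 v)) v = zv * zv" "hm v (D1 (D1 v)) = cnj zv * cnj zv"
       "hm (D1 v) (D1 v) = zv * cnj zv + hm r r"
       "hm (D2 (D2 v)) v = wv * wv" "hm v (D2 (D2 v)) = cnj wv * cnj wv"
       "hm (D2 v) (D2 v) = wv * cnj wv + hm q q"
       "hm v (D1 v) = cnj zv" "hm v (D2 v) = cnj wv"
      unfolding D1v D2v using lin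
      by (simp_all add: hm_simps linear_add complex_endo_cs[OF D1] complex_endo_cs[OF D2] D1v D2v)
    have comp: "hm (D1 x) (Y i) = z i * hm x (Y i)" "hm (D2 x) (Y i) = w i * hm x (Y i)"
      if "i \<in> {1..m}" "x \<in> U" for i x
      using unitary_basis_eigen_component[OF U(1) Y D1U e1 that(2,1)]
        unitary_basis_eigen_component[OF U(1) Y D2U e2 that(2,1)] by blast+
    have c1: "hm (D1 v) (Y i) = hm r (Y i)" "hm (D2 v) (Y i) = hm q (Y i)"
       "hm (D1 (D1 v)) (Y i) = (zv + z i) * hm r (Y i)"
       "hm (D2 (D2 v)) (Y i) = (wv + w i) * hm q (Y i)"
       "hm (D1 (D2 v)) (Y i) = wv * hm r (Y i) + z i * hm q (Y i)"
       "hm (D2 (D1 v)) (Y i) = zv * hm q (Y i) + w i * hm r (Y i)"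
      if i: "i \<in> {1..m}" for i
      unfolding D1v D2v using lin YU[OF i]
      by (simp_all add: hm_simps linear_add complex_endo_cs[OF D1] complex_endo_cs[OF D2] D1v D2v
          comp[OF i] i algebra_simps)
    have c2: "hm x (D1 (Y i)) = cnj (z i) * hm x (Y i)" "hm x (D2 (Y i)) = cnj (w i) * hm x (Y i)"
       "hm v (D1 (D1 (Y i))) = 0" "hm v (D2 (D2 (Y i))) = 0" "hm v (D1 (D2 (Y i))) = 0"
       "hm v (Y i) = 0"
      if i: "i \<in> {1..m}" "x \<in> W" for i x
      using YU[OF i(1)] i by (simp_all add: e1 e2 hm_simps complex_endo_cs[OF D1] complex_endo_cs[OF D2])
    \<comment> \<open>An off-diagonal entry of \<open>D1\<close> would force \<open>Re zv = - 3 Re (z i) - a\<close>, where \<open>2 x\<^sup>2 + a x \<ge> 0\<close>,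
      whereas the diagonal entry at \<open>v\<close> gives \<open>2 x\<^sup>2 + a x = - g r r\<close>; similarly for \<open>D2\<close>.\<close>
    have "r = 0"
    proof (rule ccontr)
      assume "r \<noteq> 0"
      then obtain i where i: "i \<in> {1..m}" "hm r (Y i) \<noteq> 0"
        using unitary_basis_nonzero_component[OF Y rU(1)] by blast
      have gr: "g r r > 0" using g_pos \<open>r \<noteq> 0\<close> rW WV by blast
      have "Re (sym_form D1 (D1 v) v + sym_form D1 v (D1 v) + of_real a * sym_form D1 v v) = 0"
        using K11[OF v(1) v(1)] by simp
      then have 1: "4 * (Re zv)\<^sup>2 + 2 * g r r + 2 * a * Re zv = 0"
        unfolding sym_form_def vv zv_def[symmetric]
        by (simp add: hm_self WV rW power2_eq_square algebra_simps)
      have "(zv + z i + 2 * cnj (z i) + of_real a) * hm r (Y i) = 0"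
        using K11[OF v(1) UW[OF YU[OF i(1)]]] i(1) v
        unfolding sym_form_def by (simp add: c1 c2 DW algebra_simps)
      then have "Re (zv + z i + 2 * cnj (z i) + of_real a) = 0" using i(2) by simp
      then have 2: "Re zv = - 3 * Re (z i) - a" by simp
      have "Re (z i) * (2 * Re (z i) + a) = 0"
        using R[OF i(1)] unfolding diagonal_eqs_def by (simp add: power2_eq_square algebra_simps)
      then have "Re (z i) = 0 \<or> 2 * Re (z i) = - a" by auto
      then have "2 * Re zv * (2 * Re zv + a) \<ge> 0"
      proof
        assume "Re (z i) = 0"
        then show ?thesis using 2 a by simp
      next
        assume "2 * Re (z i) = - a"
        then have "2 * Re zv = a" using 2 by simp
        then show ?thesis using a by simp
      qed
      then show False using 1 gr by (simp add: power2_eq_square algebra_simps)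
    qed
    have "q = 0"
    proof (rule ccontr)
      assume "q \<noteq> 0"
      then obtain i where i: "i \<in> {1..m}" "hm q (Y i) \<noteq> 0"
        using unitary_basis_nonzero_component[OF Y rU(2)] by blast
      have gq: "g q q > 0" using g_pos \<open>q \<noteq> 0\<close> rW WV by blast
      \<comment> \<open>Comparison of the Y_i-components of \<open>D1 (D2 v)\<close> and
        \<open>D2 (D1 v)\<close>; with \<open>r = 0\<close> a nonzero component of \<open>q\<close>
        puts Y_i and \<open>v\<close> in the same eigenspace of \<open>D1\<close>.\<close>
      have "z i * hm q (Y i) = zv * hm q (Y i)"
        using comm[OF v(1)] c1(5,6)[OF i(1)] \<open>r = 0\<close> by auto
      then have zz: "z i = zv" using i(2) by simp
      have "(z i + cnj (z i) + of_real a) * hm q (Y i) = 0"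
        using K12[OF v(1) UW[OF YU[OF i(1)]]] i(1) v \<open>r = 0\<close>
        unfolding sym_form_def by (simp add: c1 c2 DW algebra_simps)
      then have "Re (z i + cnj (z i) + of_real a) = 0" using i(2) by simp
      then have Rz: "Re (z i) = - a / 2" by simp
      have "Re (sym_form D2 (D2 v) v + sym_form D2 v (D2 v) + of_real b1 * sym_form D1 v v
          + of_real b2 * sym_form D2 v v) = 0"
        using K22[OF v(1) v(1)] by simp
      then have 1: "4 * (Re wv)\<^sup>2 + 2 * g q q - a * b1 + 2 * b2 * Re wv = 0"
        unfolding sym_form_def vv zv_def[symmetric] wv_def[symmetric] using Rz zz
        by (simp add: hm_self WV rW power2_eq_square algebra_simps)
      have "(wv + w i + 2 * cnj (w i) + of_real b2) * hm q (Y i) = 0"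
        using K22[OF v(1) UW[OF YU[OF i(1)]]] i(1) v \<open>r = 0\<close>
        unfolding sym_form_def by (simp add: c1 c2 DW algebra_simps)
      then have "Re (wv + w i + 2 * cnj (w i) + of_real b2) = 0" using i(2) by simp
      then have 2: "Re wv = - 3 * Re (w i) - b2" by simp
      have 3: "4 * (Re (w i))\<^sup>2 - a * b1 + 2 * b2 * Re (w i) = 0"
        using R[OF i(1)] Rz unfolding diagonal_eqs_def by (simp add: algebra_simps)
      \<comment> \<open>Inserting 2 into 1 and subtracting 3 removes \<open>a * b1\<close> and
        leaves a complete square.\<close>
      have "g q q = - (4 * Re (w i) + b2)\<^sup>2"
        using 1 3 unfolding 2 power2_eq_square by algebra
      then show False using gq by (smt (verit) zero_le_power2)
    qed
    have basis: "unitary_basis W (Suc m) (Y(Suc m := v))"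
      using unitary_basis_extend[OF W v] Y unfolding U_def by blast
    have ev: "D1 v = cs zv v" "D2 v = cs wv v" using D1v D2v \<open>r = 0\<close> \<open>q = 0\<close> by auto
    \<comment> \<open>With both off-diagonal components gone, the identities at (v, v) are the
      diagonal equations for the new eigenvalues.\<close>
    have "Re (sym_form D1 (D1 v) v + sym_form D1 v (D1 v) + of_real a * sym_form D1 v v) = 0"
      using K11[OF v(1) v(1)] by simp
    then have v1: "2 * (Re zv)\<^sup>2 + a * Re zv = 0"
      unfolding sym_form_def vv zv_def[symmetric] \<open>r = 0\<close>
      by (simp add: power2_eq_square algebra_simps)
    have vw: "hm (D1 (D2 v)) v = zv * wv" "hm v (D1 (D2 v)) = cnj (zv * wv)"
       "hm (D2 v) (D1 v) = wv * cnj zv" "hm (D1 v) (D2 v) = zv * cnj wv"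
      by (simp_all add: ev hm_simps complex_endo_cs[OF D1] complex_subspace_cs[OF W])
    have "Re (sym_form D1 (D2 v) v + sym_form D1 v (D2 v) + of_real a * sym_form D2 v v) = 0"
      using K12[OF v(1) v(1)] by simp
    then have v2: "2 * Re zv * Re wv + a * Re wv = 0"
      unfolding sym_form_def vv vw wv_def[symmetric] by (simp add: algebra_simps)
    have "Re (sym_form D2 (D2 v) v + sym_form D2 v (D2 v) + of_real b1 * sym_form D1 v v
        + of_real b2 * sym_form D2 v v) = 0"
      using K22[OF v(1) v(1)] by simp
    then have v3: "2 * (Re wv)\<^sup>2 + b1 * Re zv + b2 * Re wv = 0"
      unfolding sym_form_def vv zv_def[symmetric] wv_def[symmetric] \<open>q = 0\<close>
      by (simp add: power2_eq_square algebra_simps)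
    have vd: "diagonal_eqs a b1 b2 zv wv" unfolding diagonal_eqs_def using v1 v2 v3 by blast
    show ?thesis
    proof (rule exI[of _ "Suc m"], rule exI[of _ "Y(Suc m := v)"], rule exI[of _ "z(Suc m := zv)"],
        rule exI[of _ "w(Suc m := wv)"], intro conjI basis ballI)
      fix i assume "i \<in> {1..Suc m}"
      then consider "i = Suc m" | "i \<in> {1..m}" "i \<noteq> Suc m" by fastforce
      note cases = this
      show "D1 ((Y(Suc m := v)) i) = cs ((z(Suc m := zv)) i) ((Y(Suc m := v)) i)"
        using cases by cases (simp_all add: ev e1)
      show "D2 ((Y(Suc m := v)) i) = cs ((w(Suc m := wv)) i) ((Y(Suc m := v)) i)"
        using cases by cases (simp_all add: ev e2)
      show "diagonal_eqs a b1 b2 ((z(Suc m := zv)) i) ((w(Suc m := wv)) i)"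
        using cases by cases (simp_all add: R vd)
    qed
  qed
qed

end

section \<open>SKT Lie algebras\<close>

text \<open>On \<open>vs L\<close> this is \<open>- J\<^sup>*d\<sigma>\<close>, simplified by the orthogonality of \<open>J\<close>.\<close>

definition torsion :: "('v::real_vector, 'm) ah_data_scheme \<Rightarrow> 'v \<Rightarrow> 'v \<Rightarrow> 'v \<Rightarrow> real" where
  "torsion L x y u =
     metric L (bracket L (cplx L x) (cplx L y)) u + metric L (bracket L (cplx L y) (cplx L u)) x
     + metric L (bracket L (cplx L u) (cplx L x)) y"

text \<open>The leading sign of the Chevalley-Eilenberg differential and the sign in
  \<open>torsion\<close> cancel, so on the carrier this is the value of d(J^* d\<sigma>)
  itself.\<close>

definition d_torsion :: "('v::real_vector, 'm) ah_data_scheme \<Rightarrow> 'v \<Rightarrow> 'v \<Rightarrow> 'v \<Rightarrow> 'v \<Rightarrow> real" where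
  "d_torsion L p q x y =
     torsion L (bracket L p q) x y - torsion L (bracket L p x) q y + torsion L (bracket L p y) q x
     + torsion L (bracket L q x) p y - torsion L (bracket L q y) p x + torsion L (bracket L x y) p q"

lemma lin_on_neg:
  assumes "lin_on V f" "x \<in> V" shows "f (- x) = - f x"
proof -
  have "f ((-1) *\<^sub>R x) = (-1) *\<^sub>R f x" using assms unfolding lin_on_def by blast
  then show ?thesis by simp
qed

lemma lie_bracket_antisym:
  assumes L: "lie_algebra L" and x: "x \<in> vs L" and y: "y \<in> vs L"
  shows "bracket L x y = - bracket L y x"
proof -
  have sub: "subspace (vs L)" and bil: "bilin_on (vs L) (bracket L)"
    and alt: "\<And>x. x \<in> vs L \<Longrightarrow> bracket L x x = 0"
    using L unfolding lie_algebra_def by auto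
  have xy: "x + y \<in> vs L" using sub x y by (simp add: subspace_add)
  have "bracket L (x + y) (x + y) = bracket L x (x + y) + bracket L y (x + y)"
    using bil x y xy unfolding bilin_on_def lin_on_def by blast
  also have "bracket L x (x + y) = bracket L x x + bracket L x y"
    using bil x y unfolding bilin_on_def lin_on_def by blast
  also have "bracket L y (x + y) = bracket L y x + bracket L y y"
    using bil x y unfolding bilin_on_def lin_on_def by blast
  finally show ?thesis using alt[OF x] alt[OF y] alt[OF xy] by (simp add: eq_neg_iff_add_eq_0)
qed

text \<open>Each term of J^* d\<sigma> pairs J[Jx, Jy] with Ju; orthogonality of J removes J from
  both entries, and antisymmetry of the bracket puts the three terms in cyclic order.\<close>

lemma ce_d_fundamental_form:
  assumes L: "almost_hermitian L" and V: "x \<in> vs L" "y \<in> vs L" "u \<in> vs L"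
  shows "cplx_pullback L (ce_d L (fundamental_form L)) [x, y, u] = - torsion L x y u"
proof -
  have lie: "lie_algebra L" and ip: "inner_product L"
    and J: "\<And>x. x \<in> vs L \<Longrightarrow> cplx L x \<in> vs L"
    and o: "\<And>x y. x \<in> vs L \<Longrightarrow> y \<in> vs L \<Longrightarrow> metric L (cplx L x) (cplx L y) = metric L x y"
    using L unfolding almost_hermitian_def by auto
  have br: "\<And>x y. x \<in> vs L \<Longrightarrow> y \<in> vs L \<Longrightarrow> bracket L x y \<in> vs L"
    using lie unfolding lie_algebra_def by auto
  have "cplx_pullback L (ce_d L (fundamental_form L)) [x, y, u] =
     - metric L (cplx L (bracket L (cplx L x) (cplx L y))) (cplx L u)
     + metric L (cplx L (bracket L (cplx L x) (cplx L u))) (cplx L y)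
     - metric L (cplx L (bracket L (cplx L y) (cplx L u))) (cplx L x)"
    unfolding cplx_pullback_def ce_d_def fundamental_form_def
    by (simp add: lessThan_Suc numeral_3_eq_3 nths_Cons eval_nat_numeral)
  also have "\<dots> = - metric L (bracket L (cplx L x) (cplx L y)) u
     + metric L (bracket L (cplx L x) (cplx L u)) y - metric L (bracket L (cplx L y) (cplx L u)) x"
    by (simp add: o br J V)
  also have "metric L (bracket L (cplx L x) (cplx L u)) y = - metric L (bracket L (cplx L u) (cplx L x)) y"
  proof -
    have "lin_on (vs L) (\<lambda>x. metric L x y)"
      using ip V(2) by (simp add: inner_product_def bilin_on_def)
    then show ?thesis
      using lin_on_neg[of "vs L" "\<lambda>x. metric L x y" "bracket L (cplx L u) (cplx L x)"]
        lie_bracket_antisym[OF lie J[OF V(1)] J[OF V(3)]] br[OF J[OF V(3)] J[OF V(1)]] by simp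
  qed
  finally show ?thesis unfolding torsion_def by simp
qed

lemma ce_d_torsion:
  assumes L: "almost_hermitian L" and V: "p \<in> vs L" "q \<in> vs L" "x \<in> vs L" "y \<in> vs L"
  shows "ce_d L (cplx_pullback L (ce_d L (fundamental_form L))) [p, q, x, y] = d_torsion L p q x y"
proof -
  have br: "\<And>x y. x \<in> vs L \<Longrightarrow> y \<in> vs L \<Longrightarrow> bracket L x y \<in> vs L"
    using L unfolding almost_hermitian_def lie_algebra_def by auto
  define F where "F = cplx_pullback L (ce_d L (fundamental_form L))"
  have F: "F [u, v, r] = - torsion L u v r" if "u \<in> vs L" "v \<in> vs L" "r \<in> vs L" for u v r
    unfolding F_def using ce_d_fundamental_form[OF L that] .
  have "ce_d L F [p, q, x, y] = - F [bracket L p q, x, y] + F [bracket L p x, q, y]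
      - F [bracket L p y, q, x] - F [bracket L q x, p, y] + F [bracket L q y, p, x]
      - F [bracket L x y, p, q]"
    unfolding ce_d_def
    by (simp add: lessThan_Suc nths_Cons eval_nat_numeral)
  then show ?thesis unfolding F_def[symmetric] d_torsion_def using br V by (simp add: F)
qed

lemma skt_iff:
  "skt L \<longleftrightarrow> almost_hermitian L \<and> integrable_cplx L \<and>
     (\<forall>p\<in>vs L. \<forall>q\<in>vs L. \<forall>x\<in>vs L. \<forall>y\<in>vs L. d_torsion L p q x y = 0)"
proof -
  have "(\<forall>xs. length xs = 4 \<and> set xs \<subseteq> vs L \<longrightarrow>
        ce_d L (cplx_pullback L (ce_d L (fundamental_form L))) xs = 0) \<longleftrightarrow>
     (\<forall>p\<in>vs L. \<forall>q\<in>vs L. \<forall>x\<in>vs L. \<forall>y\<in>vs L. d_torsion L p q x y = 0)" (is "?A \<longleftrightarrow> ?B")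
    if L: "almost_hermitian L"
  proof
    assume A: ?A
    show ?B
    proof (intro ballI)
      fix p q x y assume V: "p \<in> vs L" "q \<in> vs L" "x \<in> vs L" "y \<in> vs L"
      then show "d_torsion L p q x y = 0"
        using A[rule_format, of "[p, q, x, y]"] ce_d_torsion[OF L V] by simp
    qed
  next
    assume B: ?B
    show ?A
    proof (intro allI impI)
      fix xs :: "'a list" assume xs: "length xs = 4 \<and> set xs \<subseteq> vs L"
      then obtain p q x y where "xs = [p, q, x, y]"
        by (auto simp: length_Suc_conv eval_nat_numeral)
      then show "ce_d L (cplx_pullback L (ce_d L (fundamental_form L))) xs = 0"
        using xs B ce_d_torsion[OF L, of p q x y] by simp
    qed
  qed
  then show ?thesis unfolding skt_def by blast
qed


locale skt_lie = hermitian_space V g J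
  for V :: "'v::real_vector set" and g J +
  fixes br :: "'v \<Rightarrow> 'v \<Rightarrow> 'v"
  assumes br_add_left: "br (x + y) u = br x u + br y u"
    and br_add_right: "br u (x + y) = br u x + br u y"
    and br_scale_left: "br (r *\<^sub>R x) y = r *\<^sub>R br x y"
    and br_scale_right: "br x (r *\<^sub>R y) = r *\<^sub>R br x y"
    and br_self [simp]: "br x x = 0"
    and br_in: "x \<in> V \<Longrightarrow> y \<in> V \<Longrightarrow> br x y \<in> V"
    and jacobi: "x \<in> V \<Longrightarrow> y \<in> V \<Longrightarrow> u \<in> V \<Longrightarrow>
       br x (br y u) + br y (br u x) + br u (br x y) = 0"
    and integrable: "x \<in> V \<Longrightarrow> y \<in> V \<Longrightarrow>
       br (J x) (J y) - J (br (J x) y) - J (br x (J y)) - br x y = 0"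
    and skt_identity: "p \<in> V \<Longrightarrow> q \<in> V \<Longrightarrow> x \<in> V \<Longrightarrow> y \<in> V \<Longrightarrow>
       d_torsion \<lparr>vs = V, bracket = br, metric = g, cplx = J\<rparr> p q x y = 0"
begin

lemma linear_br_left: "linear (\<lambda>x. br x y)"
  by (rule linearI) (simp_all add: br_add_left br_scale_left)

lemma linear_br_right: "linear (br x)"
  by (rule linearI) (simp_all add: br_add_right br_scale_right)

lemmas br_zero_left [simp] = linear_0[OF linear_br_left]
  and br_zero_right [simp] = linear_0[OF linear_br_right]
  and br_neg_left = linear_neg[OF linear_br_left] and br_neg_right = linear_neg[OF linear_br_right]
  and br_diff_left = linear_diff[OF linear_br_left] and br_diff_right = linear_diff[OF linear_br_right]

lemmas br_linear = br_add_left br_add_right br_scale_left br_scale_right br_neg_left br_neg_right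
  br_diff_left br_diff_right

lemma br_commute: "br x y = - br y x"
  using br_self[of "x + y"] by (simp add: br_linear eq_neg_iff_add_eq_0 del: br_self) (simp add: algebra_simps)

end

text \<open>All three structure maps are precomposed with a linear projection \<open>P\<close> onto
  the carrier. They keep their values there and become linear on the whole type.\<close>

lemma skt_lie_of_record:
  fixes L :: "'v::real_vector ah_data"
  assumes "skt L"
  obtains g J br where "skt_lie (vs L) g J br"
    "\<And>x y. x \<in> vs L \<Longrightarrow> y \<in> vs L \<Longrightarrow> br x y = bracket L x y"
    "\<And>x y. x \<in> vs L \<Longrightarrow> y \<in> vs L \<Longrightarrow> g x y = metric L x y"
    "\<And>x. x \<in> vs L \<Longrightarrow> J x = cplx L x"
proof -
  have L: "almost_hermitian L" "integrable_cplx L"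
    and d: "\<And>p q x y. p \<in> vs L \<Longrightarrow> q \<in> vs L \<Longrightarrow> x \<in> vs L \<Longrightarrow> y \<in> vs L \<Longrightarrow> d_torsion L p q x y = 0"
    using assms unfolding skt_iff by auto
  have lie: "lie_algebra L" and ip: "inner_product L"
    and linJ: "lin_on (vs L) (cplx L)"
    and Jin: "\<And>x. x \<in> vs L \<Longrightarrow> cplx L x \<in> vs L"
    and JJ: "\<And>x. x \<in> vs L \<Longrightarrow> cplx L (cplx L x) = - x"
    and o: "\<And>x y. x \<in> vs L \<Longrightarrow> y \<in> vs L \<Longrightarrow> metric L (cplx L x) (cplx L y) = metric L x y"
    using L(1) unfolding almost_hermitian_def by auto
  have sub: "subspace (vs L)" and fd: "fin_dim (vs L)"
    and brin: "\<And>x y. x \<in> vs L \<Longrightarrow> y \<in> vs L \<Longrightarrow> bracket L x y \<in> vs L"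
    and bilb: "bilin_on (vs L) (bracket L)"
    and alt: "\<And>x. x \<in> vs L \<Longrightarrow> bracket L x x = 0"
    and jac: "\<And>x y u. x \<in> vs L \<Longrightarrow> y \<in> vs L \<Longrightarrow> u \<in> vs L \<Longrightarrow>
        bracket L x (bracket L y u) + bracket L y (bracket L u x) + bracket L u (bracket L x y) = 0"
    using lie unfolding lie_algebra_def fin_dim_def by auto
  have bilg: "bilin_on (vs L) (metric L)"
    and sym: "\<And>x y. x \<in> vs L \<Longrightarrow> y \<in> vs L \<Longrightarrow> metric L x y = metric L y x"
    and pos: "\<And>x. x \<in> vs L \<Longrightarrow> x \<noteq> 0 \<Longrightarrow> metric L x x > 0"
    using ip unfolding inner_product_def by auto
  obtain P where P: "linear P" "\<And>x. P x \<in> vs L" "\<And>x. x \<in> vs L \<Longrightarrow> P x = x"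
    using subspace_projection[OF sub] by blast
  define g where "g = (\<lambda>x y. metric L (P x) (P y))"
  define br where "br = (\<lambda>x y. bracket L (P x) (P y))"
  define J where "J = (\<lambda>x. cplx L (P x))"
  note P_lin = linear_add[OF P(1)] linear_scale[OF P(1)]
  have dt: "d_torsion \<lparr>vs = vs L, bracket = br, metric = g, cplx = J\<rparr> p q x y = 0"
    if "p \<in> vs L" "q \<in> vs L" "x \<in> vs L" "y \<in> vs L" for p q x y
    using d[OF that] that unfolding d_torsion_def torsion_def
    by (simp add: g_def br_def J_def P brin Jin)
  have "skt_lie (vs L) g J br"
  proof (intro skt_lie.intro hermitian_space.intro skt_lie_axioms.intro)
    show "subspace (vs L)" "fin_dim (vs L)" by fact+
    show "linear J" unfolding J_def
      by (rule linearI; use linJ P(2) in \<open>simp add: P_lin lin_on_def\<close>)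
    show "d_torsion \<lparr>vs = vs L, bracket = br, metric = g, cplx = J\<rparr> p q x y = 0"
      if "p \<in> vs L" "q \<in> vs L" "x \<in> vs L" "y \<in> vs L" for p q x y using dt that .
    show "br (J x) (J y) - J (br (J x) y) - J (br x (J y)) - br x y = 0"
      if "x \<in> vs L" "y \<in> vs L" for x y
      using L(2) that unfolding integrable_cplx_def by (simp add: br_def J_def P Jin brin)
    show "br x (br y u) + br y (br u x) + br u (br x y) = 0"
      if "x \<in> vs L" "y \<in> vs L" "u \<in> vs L" for x y u
      using jac[OF that] that by (simp add: br_def P brin)
  qed (use bilb bilg P(2) in \<open>simp_all add: g_def br_def J_def P P_lin bilin_on_def lin_on_def
        alt brin Jin JJ o pos sym\<close>)
  then show ?thesis using that[of g J br] by (simp add: g_def br_def J_def P)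
qed


text \<open>The pairs \<open>(p, q)\<close>, \<open>(r, s)\<close>, \<open>(t, u)\<close> are the coordinates of \<open>X\<^sub>1X\<^sub>1\<close>, \<open>X\<^sub>1X\<^sub>2\<close>, \<open>X\<^sub>2X\<^sub>2\<close> for a
  commutative associative product on a plane; \<open>\<alpha>X\<^sub>1 + \<beta>X\<^sub>2\<close> is its unit.\<close>

lemma unital_of_perfect:
  fixes p q r s t u :: real
  assumes assoc: "s * r = q * t" "r * q + s * s = p * s + q * u" "t * p + u * r = r * r + s * t"
    and perfect: "\<And>l m. l * p + m * q = 0 \<Longrightarrow> l * r + m * s = 0 \<Longrightarrow> l * t + m * u = 0 \<Longrightarrow> l = 0 \<and> m = 0"
  obtains \<alpha> \<beta> where "\<alpha> * p + \<beta> * r = 1" "\<alpha> * q + \<beta> * s = 0" "\<alpha> * r + \<beta> * t = 0" "\<alpha> * s + \<beta> * u = 1"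
proof -
  \<comment> \<open>\<open>M1\<close> and \<open>M3\<close> are minors of the matrix with columns
    (p, q), (r, s), (t, u). Associativity supplies a second expression for each, and if one of them
    is nonzero, Cramer's rule solves all four unit equations at once.\<close>
  define M1 where "M1 = p * s - q * r"
  define M3 where "M3 = r * u - s * t"
  have M1: "M1 = s * s - q * u" and M3: "M3 = r * r - p * t"
    using assoc unfolding M1_def M3_def by (auto simp: algebra_simps)
  consider "M1 \<noteq> 0" | "M3 \<noteq> 0" | "M1 = 0" "M3 = 0" by blast
  then show ?thesis
  proof cases
    case 1
    have "s / M1 * p + (- q / M1) * r = (p * s - q * r) / M1" "s / M1 * q + (- q / M1) * s = 0"
      "s / M1 * r + (- q / M1) * t = (s * r - q * t) / M1" "s / M1 * s + (- q / M1) * u = (s * s - q * u) / M1"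
      by (simp_all add: diff_divide_distrib mult.commute)
    then show ?thesis
      using that[of "s / M1" "- q / M1"] 1 assoc(1) M1_def[symmetric] M1[symmetric] by simp
  next
    case 2
    have "- t / M3 * p + r / M3 * r = (r * r - p * t) / M3" "- t / M3 * r + r / M3 * t = 0"
      "- t / M3 * q + r / M3 * s = (s * r - q * t) / M3" "- t / M3 * s + r / M3 * u = (r * u - s * t) / M3"
      by (simp_all add: diff_divide_distrib mult.commute)
    then show ?thesis
      using that[of "- t / M3" "r / M3"] 2 assoc(1) M3_def[symmetric] M3[symmetric] by simp
  next
    case 3
    have e: "p * s = q * r" "s * s = q * u" "r * r = p * t" "r * u = s * t"
      using 3 M1 M3 unfolding M1_def M3_def by auto
    \<comment> \<open>The remaining minor. If it vanished too, the three products would lie on a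
      line, against \<open>perfect\<close>.\<close>
    have pu: "p * u \<noteq> q * t"
    proof
      assume z: "p * u = q * t"
      have "q = 0 \<and> p = 0" using perfect[of q "- p"] z e(1) by (auto simp: algebra_simps)
      moreover have "s = 0 \<and> r = 0" using perfect[of s "- r"] z e by (auto simp: algebra_simps)
      ultimately show False using perfect[of u "- t"] e perfect[of 1 0] by (auto simp: algebra_simps)
    qed
    \<comment> \<open>For the third minor M this reads M^2 = p u M, hence q t M = 0.\<close>
    have "(p * u - q * t) * (p * u - q * t) = p * u * (p * u - q * t)"
      using e assoc(1) by algebra
    then have "q * t = 0" using pu by simp
    then have z: "q * t = 0" "s * r = 0" "p \<noteq> 0" "u \<noteq> 0" using pu assoc(1) by auto
    have "s = 0 \<or> r = 0" using z by simp
    then have "s = 0" "r = 0" "q = 0" "t = 0" using e z by auto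
    \<comment> \<open>Both mixed products vanish and the plane is R x R with idempotents X1/p and
      X2/u, whose sum is the unit.\<close>
    then have "1 / p * p + 1 / u * r = 1 \<and> 1 / p * q + 1 / u * s = 0 \<and>
        1 / p * r + 1 / u * t = 0 \<and> 1 / p * s + 1 / u * u = 1" using z by simp
    then show ?thesis using that by blast
  qed
qed


locale two_step_skt = skt_lie V g J br
  for V :: "'v::real_vector set" and g J br +
  fixes A :: "'v set"
  assumes A_span: "A = span {br x y | x y. x \<in> V \<and> y \<in> V}"
    and abelian: "x \<in> A \<Longrightarrow> y \<in> A \<Longrightarrow> br x y = 0"
    and not_invariant: "\<exists>x\<in>A. J x \<notin> A"
    and codim: "dim V = dim A + 2"
begin

section \<open>The commutator ideal, its complex part W and adapted frames\<close>

lemma subspace_A: "subspace A" unfolding A_span by (rule subspace_span)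

lemmas A_add = subspace_add[OF subspace_A] and A_scale = subspace_scale[OF subspace_A]
  and A_diff = subspace_diff[OF subspace_A] and A_neg = subspace_neg[OF subspace_A]

lemma A_subset: "A \<subseteq> V"
  unfolding A_span using br_in by (intro span_minimal subspace_V) auto

lemma A_V: "x \<in> A \<Longrightarrow> x \<in> V" using A_subset by blast

lemma br_in_A: "x \<in> V \<Longrightarrow> y \<in> V \<Longrightarrow> br x y \<in> A"
  unfolding A_span by (rule span_base) blast

definition W :: "'v set" where "W = {x \<in> A. J x \<in> A}"

lemma W_A: "x \<in> W \<Longrightarrow> x \<in> A" and W_V: "x \<in> W \<Longrightarrow> x \<in> V"
  unfolding W_def using A_V by auto

lemma complex_subspace_W: "complex_subspace W"
  unfolding complex_subspace_def
proof (intro conjI ballI)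
  show "subspace W" using subspace_A unfolding W_def subspace_def by (auto simp: J_add J_scale)
qed (auto simp: W_def A_V J_J A_neg)

lemma subspace_W: "subspace W" using complex_subspace_W unfolding complex_subspace_def by blast

lemmas W_add = subspace_add[OF subspace_W] and W_scale = subspace_scale[OF subspace_W]
  and W_diff = subspace_diff[OF subspace_W] and W_neg = subspace_neg[OF subspace_W]

lemma W_J: "x \<in> W \<Longrightarrow> J x \<in> W"
  using complex_subspace_W unfolding complex_subspace_def by blast

text \<open>Induction on the dimension of \<open>S\<close>: the component along one vector
  \<open>u\<close> is subtracted, and the hypothesis projects the rest to the complement of
  \<open>u\<close> in \<open>S\<close>.\<close>

lemma orthogonal_projection:
  assumes "subspace S" "S \<subseteq> V" "v \<in> V"
  shows "\<exists>s\<in>S. \<forall>x\<in>S. g (v - s) x = 0"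
  using assms
proof (induction "dim S" arbitrary: S v rule: less_induct)
  case less
  show ?case
  proof (cases "S = {0}")
    case False
    then obtain u where u: "u \<in> S" "u \<noteq> 0" using less.prems subspace_0 by blast
    then have gu: "g u u > 0" using g_pos less.prems by blast
    define T where "T = {x \<in> S. g x u = 0}"
    have T: "subspace T" using less.prems(1) unfolding T_def subspace_def by (auto simp: g_linear)
    have "u \<notin> T" using gu unfolding T_def by simp
    then have "T \<subset> S" using u unfolding T_def by blast
    moreover have "fin_dim S" using fin_dim_subset[OF fin_dim_V less.prems(2)] .
    ultimately have "dim T < dim S" using dim_less_fin T less.prems(1) by blast
    define v' where "v' = v - (g v u / g u u) *\<^sub>R u"
    have "v' \<in> V" unfolding v'_def using less.prems u by (auto intro!: V_diff V_scale)
    then obtain s where s: "s \<in> T" "\<forall>x\<in>T. g (v' - s) x = 0"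
      using less.hyps[OF \<open>dim T < dim S\<close> T, of v'] \<open>T \<subset> S\<close> less.prems(2) by blast
    have v'u: "g (v' - s) u = 0" using s(1) gu unfolding v'_def T_def by (simp add: g_linear)
    have "g (v' - s) x = 0" if x: "x \<in> S" for x
    proof -
      have "x - (g x u / g u u) *\<^sub>R u \<in> T"
        using x u gu less.prems(1) unfolding T_def
        by (auto simp: g_linear intro!: subspace_diff subspace_scale)
      then have "g (v' - s) (x - (g x u / g u u) *\<^sub>R u) = 0" using s(2) by blast
      then show ?thesis using v'u by (simp add: g_diff_right g_scale_right)
    qed
    moreover have "v' - s = v - (s + (g v u / g u u) *\<^sub>R u)" unfolding v'_def by simp
    moreover have "s + (g v u / g u u) *\<^sub>R u \<in> S"
      using s(1) u less.prems(1) unfolding T_def by (auto intro!: subspace_add subspace_scale)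
    ultimately show ?thesis by metis
  qed simp
qed

lemma unit_normal_exists:
  assumes "subspace S" "S \<subseteq> V" "S \<noteq> V"
  obtains n where "n \<in> V" "n \<notin> S" "g n n = 1" "\<And>x. x \<in> S \<Longrightarrow> g x n = 0"
proof -
  obtain v where v: "v \<in> V" "v \<notin> S" using assms by blast
  obtain s where s: "s \<in> S" "\<forall>x\<in>S. g (v - s) x = 0"
    using orthogonal_projection[OF assms(1,2) v(1)] by blast
  define k where "k = v - s"
  have k: "k \<in> V" "k \<noteq> 0" unfolding k_def using v s assms by (auto intro!: V_diff)
  then have gk: "g k k > 0" by (rule g_pos)
  define n where "n = (1 / sqrt (g k k)) *\<^sub>R k"
  have "g n n = 1" unfolding n_def using gk by (simp add: g_linear field_simps)
  moreover have perp: "g x n = 0" if "x \<in> S" for x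
    using s(2) that unfolding n_def k_def g_sym[of x] by (simp add: g_scale_left)
  moreover have "n \<in> V" unfolding n_def by (rule V_scale[OF k(1)])
  moreover have "n \<notin> S" using perp calculation(1) by force
  ultimately show ?thesis using that by blast
qed

text \<open>Two orthonormal normals describe \<open>A\<close> by two linear equations, so that
  membership of J x in \<open>A\<close> can be tested by inner products. The second normal is chosen
  orthogonal to the span of \<open>A\<close> and the first, and the codimension shows that nothing
  of \<open>V\<close> is left over.\<close>

lemma normals_exist:
  obtains n1 n2 where "n1 \<in> V" "n2 \<in> V" "g n1 n1 = 1" "g n2 n2 = 1" "g n1 n2 = 0"
    "\<And>x. x \<in> V \<Longrightarrow> x \<in> A \<longleftrightarrow> g x n1 = 0 \<and> g x n2 = 0"
proof -
  have fA: "fin_dim A" using fin_dim_subset[OF fin_dim_V A_subset] .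
  obtain n1 where n1: "n1 \<in> V" "n1 \<notin> A" "g n1 n1 = 1" "\<And>x. x \<in> A \<Longrightarrow> g x n1 = 0"
  proof -
    have "A \<noteq> V" using codim by auto
    from unit_normal_exists[OF subspace_A A_subset this] show ?thesis using that by blast
  qed
  define A1 where "A1 = span (insert n1 A)"
  have A1: "subspace A1" "A1 \<subseteq> V" "fin_dim A1" "dim A1 = dim A + 1"
  proof -
    show "A1 \<subseteq> V"
      unfolding A1_def by (rule span_minimal[OF _ subspace_V]) (use n1(1) A_subset in auto)
  qed (simp_all only: A1_def dim_span_insert[OF fA subspace_A n1(2)] fin_dim_span_insert[OF fA] subspace_span)
  obtain n2 where n2: "n2 \<in> V" "n2 \<notin> A1" "g n2 n2 = 1" "\<And>x. x \<in> A1 \<Longrightarrow> g x n2 = 0"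
  proof -
    have "A1 \<noteq> V" using codim A1(4) by auto
    from unit_normal_exists[OF A1(1,2) this] show ?thesis using that by blast
  qed
  define A2 where "A2 = span (insert n2 A1)"
  have A2: "subspace A2" "A2 \<subseteq> V" "dim A2 = dim V"
  proof -
    show "A2 \<subseteq> V"
      unfolding A2_def by (rule span_minimal[OF _ subspace_V]) (use n2(1) A1(2) in auto)
    show "dim A2 = dim V"
      unfolding A2_def dim_span_insert[OF A1(3,1) n2(2)] using A1(4) codim by simp
  qed (simp only: A2_def subspace_span)
  then have VA2: "A2 = V" using dim_less_fin[OF A2(1) subspace_V fin_dim_V] by auto
  have nA1: "n1 \<in> A1" "\<And>x. x \<in> A \<Longrightarrow> x \<in> A1" unfolding A1_def by (auto intro: span_base)
  have "x \<in> A" if x: "x \<in> V" "g x n1 = 0" "g x n2 = 0" for x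
  proof -
    obtain k2 where k2: "x - k2 *\<^sub>R n2 \<in> A1"
      using x(1) span_breakdown_eq[of x n2 A1] A1(1) unfolding VA2[symmetric] A2_def
      by (metis span_eq_iff)
    then have "g (x - k2 *\<^sub>R n2) n2 = 0" by (rule n2(4))
    then have "k2 = 0" using x n2(3) by (simp add: g_linear)
    then obtain k1 where k1: "x - k1 *\<^sub>R n1 \<in> A"
      using k2 span_breakdown_eq[of x n1 A] subspace_A unfolding A1_def by (auto simp: span_eq_iff[THEN iffD2])
    then have "g (x - k1 *\<^sub>R n1) n1 = 0" by (rule n1(4))
    then have "k1 = 0" using x n1(3) by (simp add: g_linear)
    then show ?thesis using k1 by simp
  qed
  then show ?thesis using that[OF n1(1) n2(1) n1(3) n2(3) n2(4)[OF nA1(1)]] n1(4) n2(4) nA1(2) by blast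
qed

text \<open>X1, X2 is an orthonormal basis of the complement of W in A, and JX1, JX2 complete it to
  V modulo A. The planes of X1, X2 and of JX1, JX2 need not be orthogonal; g(JX1, X2) becomes
  \<tau>.\<close>

definition frame :: "'v \<Rightarrow> 'v \<Rightarrow> bool" where
  "frame X1 X2 \<longleftrightarrow> X1 \<in> A \<and> X2 \<in> A \<and> g X1 X1 = 1 \<and> g X2 X2 = 1 \<and> g X1 X2 = 0 \<and>
     (\<forall>y\<in>W. g y X1 = 0 \<and> g y X2 = 0) \<and>
     (\<forall>x1 x2. x1 *\<^sub>R J X1 + x2 *\<^sub>R J X2 \<in> A \<longrightarrow> x1 = 0 \<and> x2 = 0) \<and>
     (\<forall>x\<in>V. \<exists>y\<in>W. \<exists>x1 x2 u1 u2. x = y + x1 *\<^sub>R X1 + x2 *\<^sub>R X2 + u1 *\<^sub>R J X1 + u2 *\<^sub>R J X2)"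

lemma frameD:
  assumes "frame X1 X2"
  shows "X1 \<in> A" "X2 \<in> A" "g X1 X1 = 1" "g X2 X2 = 1" "g X1 X2 = 0" "g X2 X1 = 0"
    and "y \<in> W \<Longrightarrow> g y X1 = 0 \<and> g y X2 = 0"
    and "x1 *\<^sub>R J X1 + x2 *\<^sub>R J X2 \<in> A \<Longrightarrow> x1 = 0 \<and> x2 = 0"
    and "x \<in> V \<Longrightarrow> \<exists>y\<in>W. \<exists>x1 x2 u1 u2. x = y + x1 *\<^sub>R X1 + x2 *\<^sub>R X2 + u1 *\<^sub>R J X1 + u2 *\<^sub>R J X2"
  using assms g_sym[of X2 X1] unfolding frame_def by auto

lemma frame_exists: obtains X1 X2 where "frame X1 X2"
proof -
  obtain n1 n2 where n: "n1 \<in> V" "n2 \<in> V" "g n1 n1 = 1" "g n2 n2 = 1" "g n1 n2 = 0"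
    and A: "\<And>x. x \<in> V \<Longrightarrow> x \<in> A \<longleftrightarrow> g x n1 = 0 \<and> g x n2 = 0" using normals_exist by metis
  define t where "t = g (J n1) n2"
  have Jn: "J n1 \<in> V" "J n2 \<in> V" using n J_in by auto
  have gJ: "g (J n2) n1 = - t" "g n2 (J n1) = t" "g n1 (J n2) = - t" "g n2 n1 = 0"
    "g (J n1) (J n1) = 1" "g (J n2) (J n2) = 1" "g (J n1) (J n2) = 0" "g (J n2) (J n1) = 0"
    "g (J n1) n2 = t"
  proof -
    show "g (J n2) n1 = - t" "g n1 (J n2) = - t" "g n2 (J n1) = t"
      unfolding t_def using g_J_left[OF n(1,2)] g_sym[of "J n2" n1] g_sym[of "J n1" n2] by auto
    show "g n2 n1 = 0" "g (J n2) (J n1) = 0" using n g_sym[of n2 n1] by (simp_all add: g_J_J)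
  qed (simp_all add: g_J_J n t_def)
  have swap: "g (J x) n1 = - g x (J n1)" "g (J x) n2 = - g x (J n2)" if "x \<in> V" for x
    using g_J_left[OF that] n by auto
  note gs = g_linear gJ n(3-5) g_J_self[OF n(1)] g_J_self[OF n(2)]
  \<comment> \<open>The parts of J n1 and J n2 tangent to A. Because g(J n1, n1) = 0 and g(J n1, n2)
    = t = - g(J n2, n1), each of them takes a single correction.\<close>
  define k1 where "k1 = J n1 - t *\<^sub>R n2"
  define k2 where "k2 = J n2 + t *\<^sub>R n1"
  have kV: "k1 \<in> V" "k2 \<in> V" unfolding k1_def k2_def using Jn n by (auto intro!: V_add V_diff V_scale)
  have gk: "g k1 k1 = 1 - t * t" "g k2 k2 = 1 - t * t" "g k1 k2 = 0" "g k1 n1 = 0" "g k1 n2 = 0"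
    "g k2 n1 = 0" "g k2 n2 = 0"
    unfolding k1_def k2_def by (simp_all add: gs)
  \<comment> \<open>Otherwise both tangent parts vanish and the normal plane is J-invariant. Its
    orthogonal complement A would then be J-invariant as well.\<close>
  have t: "1 - t * t > 0"
  proof (rule ccontr)
    assume "\<not> 1 - t * t > 0"
    then have "g k1 k1 = 0 \<and> g k2 k2 = 0" using gk g_nonneg[OF kV(1)] by auto
    then have k0: "J n1 = t *\<^sub>R n2" "J n2 = - t *\<^sub>R n1"
      using kV g_eq_0_iff unfolding k1_def k2_def by (auto simp: eq_neg_iff_add_eq_0)
    have "J x \<in> A" if "x \<in> A" for x
      using that A[of x] A[of "J x"] A_V[of x] J_in swap[of x] k0 by (simp add: g_linear)
    then show False using not_invariant by blast
  qed
  define s where "s = sqrt (1 - t * t)"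
  have s: "s > 0" "s * s = 1 - t * t" unfolding s_def using t by auto
  define e1 where "e1 = (1 / s) *\<^sub>R k1"
  define e2 where "e2 = (1 / s) *\<^sub>R k2"
  have eV: "e1 \<in> V" "e2 \<in> V" unfolding e1_def e2_def using kV V_scale by auto
  have eA: "e1 \<in> A" "e2 \<in> A" using A eV unfolding e1_def e2_def by (simp_all add: g_linear gk)
  have ge: "g e1 e1 = 1" "g e2 e2 = 1" "g e1 e2 = 0" "g e2 e1 = 0"
    using s unfolding e1_def e2_def by (simp_all add: g_linear gk g_sym[of k2 k1] s(2)[symmetric])
  have Jn_e: "J n1 = s *\<^sub>R e1 + t *\<^sub>R n2" "J n2 = s *\<^sub>R e2 - t *\<^sub>R n1"
    using s unfolding e1_def e2_def k1_def k2_def by simp_all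
  have Jen: "g (J e1) n1 = - s" "g (J e1) n2 = 0" "g (J e2) n1 = 0" "g (J e2) n2 = - s"
    using eA A[OF eV(1)] A[OF eV(2)] by (simp_all add: swap eV Jn_e g_linear ge)
  have perp: "g y e1 = 0 \<and> g y e2 = 0" if "y \<in> W" for y
  proof -
    have y: "y \<in> V" "g y n1 = 0" "g y n2 = 0" "g (J y) n1 = 0" "g (J y) n2 = 0"
      using that A[of y] A[of "J y"] A_V J_in unfolding W_def by auto
    then have "s * g y e1 = 0" "s * g y e2 = 0" using swap[OF y(1)] by (simp_all add: Jn_e g_linear)
    then show ?thesis using s by simp
  qed
  have tr: "x1 = 0 \<and> x2 = 0" if "x1 *\<^sub>R J e1 + x2 *\<^sub>R J e2 \<in> A" for x1 x2
    using that A[OF A_V[OF that]] s Jen by (simp add: g_linear)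
  have dec: "\<exists>y\<in>W. \<exists>x1 x2 u1 u2. x = y + x1 *\<^sub>R e1 + x2 *\<^sub>R e2 + u1 *\<^sub>R J e1 + u2 *\<^sub>R J e2"
    if x: "x \<in> V" for x
  proof -
    \<comment> \<open>J e1 and J e2 have normal components -s n1 and -s n2, so these coefficients
      cancel the normal part of x.\<close>
    define u1 where "u1 = - g x n1 / s"
    define u2 where "u2 = - g x n2 / s"
    define x' where "x' = x - u1 *\<^sub>R J e1 - u2 *\<^sub>R J e2"
    have x'V: "x' \<in> V" unfolding x'_def using x eV by (auto intro!: V_diff V_scale J_in)
    have x'A: "x' \<in> A" unfolding A[OF x'V] unfolding x'_def u1_def u2_def using s by (simp add: g_linear Jen)
    define y where "y = x' - g x' e1 *\<^sub>R e1 - g x' e2 *\<^sub>R e2"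
    have yA: "y \<in> A" unfolding y_def using x'A eA by (intro A_diff A_scale)
    have ye: "g y e1 = 0" "g y e2 = 0" unfolding y_def by (simp_all add: g_linear ge)
    have yV: "y \<in> V" using yA A_V by blast
    \<comment> \<open>J n1 and J n2 are combinations of e1, e2 and the normals, all of them
      orthogonal to y.\<close>
    have "J y \<in> A" using A[OF J_in[OF yV]] swap[OF yV] A[OF yV] yA ye by (simp add: Jn_e g_linear)
    then have "y \<in> W" unfolding W_def using yA by blast
    moreover have "x = y + g x' e1 *\<^sub>R e1 + g x' e2 *\<^sub>R e2 + u1 *\<^sub>R J e1 + u2 *\<^sub>R J e2"
      unfolding y_def x'_def by simp
    ultimately show ?thesis by blast
  qed
  have "frame e1 e2" unfolding frame_def using eA ge perp tr dec by blast
  then show ?thesis using that by blast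
qed

text \<open>A rotation with cosine \<open>c\<close> and sine \<open>s\<close>, followed by the sign
  \<open>e\<close> on the second vector. It carries X1 to the direction of the unit and leaves the
  sign of X2 open.\<close>

lemma frame_rotate:
  assumes f: "frame X1 X2" and c: "c * c + s * s = 1" and e: "e * e = 1"
  shows "frame (c *\<^sub>R X1 + s *\<^sub>R X2) (e *\<^sub>R (c *\<^sub>R X2 - s *\<^sub>R X1))" (is "frame ?Y1 ?Y2")
proof -
  note X = frameD(1-6)[OF f] and p = frameD(7)[OF f] and tr = frameD(8)[OF f] and dec = frameD(9)[OF f]
  have inv: "X1 = c *\<^sub>R ?Y1 - (s * e) *\<^sub>R ?Y2" "X2 = s *\<^sub>R ?Y1 + (c * e) *\<^sub>R ?Y2"
  proof -
    have "c *\<^sub>R ?Y1 - (s * e) *\<^sub>R ?Y2 = (c * c + (e * e) * (s * s)) *\<^sub>R X1 + (c * s - (e * e) * (c * s)) *\<^sub>R X2"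
      by (simp add: algebra_simps)
    then show "X1 = c *\<^sub>R ?Y1 - (s * e) *\<^sub>R ?Y2" by (simp add: c e)
    have "s *\<^sub>R ?Y1 + (c * e) *\<^sub>R ?Y2 = (s * s + (e * e) * (c * c)) *\<^sub>R X2 + (c * s - (e * e) * (c * s)) *\<^sub>R X1"
      by (simp add: algebra_simps)
    then show "X2 = s *\<^sub>R ?Y1 + (c * e) *\<^sub>R ?Y2" using c by (simp add: e add.commute)
  qed
  have gY: "g ?Y1 ?Y1 = 1" "g ?Y2 ?Y2 = 1" "g ?Y1 ?Y2 = 0"
    using c e X by (simp_all add: g_linear algebra_simps) (metis distrib_left mult.left_commute mult.right_neutral)
  have tr': "x1 = 0 \<and> x2 = 0" if "x1 *\<^sub>R J ?Y1 + x2 *\<^sub>R J ?Y2 \<in> A" for x1 x2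
  proof -
    have eq: "x1 *\<^sub>R J ?Y1 + x2 *\<^sub>R J ?Y2 = (x1 * c - x2 * e * s) *\<^sub>R J X1 + (x1 * s + x2 * e * c) *\<^sub>R J X2"
      by (simp add: J_add J_diff J_scale algebra_simps)
    have z: "x1 * c - x2 * e * s = 0" "x1 * s + x2 * e * c = 0"
      using tr[OF that[unfolded eq]] by auto
    have "x1 = 0" using z c by algebra
    moreover have "x2 = 0" using z c e by algebra
    ultimately show ?thesis by simp
  qed
  have dec': "\<exists>y\<in>W. \<exists>x1 x2 u1 u2. x = y + x1 *\<^sub>R ?Y1 + x2 *\<^sub>R ?Y2 + u1 *\<^sub>R J ?Y1 + u2 *\<^sub>R J ?Y2"
    if xV: "x \<in> V" for x
  proof -
    obtain y x1 x2 u1 u2 where y: "y \<in> W"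
      and x: "x = y + x1 *\<^sub>R X1 + x2 *\<^sub>R X2 + u1 *\<^sub>R J X1 + u2 *\<^sub>R J X2"
      using dec[OF xV] by blast
    have JX: "J X1 = c *\<^sub>R J ?Y1 - (s * e) *\<^sub>R J ?Y2" "J X2 = s *\<^sub>R J ?Y1 + (c * e) *\<^sub>R J ?Y2"
      by (metis inv(1) J_diff J_scale, metis inv(2) J_add J_scale)
    define Z1 Z2 where "Z1 = ?Y1" and "Z2 = ?Y2"
    have "x = y + x1 *\<^sub>R (c *\<^sub>R Z1 - (s * e) *\<^sub>R Z2) + x2 *\<^sub>R (s *\<^sub>R Z1 + (c * e) *\<^sub>R Z2)
        + u1 *\<^sub>R (c *\<^sub>R J Z1 - (s * e) *\<^sub>R J Z2) + u2 *\<^sub>R (s *\<^sub>R J Z1 + (c * e) *\<^sub>R J Z2)"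
      unfolding x Z1_def Z2_def using inv JX by metis
    then have "x = y + (x1 * c + x2 * s) *\<^sub>R Z1 + (x2 * c * e - x1 * s * e) *\<^sub>R Z2
        + (u1 * c + u2 * s) *\<^sub>R J Z1 + (u2 * c * e - u1 * s * e) *\<^sub>R J Z2"
      by (simp add: algebra_simps)
    then show ?thesis using y unfolding Z1_def Z2_def by blast
  qed
  show ?thesis unfolding frame_def using X gY p tr' dec'
    by (auto intro!: A_add A_scale A_diff simp: g_linear)
qed

text \<open>Independence of JX1, JX2 modulo A kills their coefficients; the others are inner
  products because X1, X2 are orthonormal and orthogonal to W.\<close>

lemma A_decompose:
  assumes f: "frame X1 X2" and v: "v \<in> A"
  shows "v - g v X1 *\<^sub>R X1 - g v X2 *\<^sub>R X2 \<in> W"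
proof -
  obtain y x1 x2 u1 u2 where y: "y \<in> W"
    and x: "v = y + x1 *\<^sub>R X1 + x2 *\<^sub>R X2 + u1 *\<^sub>R J X1 + u2 *\<^sub>R J X2"
    using f A_V[OF v] unfolding frame_def by blast
  have X: "X1 \<in> A" "X2 \<in> A" using f unfolding frame_def by auto
  have "u1 *\<^sub>R J X1 + u2 *\<^sub>R J X2 = v - (y + x1 *\<^sub>R X1 + x2 *\<^sub>R X2)" unfolding x by simp
  moreover have "\<dots> \<in> A" using v y X W_A by (intro A_diff A_add A_scale) auto
  ultimately have "u1 = 0 \<and> u2 = 0" using f unfolding frame_def by metis
  then have x: "v = y + x1 *\<^sub>R X1 + x2 *\<^sub>R X2" using x by simp
  then have "g v X1 = x1" "g v X2 = x2"
    using f y g_sym[of X2 X1] unfolding frame_def by (auto simp: g_linear)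
  then show ?thesis using x y by simp
qed

text \<open>As X, y and J y lie in the abelian ideal A, integrability for X, y reduces to [JX, Jy] =
  J[JX, y]. Both brackets lie in A, hence [JX, y] lies in W.\<close>

lemma ad_W:
  assumes X: "X \<in> A" and y: "y \<in> W"
  shows "br (J X) y \<in> W" "br (J X) (J y) = J (br (J X) y)"
proof -
  have V: "X \<in> V" "y \<in> V" "J X \<in> V" "J y \<in> V" using X y A_V W_V J_in by auto
  show e: "br (J X) (J y) = J (br (J X) y)"
    using integrable[OF V(1,2)] abelian[OF X W_A[OF y]] abelian[OF X, of "J y"] y
    unfolding W_def by simp
  show "br (J X) y \<in> W" unfolding W_def
    using br_in_A[OF V(3,2)] br_in_A[OF V(3,4)] e by simp
qed

lemma complex_endo_ad: "X \<in> A \<Longrightarrow> complex_endo W (br (J X))"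
  unfolding complex_endo_def using ad_W linear_br_right by blast

text \<open>Integrability on A writes [JX, JY] as J of [JX, Y] - [JY, X]. Being a bracket it lies in
  A, which puts the difference into W: the product [JX, Y] is commutative on A/W.\<close>

lemma br_J_J:
  assumes X: "X \<in> A" and Y: "Y \<in> A"
  shows "br (J X) (J Y) = J (br (J X) Y - br (J Y) X)" "br (J X) Y - br (J Y) X \<in> W"
    "br (J X) (J Y) \<in> W"
proof -
  have V: "X \<in> V" "Y \<in> V" "J X \<in> V" "J Y \<in> V" using X Y A_V J_in by auto
  show e: "br (J X) (J Y) = J (br (J X) Y - br (J Y) X)"
    using integrable[OF V(1,2)] abelian[OF X Y] br_commute[of X "J Y"] by (simp add: J_diff J_neg eq_iff_diff_eq_0[of "br (J X) (J Y)"] algebra_simps)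
  have "br (J X) Y - br (J Y) X \<in> A" using br_in_A V by (intro A_diff) auto
  then show w: "br (J X) Y - br (J Y) X \<in> W" unfolding W_def using e br_in_A[OF V(3,4)] by simp
  show "br (J X) (J Y) \<in> W" unfolding e by (rule W_J[OF w])
qed

text \<open>The Jacobi identity, with [x, y] in A acting trivially on v. Together with commutativity
  this is associativity of the product on A/W; applied to W it shows that D_1 and D_2
  commute.\<close>

lemma ad_commute:
  assumes "x \<in> V" "y \<in> V" "v \<in> A"
  shows "br x (br y v) = br y (br x v)"
proof -
  have "br v (br x y) = 0" using abelian assms br_in_A by blast
  then show ?thesis using jacobi[OF assms(1,2) A_V[OF assms(3)]] br_commute[of v x]
    by (simp add: br_neg_right)
qed

text \<open>The bracket table modulo W; the W-components left open here are the later h_jk.\<close>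

definition normal_frame :: "'v \<Rightarrow> 'v \<Rightarrow> real \<Rightarrow> real \<Rightarrow> real \<Rightarrow> bool" where
  "normal_frame X1 X2 a b1 b2 \<longleftrightarrow> frame X1 X2 \<and>
     br (J X1) X1 - a *\<^sub>R X1 \<in> W \<and> br (J X1) X2 - a *\<^sub>R X2 \<in> W \<and>
     br (J X2) X1 - a *\<^sub>R X2 \<in> W \<and> br (J X2) X2 - (b1 *\<^sub>R X1 + b2 *\<^sub>R X2) \<in> W"

text \<open>The six numbers are the structure constants of the product on A/W in the frame. Their
  associativity comes from \<open>ad_commute\<close>, and perfectness from A being spanned by
  brackets; \<open>unital_of_perfect\<close> then gives the coordinates of the unit.\<close>

lemma frame_unit_exists:
  assumes f: "frame X1 X2"
  obtains \<alpha> \<beta> where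
    "br (J (\<alpha> *\<^sub>R X1 + \<beta> *\<^sub>R X2)) X1 - X1 \<in> W" "br (J (\<alpha> *\<^sub>R X1 + \<beta> *\<^sub>R X2)) X2 - X2 \<in> W"
proof -
  note X = frameD(1-6)[OF f] and p = frameD(7)[OF f] and dec = frameD(9)[OF f]
  have XV: "X1 \<in> V" "X2 \<in> V" "J X1 \<in> V" "J X2 \<in> V" using X A_V J_in by auto
  define c where "c = (\<lambda>x v l. g (br (J x) v) l)"
  define p' q r s t u where "p' = c X1 X1 X1" and "q = c X1 X1 X2" and "r = c X1 X2 X1"
    and "s = c X1 X2 X2" and "t = c X2 X2 X1" and "u = c X2 X2 X2"
  \<comment> \<open>Commutativity of the product: the two mixed products differ by an element of W,
    which is orthogonal to the frame.\<close>
  have rs: "c X2 X1 X1 = r" "c X2 X1 X2 = s"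
    using p[OF br_J_J(2)[OF X(1,2)]] unfolding r_def s_def c_def by (simp_all add: g_linear)
  have cW: "c X y X1 = 0 \<and> c X y X2 = 0" if "X \<in> A" "y \<in> W" for X y
    using p[OF ad_W(1)[OF that]] unfolding c_def by simp
  have cA: "c X v l = g v X1 * c X X1 l + g v X2 * c X X2 l"
    if "X \<in> A" "v \<in> A" "l = X1 \<or> l = X2" for X v l
  proof -
    have "c X (v - g v X1 *\<^sub>R X1 - g v X2 *\<^sub>R X2) l = 0"
      using cW[OF that(1) A_decompose[OF f that(2)]] that(3) by blast
    then show ?thesis unfolding c_def by (simp add: br_linear g_linear)
  qed
  have comp: "c X (br (J Y) v) l = c Y v X1 * c X X1 l + c Y v X2 * c X X2 l"
    if "X \<in> A" "Y \<in> A" "v \<in> A" "l = X1 \<or> l = X2" for X Y v l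
    using cA[OF that(1) br_in_A[OF J_in[OF A_V[OF that(2)]] A_V[OF that(3)]] that(4)] unfolding c_def .
  have sw: "c X1 (br (J X2) v) l = c X2 (br (J X1) v) l" if "v \<in> A" for v l
    unfolding c_def using ad_commute[OF XV(3,4) that] by simp
  have as: "s * r = q * t" "r * q + s * s = p' * s + q * u" "t * p' + u * r = r * r + s * t"
    using sw[of X1 X1] sw[of X1 X2] sw[of X2 X1] X(1,2)
    by (simp_all add: comp rs p'_def[symmetric] q_def[symmetric] r_def[symmetric] s_def[symmetric]
        t_def[symmetric] u_def[symmetric] algebra_simps)
  have perf: "l = 0 \<and> m = 0"
    if lm: "l * p' + m * q = 0" "l * r + m * s = 0" "l * t + m * u = 0" for l m
  proof -
    \<comment> \<open>A functional on A/W that annihilates all products. The following shows that it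
      annihilates every bracket, hence all of A, and its values at X1 and X2 are \<open>l\<close>
      and \<open>m\<close>.\<close>
    define F where "F = (\<lambda>v. l * g v X1 + m * g v X2)"
    have F_add: "F (x + y) = F x + F y" "F (k *\<^sub>R x) = k * F x" for x y k
      unfolding F_def by (simp_all add: g_linear algebra_simps)
    have F_lin: "linear F" by (rule linearI) (simp_all add: F_add)
    have FW: "F y = 0" if "y \<in> W" for y unfolding F_def using p[OF that] by simp
    have FX: "F (br (J X1) X1) = 0" "F (br (J X1) X2) = 0" "F (br (J X2) X1) = 0" "F (br (J X2) X2) = 0"
      using lm rs unfolding F_def p'_def q_def r_def s_def t_def u_def c_def by simp_all
    have Fbr: "F (br (J X) v) = 0" if "X = X1 \<or> X = X2" "v \<in> A" for X v
    proof -
      have "F (br (J X) (v - g v X1 *\<^sub>R X1 - g v X2 *\<^sub>R X2)) = 0"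
        using FW[OF ad_W(1)[OF _ A_decompose[OF f that(2)]]] that(1) X by blast
      then show ?thesis using that(1) FX by (auto simp: br_linear linear_diff[OF F_lin] F_add)
    qed
    have "F (br x x') = 0" if "x \<in> V" "x' \<in> V" for x x'
    proof -
      obtain y x1 x2 u1 u2 where y: "y \<in> W"
        and x: "x = y + x1 *\<^sub>R X1 + x2 *\<^sub>R X2 + u1 *\<^sub>R J X1 + u2 *\<^sub>R J X2" using dec[OF \<open>x \<in> V\<close>] by blast
      obtain y' x1' x2' u1' u2' where y': "y' \<in> W"
        and x': "x' = y' + x1' *\<^sub>R X1 + x2' *\<^sub>R X2 + u1' *\<^sub>R J X1 + u2' *\<^sub>R J X2" using dec[OF \<open>x' \<in> V\<close>] by blast
      define v v' where "v = y + x1 *\<^sub>R X1 + x2 *\<^sub>R X2" and "v' = y' + x1' *\<^sub>R X1 + x2' *\<^sub>R X2"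
      have v: "v \<in> A" "v' \<in> A" unfolding v_def v'_def using X W_A y y' by (auto intro!: A_add A_scale)
      \<comment> \<open>Split into A-parts and J-parts: brackets inside A vanish, those of JX_j with
        A are products, and [JX1, JX2] lies in W.\<close>
      have "br x x' = br v v' + u1 *\<^sub>R br (J X1) v' + u2 *\<^sub>R br (J X2) v' - u1' *\<^sub>R br (J X1) v - u2' *\<^sub>R br (J X2) v
          + (u1 * u2' - u2 * u1') *\<^sub>R br (J X1) (J X2)"
        unfolding x x' v_def[symmetric] v'_def[symmetric]
        using br_commute[of v "J X1"] br_commute[of v "J X2"] br_commute[of "J X2" "J X1"]
        by (simp add: br_linear algebra_simps)
      then show ?thesis
        using v Fbr FW[OF br_J_J(3)[OF X(1,2)]] by (simp add: abelian linear_diff[OF F_lin] F_add linear_0[OF F_lin])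
    qed
    then have "{br x y | x y. x \<in> V \<and> y \<in> V} \<subseteq> {v. F v = 0}" by auto
    moreover have "subspace {v. F v = 0}" unfolding subspace_def by (simp add: F_add linear_0[OF F_lin])
    ultimately have "F v = 0" if "v \<in> A" for v using span_minimal that unfolding A_span by blast
    from this[OF X(1)] this[OF X(2)] show ?thesis unfolding F_def using X by simp
  qed
  obtain \<alpha> \<beta> where ab: "\<alpha> * p' + \<beta> * r = 1" "\<alpha> * q + \<beta> * s = 0" "\<alpha> * r + \<beta> * t = 0" "\<alpha> * s + \<beta> * u = 1"
  proof (rule unital_of_perfect[OF as])
    show "l = 0 \<and> m = 0" if "l * p' + m * q = 0" "l * r + m * s = 0" "l * t + m * u = 0" for l m
      by (rule perf[OF that])
  qed
  define e where "e = \<alpha> *\<^sub>R X1 + \<beta> *\<^sub>R X2"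
  have e: "e \<in> A" unfolding e_def using X by (intro A_add A_scale)
  have be: "br (J e) v = \<alpha> *\<^sub>R br (J X1) v + \<beta> *\<^sub>R br (J X2) v" for v
    unfolding e_def by (simp add: J_add J_scale br_linear)
  have ge: "g (br (J e) X1) X1 = 1" "g (br (J e) X1) X2 = 0" "g (br (J e) X2) X1 = 0" "g (br (J e) X2) X2 = 1"
    unfolding be using ab rs unfolding p'_def q_def r_def s_def t_def u_def c_def by (simp_all add: g_linear)
  have "br (J e) X1 \<in> A" "br (J e) X2 \<in> A" using br_in_A J_in A_V e XV by auto
  from A_decompose[OF f this(1)] A_decompose[OF f this(2)]
  have "br (J e) X1 - X1 \<in> W" "br (J e) X2 - X2 \<in> W" by (simp_all add: ge)
  then show ?thesis using that unfolding e_def by blast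
qed

lemma normal_frame_exists:
  obtains X1 X2 a b1 b2 where "normal_frame X1 X2 a b1 b2" "a > 0" "b2 \<ge> 0"
proof -
  obtain E1 E2 where f: "frame E1 E2" using frame_exists by blast
  obtain \<alpha> \<beta> where u: "br (J (\<alpha> *\<^sub>R E1 + \<beta> *\<^sub>R E2)) E1 - E1 \<in> W" "br (J (\<alpha> *\<^sub>R E1 + \<beta> *\<^sub>R E2)) E2 - E2 \<in> W"
    using frame_unit_exists[OF f] by metis
  define e where "e = \<alpha> *\<^sub>R E1 + \<beta> *\<^sub>R E2"
  note u = u[folded e_def]
  define \<rho> where "\<rho> = sqrt (\<alpha> * \<alpha> + \<beta> * \<beta>)"
  have "E1 \<notin> W" using f unfolding frame_def by fastforce
  \<comment> \<open>For a zero unit, the relation [Je, E1] - E1 in W would put E1 itself into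
    W.\<close>
  then have "\<not> (\<alpha> = 0 \<and> \<beta> = 0)" using u(1) W_neg unfolding e_def by force
  then have "\<alpha> * \<alpha> + \<beta> * \<beta> > 0" by (simp add: sum_squares_gt_zero_iff)
  then have \<rho>: "\<rho> > 0" "\<rho> * \<rho> = \<alpha> * \<alpha> + \<beta> * \<beta>" unfolding \<rho>_def by auto
  have unit: "(\<alpha> / \<rho>) * (\<alpha> / \<rho>) + (\<beta> / \<rho>) * (\<beta> / \<rho>) = 1"
  proof -
    have "(\<alpha> / \<rho>) * (\<alpha> / \<rho>) + (\<beta> / \<rho>) * (\<beta> / \<rho>) = (\<alpha> * \<alpha> + \<beta> * \<beta>) / (\<rho> * \<rho>)"
      by (simp add: add_divide_distrib)
    also have "\<dots> = 1" unfolding \<rho>(2)[symmetric] using \<rho>(1) by simp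
    finally show ?thesis .
  qed
  define X1 where "X1 = (\<alpha> / \<rho>) *\<^sub>R E1 + (\<beta> / \<rho>) *\<^sub>R E2"
  define Z where "Z = (\<alpha> / \<rho>) *\<^sub>R E2 - (\<beta> / \<rho>) *\<^sub>R E1"
  have fs: "frame X1 (k *\<^sub>R Z)" if "k * k = 1" for k
    unfolding X1_def Z_def by (rule frame_rotate[OF f unit that])
  have f1: "frame X1 Z" using fs[of 1] by simp
  have XA: "X1 \<in> A" "Z \<in> A" using f1 unfolding frame_def by auto
  have XV: "J X1 \<in> V" "J Z \<in> V" "X1 \<in> V" "Z \<in> V" using XA A_V J_in by auto
  have X1e: "X1 = (1 / \<rho>) *\<^sub>R e" unfolding X1_def e_def by (simp add: scaleR_add_right)
  have ad: "br (J X1) (x *\<^sub>R E1 + y *\<^sub>R E2) - (1 / \<rho>) *\<^sub>R (x *\<^sub>R E1 + y *\<^sub>R E2) \<in> W" for x y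
  proof -
    have "br (J X1) (x *\<^sub>R E1 + y *\<^sub>R E2) - (1 / \<rho>) *\<^sub>R (x *\<^sub>R E1 + y *\<^sub>R E2)
       = (1 / \<rho>) *\<^sub>R (x *\<^sub>R (br (J e) E1 - E1) + y *\<^sub>R (br (J e) E2 - E2))"
      unfolding X1e by (simp add: J_scale br_linear algebra_simps)
    then show ?thesis using u by (auto intro!: W_scale W_add)
  qed
  define a where "a = 1 / \<rho>"
  have a: "a > 0" unfolding a_def using \<rho> by simp
  have d11: "br (J X1) X1 - a *\<^sub>R X1 \<in> W" using ad[of "\<alpha> / \<rho>" "\<beta> / \<rho>"] unfolding X1_def[symmetric] a_def .
  have d12: "br (J X1) Z - a *\<^sub>R Z \<in> W" using ad[of "- \<beta> / \<rho>" "\<alpha> / \<rho>"] unfolding Z_def a_def by simp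
  \<comment> \<open>Commutativity modulo W transfers the relation X1 Z = a Z to Z X1.\<close>
  have d21: "br (J Z) X1 - a *\<^sub>R Z \<in> W"
    using W_diff[OF d12 br_J_J(2)[OF XA]] by simp
  \<comment> \<open>Replacing Z by -Z preserves Z Z, so the Z-coefficient of the product changes
    sign with Z; \<open>k\<close> makes it nonnegative.\<close>
  define k where "k = (if g (br (J Z) Z) Z \<ge> 0 then 1 else - 1 :: real)"
  have k: "k * k = 1" "k * g (br (J Z) Z) Z \<ge> 0" unfolding k_def by auto
  define X2 where "X2 = k *\<^sub>R Z"
  define b1 where "b1 = g (br (J Z) Z) X1"
  define b2 where "b2 = k * g (br (J Z) Z) Z"
  have d22: "br (J Z) Z - (b1 *\<^sub>R X1 + b2 *\<^sub>R X2) \<in> W"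
  proof -
    have "b2 *\<^sub>R X2 = ((k * k) * g (br (J Z) Z) Z) *\<^sub>R Z"
      unfolding b2_def X2_def by (simp add: ac_simps)
    then show ?thesis
      using A_decompose[OF f1 br_in_A[OF XV(2,4)]] k(1) unfolding b1_def by (simp add: algebra_simps)
  qed
  have "br (J X1) X2 - a *\<^sub>R X2 = k *\<^sub>R (br (J X1) Z - a *\<^sub>R Z)"
    "br (J X2) X1 - a *\<^sub>R X2 = k *\<^sub>R (br (J Z) X1 - a *\<^sub>R Z)"
    "br (J X2) X2 = (k * k) *\<^sub>R br (J Z) Z"
    unfolding X2_def by (simp_all add: J_scale br_linear algebra_simps)
  then have "normal_frame X1 X2 a b1 b2"
    unfolding normal_frame_def using fs[OF k(1)] d11 d12 d21 d22 k(1)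
    by (simp add: X2_def[symmetric] W_scale)
  then show ?thesis using that a k(2) unfolding b2_def by blast
qed

section \<open>The SKT identity on W\<close>

abbreviation rec :: "'v ah_data" where "rec \<equiv> \<lparr>vs = V, bracket = br, metric = g, cplx = J\<rparr>"

text \<open>The term with [JY1, JY2] vanishes in the abelian ideal. In the other two, J commutes
  with [Jv, _] on W, which turns real inner products into imaginary parts of \<open>hm\<close>. The
  second equation reflects the cyclic symmetry of \<open>torsion\<close>.\<close>

lemma torsion_W:
  assumes v: "v \<in> A" and Y: "Y1 \<in> W" "Y2 \<in> W"
  shows "torsion rec v Y1 Y2 = - Im (sym_form (br (J v)) Y1 Y2)"
    "torsion rec Y1 Y2 v = - Im (sym_form (br (J v)) Y1 Y2)"
proof -
  have YV: "Y1 \<in> V" "Y2 \<in> V" "br (J v) Y1 \<in> V" "br (J v) Y2 \<in> V"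
    using Y W_V ad_W(1)[OF v] by auto
  have z: "br (J Y1) (J Y2) = 0" using abelian W_A[OF W_J[OF Y(1)]] W_A[OF W_J[OF Y(2)]] by blast
  have i: "Im (hm (br (J v) Y1) Y2) = - g (J (br (J v) Y1)) Y2"
    "Im (hm Y1 (br (J v) Y2)) = g (J (br (J v) Y2)) Y1"
    unfolding hm_def using g_J_left[OF YV(3,2)] g_sym[of Y1 "J (br (J v) Y2)"] by simp_all
  show "torsion rec v Y1 Y2 = - Im (sym_form (br (J v)) Y1 Y2)"
    "torsion rec Y1 Y2 v = - Im (sym_form (br (J v)) Y1 Y2)"
    unfolding torsion_def sym_form_def using z i br_commute[of "J Y2" "J v"] ad_W(2)[OF v Y(1)] ad_W(2)[OF v Y(2)]
    by (simp_all add: g_linear)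
qed

lemma sym_form_commute:
  assumes "X \<in> A" "x \<in> W" "y \<in> W"
  shows "sym_form (br (J X)) y x = cnj (sym_form (br (J X)) x y)"
proof -
  have V: "x \<in> V" "y \<in> V" "br (J X) x \<in> V" "br (J X) y \<in> V"
    using ad_W(1)[OF assms(1)] assms W_V by auto
  show ?thesis unfolding sym_form_def
    using hm_commute[OF V(1,4)] hm_commute[OF V(3,2)] by simp
qed

text \<open>In the SKT identity on Y1, Y2, X, JX' only brackets with JX' survive, since the other
  three arguments lie in A. This gives the imaginary part of the claim.\<close>

lemma sym_form_skt:
  assumes X: "X \<in> A" "X' \<in> A" and Y: "Y1 \<in> W" "Y2 \<in> W"
  shows "sym_form (br (J X)) (br (J X') Y1) Y2 + sym_form (br (J X)) Y1 (br (J X') Y2)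
    + sym_form (br (J (br (J X') X))) Y1 Y2 = 0"
proof -
  define D where "D = br (J X)"
  define D' where "D' = br (J X')"
  define Q where "Q = br (J (br (J X') X))"
  have vA: "br (J X') X \<in> A" using br_in_A J_in X A_V by auto
  have im: "Im (sym_form D (D' Y1) Y2 + sym_form D Y1 (D' Y2) + sym_form Q Y1 Y2) = 0"
    if Y: "Y1 \<in> W" "Y2 \<in> W" for Y1 Y2
  proof -
    have V: "Y1 \<in> V" "Y2 \<in> V" "X \<in> V" "J X' \<in> V" using X Y W_V A_V J_in by auto
    have z: "br Y1 Y2 = 0" "br Y1 X = 0" "br Y2 X = 0" using abelian X Y W_A by auto
    have dW: "D' Y1 \<in> W" "D' Y2 \<in> W" unfolding D'_def using ad_W X Y by auto
    have n: "torsion rec (- x) y u = - torsion rec x y u" for x y u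
      unfolding torsion_def by (simp add: g_linear br_linear J_neg)
    have z3: "torsion rec 0 y u = 0" for y u
      unfolding torsion_def by simp
    have "0 = torsion rec (br Y1 (J X')) Y2 X - torsion rec (br Y2 (J X')) Y1 X + torsion rec (br X (J X')) Y1 Y2"
      using skt_identity[OF V] unfolding d_torsion_def by (simp add: z z3)
    also have "\<dots> = - torsion rec (D' Y1) Y2 X + torsion rec (D' Y2) Y1 X - torsion rec (br (J X') X) Y1 Y2"
      unfolding br_commute[of _ "J X'"] n D'_def by simp
    also have "\<dots> = Im (sym_form D (D' Y1) Y2) - Im (sym_form D (D' Y2) Y1) + Im (sym_form Q Y1 Y2)"
      unfolding D_def Q_def using torsion_W(2)[OF X(1)] torsion_W(1)[OF vA Y] Y dW by simp
    also have "sym_form D (D' Y2) Y1 = cnj (sym_form D Y1 (D' Y2))"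
      unfolding D_def by (rule sym_form_commute[OF X(1) Y(1) dW(2)])
    finally show ?thesis by simp
  qed
  have JY: "sym_form (br (J X)) (J x) y = \<i> * sym_form (br (J X)) x y"
    if "X \<in> A" "x \<in> W" "y \<in> W" for X x y
    unfolding sym_form_def using that ad_W[OF that(1)] W_V by (simp add: hm_J_left algebra_simps)
  have dW: "D' Y1 \<in> W" "D' Y2 \<in> W" unfolding D'_def using ad_W X Y by auto
  \<comment> \<open>Replacing Y1 by J Y1 multiplies the sesquilinear expression by i, so the
    imaginary identity also supplies the real part.\<close>
  have "Im (\<i> * (sym_form D (D' Y1) Y2 + sym_form D Y1 (D' Y2) + sym_form Q Y1 Y2)) = 0"
    using im[OF W_J[OF Y(1)] Y(2)] unfolding D_def Q_def
    by (simp add: JY X vA Y dW ad_W(2)[OF X(2) Y(1), folded D'_def] algebra_simps)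
  with im[OF Y] have "sym_form D (D' Y1) Y2 + sym_form D Y1 (D' Y2) + sym_form Q Y1 Y2 = 0"
    by (simp add: complex_eq_iff)
  then show ?thesis unfolding D_def D'_def Q_def .
qed

text \<open>For v' in W also J v' lies in A and commutes with W. The operator [Jv, _] on W therefore
  depends only on v modulo W, which allows products to be replaced by their entries in the bracket
  table.\<close>

lemma sym_form_product:
  assumes v: "v \<in> A" "v' \<in> W" "v - v'' = v'" and v'': "v'' \<in> A"  and Y: "Y1 \<in> W" "Y2 \<in> W"
  shows "sym_form (br (J v)) Y1 Y2 = sym_form (br (J v'')) Y1 Y2"
proof -
  have v_eq: "v = v'' + v'" using v by auto
  have "br (J v') Y1 = 0" "br (J v') Y2 = 0" using abelian v Y W_A[OF W_J] W_A by auto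
  then show ?thesis unfolding v_eq sym_form_def by (simp add: J_add br_linear)
qed

text \<open>With (X, X') equal to (X1, X1), (X1, X2), (X2, X2), the products X' X are a X1, a X2 and
  b1 X1 + b2 X2 modulo W, which gives the three identities required for diagonalization.\<close>

lemma diagonal_basis_exists:
  assumes nf: "normal_frame X1 X2 a b1 b2" and a: "a > 0"
  shows "\<exists>m Y z w. unitary_basis W m Y \<and> (\<forall>i\<in>{1..m}.
      br (J X1) (Y i) = cs (z i) (Y i) \<and> br (J X2) (Y i) = cs (w i) (Y i) \<and>
      diagonal_eqs a b1 b2 (z i) (w i))"
proof (rule simultaneous_diagonalization[OF complex_subspace_W])
  have X: "X1 \<in> A" "X2 \<in> A"
    and n: "br (J X1) X1 - a *\<^sub>R X1 \<in> W" "br (J X1) X2 - a *\<^sub>R X2 \<in> W"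
     "br (J X2) X1 - a *\<^sub>R X2 \<in> W" "br (J X2) X2 - (b1 *\<^sub>R X1 + b2 *\<^sub>R X2) \<in> W"
    using nf unfolding normal_frame_def frame_def by auto
  have V: "X1 \<in> V" "X2 \<in> V" "J X1 \<in> V" "J X2 \<in> V" using X A_V J_in by auto
  show "complex_endo W (br (J X1))" "complex_endo W (br (J X2))" using complex_endo_ad X by auto
  show "br (J X1) (br (J X2) x) = br (J X2) (br (J X1) x)" if "x \<in> W" for x
    using ad_commute V W_A[OF that] by blast
  have sc: "sym_form (br (J (p *\<^sub>R X1 + q *\<^sub>R X2))) x y
      = of_real p * sym_form (br (J X1)) x y + of_real q * sym_form (br (J X2)) x y" for p q x y
    unfolding sym_form_def
    by (simp add: J_add J_scale br_linear hm_add_left hm_add_right hm_scale_left hm_scale_right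
        scaleR_conv_of_real algebra_simps)
  have in_A: "br (J X1) X1 \<in> A" "br (J X2) X1 \<in> A" "br (J X2) X2 \<in> A" using br_in_A V by auto
  have lA: "p *\<^sub>R X1 + q *\<^sub>R X2 \<in> A" for p q using X by (intro A_add A_scale)
  fix x y assume xy: "x \<in> W" "y \<in> W"
  have p11: "sym_form (br (J (br (J X1) X1))) x y = of_real a * sym_form (br (J X1)) x y"
    using sym_form_product[OF in_A(1) n(1) refl A_scale[OF X(1)] xy] sc[of a 0] by simp
  have p21: "sym_form (br (J (br (J X2) X1))) x y = of_real a * sym_form (br (J X2)) x y"
    using sym_form_product[OF in_A(2) n(3) refl A_scale[OF X(2)] xy] sc[of 0 a] by simp
  have p22: "sym_form (br (J (br (J X2) X2))) x y
      = of_real b1 * sym_form (br (J X1)) x y + of_real b2 * sym_form (br (J X2)) x y"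
    using sym_form_product[OF in_A(3) n(4) refl lA xy] sc[of b1 b2] by simp
  show "sym_form (br (J X1)) (br (J X1) x) y + sym_form (br (J X1)) x (br (J X1) y)
      + of_real a * sym_form (br (J X1)) x y = 0"
    using sym_form_skt[OF X(1) X(1) xy] p11 by simp
  show "sym_form (br (J X1)) (br (J X2) x) y + sym_form (br (J X1)) x (br (J X2) y)
      + of_real a * sym_form (br (J X2)) x y = 0"
    using sym_form_skt[OF X(1) X(2) xy] p21 by simp
  show "sym_form (br (J X2)) (br (J X2) x) y + sym_form (br (J X2)) x (br (J X2) y)
      + of_real b1 * sym_form (br (J X1)) x y + of_real b2 * sym_form (br (J X2)) x y = 0"
    using sym_form_skt[OF X(2) X(2) xy] p22 by (simp add: add.assoc)
qed (rule a)

end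

section \<open>Alternating forms\<close>

text \<open>Linearity in one slot spreads to all by the sign changes, and a value with a repeated
  argument equals its negative. Sorting the arguments leaves increasing triples; numbering the
  spanning set makes them a finite list.\<close>

lemma alternating3_eq_0:
  fixes F :: "'a::real_vector \<Rightarrow> 'a \<Rightarrow> 'a \<Rightarrow> 'b::real_vector" and b :: "nat \<Rightarrow> 'a"
  assumes lin: "\<And>q r. linear (\<lambda>p. F p q r)"
    and s12: "\<And>p q r. F q p r = - F p q r" and s23: "\<And>p q r. F p r q = - F p q r"
    and B: "span (b ` {..<N}) = UNIV"
    and z: "\<And>i j k. i < j \<Longrightarrow> j < k \<Longrightarrow> k < N \<Longrightarrow> F (b i) (b j) (b k) = 0"
  shows "F p q r = 0"
proof -
  have self: "x = 0" if "x = - x" for x :: 'b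
    using that by (simp add: eq_neg_iff_add_eq_0 scaleR_2[symmetric])
  have eq: "F p p r = 0" "F p r r = 0" for p r
    using self[OF s12] self[OF s23] by auto
  have a1: "F (b i) (b j) (b k) = 0" if "i \<le> j" "i < N" "j < N" "k < N" for i j k
  proof (cases "i = j")
    case True then show ?thesis using eq by simp
  next
    case False
    then consider "k < i" | "k = i" | "i < k" "k < j" | "k = j" | "j < k" using that by linarith
    then show ?thesis
    proof cases
      case 1
      have "F (b i) (b j) (b k) = F (b k) (b i) (b j)" by (metis s12 s23 minus_minus)
      then show ?thesis using 1 z[of k i j] that False by simp
    next
      case 2 then show ?thesis using s23[of "b i" "b i" "b j"] eq by simp
    next
      case 3 then show ?thesis using s23[of "b i" "b k" "b j"] z[of i k j] that by simp
    next
      case 4 then show ?thesis using eq by simp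
    next
      case 5 then show ?thesis using z[of i j k] that False by simp
    qed
  qed
  have a: "F x y u = 0" if xyu: "x \<in> b ` {..<N}" "y \<in> b ` {..<N}" "u \<in> b ` {..<N}" for x y u
  proof -
    obtain i j k where "x = b i" "y = b j" "u = b k" "i < N" "j < N" "k < N" using xyu by blast
    then show ?thesis using a1[of i j k] a1[of j i k] s12[of "b i" "b j" "b k"] by (cases "i \<le> j") auto
  qed
  have ext: "F x y u = 0" if "\<And>x. x \<in> b ` {..<N} \<Longrightarrow> F x y u = 0" for x y u
  proof -
    have "x \<in> span (b ` {..<N})" unfolding B by simp
    then show ?thesis using linear_eq_0_on_span[OF lin that] by blast
  qed
  have l1: "F x y u = 0" if "y \<in> b ` {..<N}" "u \<in> b ` {..<N}" for x y u
    by (rule ext) (rule a[OF _ that])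
  have l2: "F x y u = 0" if u: "u \<in> b ` {..<N}" for x y u
    by (rule ext) (use l1[OF _ u] s12 in \<open>metis neg_equal_0_iff_equal\<close>)
  have "F u x y = 0" for x y u
  proof (rule ext)
    show "F u x y = 0" if "u \<in> b ` {..<N}" for u
      using l2[OF that, of x y] s12[of x u y] s23[of x y u] by simp
  qed
  then show ?thesis .
qed

text \<open>With a spanning vector fixed in the first slot the form is alternating in three
  arguments. The fixed index is then moved to its place in the increasing triple, one transposition
  at a time.\<close>

lemma alternating4_eq_0:
  fixes F :: "'a::real_vector \<Rightarrow> 'a \<Rightarrow> 'a \<Rightarrow> 'a \<Rightarrow> 'b::real_vector" and b :: "nat \<Rightarrow> 'a"
  assumes lin: "\<And>q r s. linear (\<lambda>p. F p q r s)"
    and s12: "\<And>p q r s. F q p r s = - F p q r s" and s23: "\<And>p q r s. F p r q s = - F p q r s"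
    and s34: "\<And>p q r s. F p q s r = - F p q r s"
    and B: "span (b ` {..<N}) = UNIV"
    and z: "\<And>i j k l. i < j \<Longrightarrow> j < k \<Longrightarrow> k < l \<Longrightarrow> l < N \<Longrightarrow> F (b i) (b j) (b k) (b l) = 0"
  shows "F p q r s = 0"
proof -
  have self: "x = 0" if "x = - x" for x :: 'b
    using that by (simp add: eq_neg_iff_add_eq_0 scaleR_2[symmetric])
  have lin2: "linear (\<lambda>q. F p q r s)" for p r s
  proof -
    have "(\<lambda>q. F p q r s) = (\<lambda>q. - F q p r s)" by (rule ext) (rule s12)
    then show ?thesis using linear_compose_neg[OF lin] by (simp only:)
  qed
  have b0: "F (b l) q r s = 0" if "l < N" for l q r s
  proof (rule alternating3_eq_0[where F = "F (b l)" and b = b and N = N])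
    fix i j k assume ijk: "i < j" "j < k" "k < N"
    consider "l < i" | "l = i" | "i < l" "l < j" | "l = j" | "j < l" "l < k" | "l = k" | "k < l" by linarith
    then show "F (b l) (b i) (b j) (b k) = 0"
    proof cases
      case 1 then show ?thesis using z ijk by simp
    next
      case 2 have "F p p r s = 0" for p r s using s12[of p p r s] by (metis self minus_minus)
      then show ?thesis using 2 by simp
    next
      case 3 then show ?thesis using z[of i l j k] ijk s12[of "b i" "b l" "b j" "b k"] by simp
    next
      case 4 have "F p q p s = 0" for p q s
        using s12[of p q p s] s23[of q p p s] by (metis self minus_minus)
      then show ?thesis using 4 by simp
    next
      case 5 then show ?thesis using z[of i j l k] ijk s12[of "b i" "b l" "b j" "b k"] s23[of "b i" "b l" "b j" "b k"] by simp
    next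
      case 6 have "F p q s p = 0" for p q s
        using s12[of p q s p] s23[of q p s p] s34[of q s p p] by (metis self minus_minus)
      then show ?thesis using 6 by simp
    next
      case 7 then show ?thesis using z[of i j k l] ijk that s12[of "b i" "b l" "b j" "b k"]
          s23[of "b i" "b l" "b j" "b k"] s34[of "b i" "b j" "b l" "b k"] by simp
    qed
  qed (rule lin2 s23 s34 B)+
  have "p \<in> span (b ` {..<N})" unfolding B by simp
  moreover have "F x q r s = 0" if "x \<in> b ` {..<N}" for x using b0 that by auto
  ultimately show ?thesis using linear_eq_0_on_span[OF lin] by blast
qed

text \<open>In the sign convention of \<open>ce_d\<close> this is minus the differential of the
  3-form \<open>T\<close> for the bracket \<open>B\<close>. Separating \<open>B\<close> from
  \<open>T\<close> allows it to be applied to a single summand of the torsion.\<close>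

definition d_form :: "('a \<Rightarrow> 'a \<Rightarrow> 'a) \<Rightarrow> ('a \<Rightarrow> 'a \<Rightarrow> 'a \<Rightarrow> real) \<Rightarrow> 'a \<Rightarrow> 'a \<Rightarrow> 'a \<Rightarrow> 'a \<Rightarrow> real" where
  "d_form B T p q x y = T (B p q) x y - T (B p x) q y + T (B p y) q x
     + T (B q x) p y - T (B q y) p x + T (B x y) p q"

lemma d_form_alternating:
  fixes B :: "'a::real_vector \<Rightarrow> 'a \<Rightarrow> 'a" and T :: "'a \<Rightarrow> 'a \<Rightarrow> 'a \<Rightarrow> real"
  assumes T1: "\<And>q r. linear (\<lambda>p. T p q r)" and T12: "\<And>p q r. T q p r = - T p q r"
    and T23: "\<And>p q r. T p r q = - T p q r"
    and B1: "\<And>q. linear (\<lambda>p. B p q)" and B12: "\<And>p q. B q p = - B p q"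
  shows "linear (\<lambda>p. d_form B T p q x y)" "d_form B T q p x y = - d_form B T p q x y"
    "d_form B T p x q y = - d_form B T p q x y" "d_form B T p q y x = - d_form B T p q x y"
proof -
  have T2: "linear (\<lambda>q. T p q r)" for p r
  proof -
    have "(\<lambda>q. T p q r) = (\<lambda>q. - T q p r)" by (rule ext) (rule T12)
    then show ?thesis using linear_compose_neg[OF T1] by (simp only:)
  qed
  have c: "linear (\<lambda>p. T (B p q) r s)" for q r s
    using linear_compose[OF B1 T1] by (simp add: o_def)
  show "linear (\<lambda>p. d_form B T p q x y)" unfolding d_form_def
    by (intro linear_compose_add linear_compose_sub c T2)
  have n: "T (- u) v w = - T u v w" for u v w using linear_neg[OF T1] .
  show "d_form B T q p x y = - d_form B T p q x y"
    unfolding d_form_def using B12[of p q] n T23[of "B x y" p q] by simp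
  show "d_form B T p x q y = - d_form B T p q x y"
    unfolding d_form_def using B12[of q x] n T23[of "B p y" q x] by simp
  show "d_form B T p q y x = - d_form B T p q x y"
    unfolding d_form_def using B12[of x y] n T23[of "B p q" x y] by simp
qed


section \<open>One complex coordinate\<close>

type_synonym real4 = "real \<times> real \<times> real \<times> real"
type_synonym cvec = "complex \<times> real4"

text \<open>The bracket on the quotient by the ideal a_J, in the coordinates of X1, X2, IX1, IX2;
  there [IX1, IX2] becomes zero.\<close>

fun base_bracket :: "real \<Rightarrow> real \<Rightarrow> real \<Rightarrow> real4 \<Rightarrow> real4 \<Rightarrow> real4" where
  "base_bracket a b1 b2 (x1, x2, u1, u2) (x1', x2', u1', u2') =
     (a * (u1 * x1' - u1' * x1) + b1 * (u2 * x2' - u2' * x2),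
      a * (u1 * x2' - u1' * x2) + a * (u2 * x1' - u2' * x1) + b2 * (u2 * x2' - u2' * x2), 0, 0)"

fun base_metric :: "real \<Rightarrow> real4 \<Rightarrow> real4 \<Rightarrow> real" where
  "base_metric \<tau> (x1, x2, u1, u2) (x1', x2', u1', u2') =
     x1 * x1' + x2 * x2' + u1 * u1' + u2 * u2' + \<tau> * (u1 * x2' + x2 * u1') - \<tau> * (x1 * u2' + u2 * x1')"

fun base_cplx :: "real4 \<Rightarrow> real4" where
  "base_cplx (x1, x2, u1, u2) = (- u1, - u2, x1, x2)"

definition base_torsion :: "real \<Rightarrow> real \<Rightarrow> real \<Rightarrow> real \<Rightarrow> real4 \<Rightarrow> real4 \<Rightarrow> real4 \<Rightarrow> real" where
  "base_torsion a b1 b2 \<tau> p q r =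
     base_metric \<tau> (base_bracket a b1 b2 (base_cplx p) (base_cplx q)) r
     + base_metric \<tau> (base_bracket a b1 b2 (base_cplx q) (base_cplx r)) p
     + base_metric \<tau> (base_bracket a b1 b2 (base_cplx r) (base_cplx p)) q"

fun fibre_bracket :: "complex \<Rightarrow> complex \<Rightarrow> complex \<Rightarrow> complex \<Rightarrow> complex \<Rightarrow> complex \<Rightarrow> cvec \<Rightarrow> cvec \<Rightarrow> complex" where
  "fibre_bracket z w h11 h12 h21 h22 (y, x1, x2, u1, u2) (y', x1', x2', u1', u2') =
     (of_real u1 * z + of_real u2 * w) * y' - (of_real u1' * z + of_real u2' * w) * y
     + of_real (u1 * x1' - u1' * x1) * h11 + of_real (u1 * x2' - u1' * x2) * h12
     + of_real (u2 * x1' - u2' * x1) * h21 + of_real (u2 * x2' - u2' * x2) * h22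
     + of_real (u1 * u2' - u1' * u2) * (\<i> * (h12 - h21))"

text \<open>The bracket on the quotient by all coordinates of a_J except one, which is an algebra on
  C x R^4.\<close>

definition coord_bracket :: "real \<Rightarrow> real \<Rightarrow> real \<Rightarrow> complex \<Rightarrow> complex \<Rightarrow> complex \<Rightarrow> complex \<Rightarrow> complex \<Rightarrow> complex
    \<Rightarrow> cvec \<Rightarrow> cvec \<Rightarrow> cvec" where
  "coord_bracket a b1 b2 z w h11 h12 h21 h22 p q =
     (fibre_bracket z w h11 h12 h21 h22 p q, base_bracket a b1 b2 (snd p) (snd q))"

definition coord_cplx :: "cvec \<Rightarrow> cvec" where
  "coord_cplx p = (\<i> * fst p, base_cplx (snd p))"

text \<open>Only the part of the torsion in which the metric pairs the chosen complex coordinate;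
  the plane contributes \<open>base_torsion\<close>, once for the whole algebra.\<close>

definition fibre_torsion :: "complex \<Rightarrow> complex \<Rightarrow> complex \<Rightarrow> complex \<Rightarrow> complex \<Rightarrow> complex \<Rightarrow> cvec \<Rightarrow> cvec \<Rightarrow> cvec \<Rightarrow> real" where
  "fibre_torsion z w h11 h12 h21 h22 p q r =
     Re (fibre_bracket z w h11 h12 h21 h22 (coord_cplx p) (coord_cplx q) * cnj (fst r))
     + Re (fibre_bracket z w h11 h12 h21 h22 (coord_cplx q) (coord_cplx r) * cnj (fst p))
     + Re (fibre_bracket z w h11 h12 h21 h22 (coord_cplx r) (coord_cplx p) * cnj (fst q))"

text \<open>A 3 by 3 determinant; \<open>vol4\<close> expands the 4 by 4 determinant along its first
  row and is the volume form of the coordinates of X1, X2, IX1, IX2.\<close>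

definition vol3 :: "real \<Rightarrow> real \<Rightarrow> real \<Rightarrow> real \<Rightarrow> real \<Rightarrow> real \<Rightarrow> real \<Rightarrow> real \<Rightarrow> real \<Rightarrow> real" where
  "vol3 p1 p2 p3 q1 q2 q3 r1 r2 r3 =
     p1 * (q2 * r3 - q3 * r2) - p2 * (q1 * r3 - q3 * r1) + p3 * (q1 * r2 - q2 * r1)"

fun vol4 :: "real4 \<Rightarrow> real4 \<Rightarrow> real4 \<Rightarrow> real4 \<Rightarrow> real" where
  "vol4 (p1, p2, p3, p4) (q1, q2, q3, q4) (r1, r2, r3, r4) (s1, s2, s3, s4) =
     p1 * vol3 q2 q3 q4 r2 r3 r4 s2 s3 s4 - p2 * vol3 q1 q3 q4 r1 r3 r4 s1 s3 s4
     + p3 * vol3 q1 q2 q4 r1 r2 r4 s1 s2 s4 - p4 * vol3 q1 q2 q3 r1 r2 r3 s1 s2 s3"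

lemma vol4_alternating:
  "linear (\<lambda>p. vol4 p q r s)" "vol4 q p r s = - vol4 p q r s"
  "vol4 p r q s = - vol4 p q r s" "vol4 p q s r = - vol4 p q r s"
  by (rule linearI; cases q; cases r; cases s; force simp: vol3_def algebra_simps)
     (cases p; cases q; cases r; cases s; simp add: vol3_def algebra_simps)+

lemma base_bracket_alternating:
  "linear (\<lambda>p. base_bracket a b1 b2 p q)" "base_bracket a b1 b2 q p = - base_bracket a b1 b2 p q"
  by (rule linearI; cases q; force simp: algebra_simps) (cases p; cases q; simp add: algebra_simps)

lemma base_torsion_alternating:
  "linear (\<lambda>p. base_torsion a b1 b2 \<tau> p q r)"
  "base_torsion a b1 b2 \<tau> q p r = - base_torsion a b1 b2 \<tau> p q r"
  "base_torsion a b1 b2 \<tau> p r q = - base_torsion a b1 b2 \<tau> p q r"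
  by (rule linearI; cases q; cases r; force simp: base_torsion_def algebra_simps)
     (cases p; cases q; cases r; simp add: base_torsion_def algebra_simps)+

lemma coord_bracket_alternating:
  "linear (\<lambda>p. coord_bracket a b1 b2 z w h11 h12 h21 h22 p q)"
  "coord_bracket a b1 b2 z w h11 h12 h21 h22 q p = - coord_bracket a b1 b2 z w h11 h12 h21 h22 p q"
  by (rule linearI; cases q; force simp: coord_bracket_def scaleR_conv_of_real algebra_simps)
     (cases p; cases q; simp add: coord_bracket_def algebra_simps)

lemma fibre_torsion_alternating:
  "linear (\<lambda>p. fibre_torsion z w h11 h12 h21 h22 p q r)"
  "fibre_torsion z w h11 h12 h21 h22 q p r = - fibre_torsion z w h11 h12 h21 h22 p q r"
  "fibre_torsion z w h11 h12 h21 h22 p r q = - fibre_torsion z w h11 h12 h21 h22 p q r"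
  by (rule linearI; cases q; cases r; force simp: fibre_torsion_def coord_cplx_def algebra_simps)
     (cases p; cases q; cases r; simp add: fibre_torsion_def coord_cplx_def algebra_simps)+

abbreviation (input) Y1 :: cvec where "Y1 \<equiv> (1, 0, 0, 0, 0)"
abbreviation (input) Yi :: cvec where "Yi \<equiv> (\<i>, 0, 0, 0, 0)"
abbreviation (input) X1 :: cvec where "X1 \<equiv> (0, 1, 0, 0, 0)"
abbreviation (input) X2 :: cvec where "X2 \<equiv> (0, 0, 1, 0, 0)"
abbreviation (input) U1 :: cvec where "U1 \<equiv> (0, 0, 0, 1, 0)"
abbreviation (input) U2 :: cvec where "U2 \<equiv> (0, 0, 0, 0, 1)"

definition cbasis :: "nat \<Rightarrow> cvec" where
  "cbasis k = [Y1, Yi, X1, X2, U1, U2] ! k"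

lemma span_cbasis: "span (cbasis ` {..<6}) = UNIV"
proof -
  have "p \<in> span (cbasis ` {..<6})" for p
  proof -
    obtain y x1 x2 u1 u2 where p: "p = (y, x1, x2, u1, u2)" by (cases p) auto
    have "p = Re y *\<^sub>R cbasis 0 + Im y *\<^sub>R cbasis 1 + x1 *\<^sub>R cbasis 2 + x2 *\<^sub>R cbasis 3
        + u1 *\<^sub>R cbasis 4 + u2 *\<^sub>R cbasis 5"
      unfolding p cbasis_def by (simp add: complex_eq_iff zero_prod_def)
    also have "\<dots> \<in> span (cbasis ` {..<6})"
      by (intro span_add span_scale span_base) auto
    finally show ?thesis .
  qed
  then show ?thesis by blast
qed

text \<open>The components along Y_i of the Jacobi identity on IX1, IX2, X1 and on IX1, IX2,
  X2.\<close>

definition jacobi_eqs :: "real \<Rightarrow> real \<Rightarrow> real \<Rightarrow> complex \<Rightarrow> complex \<Rightarrow> complex \<Rightarrow> complex \<Rightarrow> complex \<Rightarrow> complex \<Rightarrow> bool" where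
  "jacobi_eqs a b1 b2 z w h11 h12 h21 h22 \<longleftrightarrow>
     of_real a * h12 + z * h21 = of_real a * h21 + w * h11 \<and>
     of_real b1 * h11 + of_real b2 * h12 + z * h22 = of_real a * h22 + w * h12"

text \<open>The vanishing of d(J^* d\<sigma>) on Y_i and three of the vectors X1, X2, IX1, IX2. Each
  complex equation unites the real ones for Y_i and i Y_i.\<close>

definition skt_eqs :: "real \<Rightarrow> real \<Rightarrow> real \<Rightarrow> complex \<Rightarrow> complex \<Rightarrow> complex \<Rightarrow> complex \<Rightarrow> complex \<Rightarrow> complex \<Rightarrow> bool" where
  "skt_eqs a b1 b2 z w h11 h12 h21 h22 \<longleftrightarrow>
     (cnj z + 2 * of_real a) * (h12 - h21) = 2 * of_real (Re w) * h11 - 2 * of_real (Re z) * h12 \<and>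
     (cnj w + of_real b2) * (h12 - h21) = 2 * of_real (Re w) * h21 - 2 * of_real (Re z) * h22 \<and>
     cnj z * h12 + (of_real a + 2 * of_real (Re z)) * (h12 - h21) = cnj w * h11 \<and>
     (cnj z + of_real a) * h22 + 2 * of_real (Re w) * (h12 - h21) = (cnj w + of_real b2) * h21 + of_real b1 * h11"

text \<open>The share of Y_i in the value on X1, X2, IX1, IX2; its sum over i gives the norm terms
  of the scalar equation.\<close>

definition fibre_const :: "complex \<Rightarrow> complex \<Rightarrow> complex \<Rightarrow> complex \<Rightarrow> real" where
  "fibre_const h11 h12 h21 h22 = Re ((h12 - h21) * cnj (h12 - h21)) + Re (h12 * cnj h12)
     + Re (h21 * cnj h21) - 2 * Re (h11 * cnj h22)"

text \<open>The first four statements are equivalences because they serve twice: to extract the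
  equations from a given SKT algebra and to verify SKT for a standard one.\<close>

lemma fibre_d_torsion_values:
  fixes z w h11 h12 h21 h22 :: complex and a b1 b2 :: real
  defines "F \<equiv> d_form (coord_bracket a b1 b2 z w h11 h12 h21 h22) (fibre_torsion z w h11 h12 h21 h22)"
  shows "F Y1 X1 X2 U1 = 0
      \<and> F Yi X1 X2 U1 = 0 \<longleftrightarrow>
      (cnj z + 2 * of_real a) * (h12 - h21) = 2 * of_real (Re w) * h11 - 2 * of_real (Re z) * h12"
    "F Y1 X1 X2 U2 = 0
      \<and> F Yi X1 X2 U2 = 0 \<longleftrightarrow>
      (cnj w + of_real b2) * (h12 - h21) = 2 * of_real (Re w) * h21 - 2 * of_real (Re z) * h22"
    "F Y1 X1 U1 U2 = 0
      \<and> F Yi X1 U1 U2 = 0 \<longleftrightarrow>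
      cnj z * h12 + (of_real a + 2 * of_real (Re z)) * (h12 - h21) = cnj w * h11"
    "F Y1 X2 U1 U2 = 0
      \<and> F Yi X2 U1 U2 = 0 \<longleftrightarrow>
      (cnj z + of_real a) * h22 + 2 * of_real (Re w) * (h12 - h21) = (cnj w + of_real b2) * h21 + of_real b1 * h11"
    "F X1 X2 U1 U2 = fibre_const h11 h12 h21 h22"
    "diagonal_eqs a b1 b2 z w \<Longrightarrow> F Y1 Yi X1 U1 = 0"
    "diagonal_eqs a b1 b2 z w \<Longrightarrow> F Y1 Yi X1 U2 = 0"
    "diagonal_eqs a b1 b2 z w \<Longrightarrow> F Y1 Yi X2 U1 = 0"
    "diagonal_eqs a b1 b2 z w \<Longrightarrow> F Y1 Yi X2 U2 = 0"
    "F Y1 Yi X1 X2 = 0"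
    "F Y1 Yi U1 U2 = 0"
  unfolding F_def d_form_def coord_bracket_def fibre_torsion_def coord_cplx_def fibre_const_def
    diagonal_eqs_def power2_eq_square
  by (simp_all add: complex_eq_iff algebra_simps) (intro iffI conjI; elim conjE; linarith)+

text \<open>Under the equations every value involving the complex coordinate vanishes, so the 4-form
  is a multiple of the volume form pulled back from the plane. The difference is alternating, and
  the 15 increasing quadruples of \<open>cbasis\<close> decide.\<close>

lemma fibre_d_torsion:
  assumes d: "diagonal_eqs a b1 b2 z w" and e: "skt_eqs a b1 b2 z w h11 h12 h21 h22"
  shows "d_form (coord_bracket a b1 b2 z w h11 h12 h21 h22) (fibre_torsion z w h11 h12 h21 h22) p q r s
    = fibre_const h11 h12 h21 h22 * vol4 (snd p) (snd q) (snd r) (snd s)"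
proof -
  define F where "F = d_form (coord_bracket a b1 b2 z w h11 h12 h21 h22) (fibre_torsion z w h11 h12 h21 h22)"
  define k where "k = fibre_const h11 h12 h21 h22"
  define G where "G = (\<lambda>p q r s. F p q r s - k * vol4 (snd p) (snd q) (snd r) (snd s))"
  note alt = d_form_alternating[of "fibre_torsion z w h11 h12 h21 h22" "coord_bracket a b1 b2 z w h11 h12 h21 h22",
      OF fibre_torsion_alternating coord_bracket_alternating, folded F_def]
  have "G p q r s = 0"
  proof (rule alternating4_eq_0[where F = G and b = cbasis and N = 6])
    show "linear (\<lambda>p. G p q r s)" for q r s
    proof -
      have "linear (\<lambda>p. vol4 (snd p) (snd q) (snd r) (snd s))"
        using linear_compose[OF linear_snd vol4_alternating(1)] by (simp add: o_def)
      from linear_compose_sub[OF alt(1) linear_compose_scale_right[OF this, of k]]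
      show ?thesis unfolding G_def by simp
    qed
    show "G q p r s = - G p q r s" for p q r s
      unfolding G_def alt(2)[of q p] vol4_alternating(2)[of "snd q" "snd p"] by simp
    show "G p r q s = - G p q r s" for p q r s
      unfolding G_def alt(3)[of p r] vol4_alternating(3)[of "snd p" "snd r"] by simp
    show "G p q s r = - G p q r s" for p q r s
      unfolding G_def alt(4)[of p q s] vol4_alternating(4)[of "snd p" "snd q" "snd s"] by simp
    show "span (cbasis ` {..<6}) = UNIV" by (rule span_cbasis)
    note v = fibre_d_torsion_values[of a b1 b2 z w h11 h12 h21 h22, folded F_def]
    have V: "F Y1 X1 X2 U1 = 0"
      "F Yi X1 X2 U1 = 0"
      "F Y1 X1 X2 U2 = 0"
      "F Yi X1 X2 U2 = 0"
      "F Y1 X1 U1 U2 = 0"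
      "F Yi X1 U1 U2 = 0"
      "F Y1 X2 U1 U2 = 0"
      "F Yi X2 U1 U2 = 0"
      using v(1-4) e unfolding skt_eqs_def by blast+
    fix i j k' l :: nat assume ijkl: "i < j" "j < k'" "k' < l" "l < 6"
    have "(i, j, k', l) \<in> {(0,1,2,3), (0,1,2,4), (0,1,2,5), (0,1,3,4), (0,1,3,5), (0,1,4,5), (0,2,3,4), (0,2,3,5),
       (0,2,4,5), (0,3,4,5), (1,2,3,4), (1,2,3,5), (1,2,4,5), (1,3,4,5), (2,3,4,5)}"
      using ijkl by (simp) presburger
    then show "G (cbasis i) (cbasis j) (cbasis k') (cbasis l) = 0"
      unfolding G_def
      by (auto simp: cbasis_def vol3_def V v(5) v(6-9)[OF d] v(10,11) k_def)
  qed
  then show ?thesis unfolding G_def F_def k_def by simp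
qed

text \<open>An alternating 4-form on a four-dimensional space is a multiple of the determinant; its
  single value is computed on the basis, which is the planar part of \<open>cbasis\<close> from
  index 2 on.\<close>

lemma base_d_torsion:
  "d_form (base_bracket a b1 b2) (base_torsion a b1 b2 \<tau>) p q r s = 2 * a * (a - b1) * vol4 p q r s"
proof -
  define F where "F = d_form (base_bracket a b1 b2) (base_torsion a b1 b2 \<tau>)"
  define k where "k = 2 * a * (a - b1)"
  define G where "G = (\<lambda>p q r s. F p q r s - k * vol4 p q r s)"
  define e :: "nat \<Rightarrow> real4" where "e = (\<lambda>i. snd (cbasis (i + 2)))"
  note alt = d_form_alternating[of "base_torsion a b1 b2 \<tau>" "base_bracket a b1 b2",
      OF base_torsion_alternating base_bracket_alternating, folded F_def]
  have "G p q r s = 0"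
  proof (rule alternating4_eq_0[where F = G and b = e and N = 4])
    show "linear (\<lambda>p. G p q r s)" for q r s
      using linear_compose_sub[OF alt(1) linear_compose_scale_right[OF vol4_alternating(1), of k]]
      unfolding G_def by simp
    show "G q p r s = - G p q r s" for p q r s
      unfolding G_def alt(2)[of q p] vol4_alternating(2)[of q p] by simp
    show "G p r q s = - G p q r s" for p q r s
      unfolding G_def alt(3)[of p r] vol4_alternating(3)[of p r] by simp
    show "G p q s r = - G p q r s" for p q r s
      unfolding G_def alt(4)[of p q s] vol4_alternating(4)[of p q s] by simp
    have "p \<in> span (e ` {..<4})" for p
    proof -
      obtain x1 x2 u1 u2 where p: "p = (x1, x2, u1, u2)" by (cases p) auto
      have "p = x1 *\<^sub>R e 0 + x2 *\<^sub>R e 1 + u1 *\<^sub>R e 2 + u2 *\<^sub>R e 3"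
        unfolding p e_def cbasis_def by simp
      also have "\<dots> \<in> span (e ` {..<4})"
        by (intro span_add span_scale span_base) auto
      finally show ?thesis .
    qed
    then show "span (e ` {..<4}) = UNIV" by blast
    fix i j k' l :: nat assume "i < j" "j < k'" "k' < l" "l < 4"
    then have "i = 0 \<and> j = 1 \<and> k' = 2 \<and> l = 3" by presburger
    then show "G (e i) (e j) (e k') (e l) = 0"
      unfolding G_def F_def
      by (simp add: e_def cbasis_def vol3_def k_def d_form_def base_torsion_def algebra_simps)
  qed
  then show ?thesis unfolding G_def F_def k_def by simp
qed

text \<open>The Jacobi expression is alternating, which leaves 20 increasing triples. The equations
  enter for IX1, IX2 with X1 or X2.\<close>

lemma coord_jacobi:
  assumes "jacobi_eqs a b1 b2 z w h11 h12 h21 h22"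
  defines "B \<equiv> coord_bracket a b1 b2 z w h11 h12 h21 h22"
  shows "B p (B q r) + B q (B r p) + B r (B p q) = 0"
proof -
  define G where "G = (\<lambda>p q r. B p (B q r) + B q (B r p) + B r (B p q))"
  have B1: "linear (\<lambda>p. B p q)" for q unfolding B_def by (rule coord_bracket_alternating)
  have B12: "B q p = - B p q" for p q unfolding B_def by (rule coord_bracket_alternating)
  have B2: "linear (B q)" for q
  proof -
    have "B q = (\<lambda>p. - B p q)" by (rule ext) (rule B12)
    then show ?thesis using linear_compose_neg[OF B1[of q]] by (simp only:)
  qed
  have "G p q r = 0"
  proof (rule alternating3_eq_0[where F = G and b = cbasis and N = 6])
    show "linear (\<lambda>p. G p q r)" for q r
    proof -
      have "linear (\<lambda>p. B q (B r p))" "linear (\<lambda>p. B r (B p q))"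
        using linear_compose[OF B2 B2] linear_compose[OF B1 B2] by (simp_all add: o_def)
      then show ?thesis unfolding G_def by (intro linear_compose_add B1)
    qed
    show "G q p r = - G p q r" for p q r
      unfolding G_def using B12[of r p] B12[of q r] B12[of p q] linear_neg[OF B2] by simp
    show "G p r q = - G p q r" for p q r
      unfolding G_def using B12[of r p] B12[of q r] B12[of p q] linear_neg[OF B2] by simp
    show "span (cbasis ` {..<6}) = UNIV" by (rule span_cbasis)
    fix i j k :: nat assume ijk: "i < j" "j < k" "k < 6"
    have "(i, j, k) \<in> {(0,1,2), (0,1,3), (0,1,4), (0,1,5), (0,2,3), (0,2,4), (0,2,5), (0,3,4), (0,3,5), (0,4,5),
       (1,2,3), (1,2,4), (1,2,5), (1,3,4), (1,3,5), (1,4,5), (2,3,4), (2,3,5), (2,4,5), (3,4,5)}"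
      using ijk by simp presburger
    then show "G (cbasis i) (cbasis j) (cbasis k) = 0"
      using assms(1) unfolding G_def B_def jacobi_eqs_def
      by (elim insertE emptyE Pair_inject; hypsubst)
         (simp_all add: cbasis_def coord_bracket_def zero_prod_def algebra_simps)
  qed
  then show ?thesis unfolding G_def .
qed

lemma coord_jacobi_imp:
  fixes a b1 b2 :: real and z w h11 h12 h21 h22 :: complex
  defines "B \<equiv> coord_bracket a b1 b2 z w h11 h12 h21 h22"
  assumes j: "\<And>p q r. p \<in> S \<Longrightarrow> q \<in> S \<Longrightarrow> r \<in> S \<Longrightarrow> B p (B q r) + B q (B r p) + B r (B p q) = 0"
    and S: "X1 \<in> S" "X2 \<in> S" "U1 \<in> S" "U2 \<in> S"
  shows "jacobi_eqs a b1 b2 z w h11 h12 h21 h22"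
  using j[OF S(3,4,1)] j[OF S(3,4,2)] unfolding jacobi_eqs_def B_def
  by (simp add: coord_bracket_def zero_prod_def algebra_simps)

lemma lookup_scaleR: "Poly_Mapping.lookup (r *\<^sub>R x) i = r *\<^sub>R Poly_Mapping.lookup x i"
proof -
  have "{i. r *\<^sub>R Poly_Mapping.lookup x i \<noteq> 0} \<subseteq> {i. Poly_Mapping.lookup x i \<noteq> 0}" by auto
  then have "finite {i. r *\<^sub>R Poly_Mapping.lookup x i \<noteq> 0}"
    using finite_lookup finite_subset by blast
  then show ?thesis unfolding scaleR_poly_mapping_def by (simp add: Abs_poly_mapping_inverse)
qed

section \<open>Equivalence of the equations with the three cases\<close>

lemma neq_0_of_Re: "Re c \<noteq> 0 \<Longrightarrow> c \<noteq> 0"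
  by auto

text \<open>The first diagonal equation gives Re z = 0 or Re z = -a/2. For Re z = 0 also Re w = 0,
  and the first SKT equation forces h12 = h21 since cnj z + 2a has real part 2a; then z decides
  between cases (i) and (ii). For Re z = -a/2 the factor a + 2 Re z in the third SKT equation
  vanishes and h12 is determined by h11. The Jacobi equations yield the remaining entries.\<close>

lemma case_eqs:
  assumes a: "a > 0" and d: "diagonal_eqs a b1 b2 (z i) (w i)"
    and j: "jacobi_eqs a b1 b2 (z i) (w i) (h 1 1 i) (h 1 2 i) (h 2 1 i) (h 2 2 i)"
    and s: "skt_eqs a b1 b2 (z i) (w i) (h 1 1 i) (h 1 2 i) (h 2 1 i) (h 2 2 i)"
    and ne: "\<not> (z i = 0 \<and> w i = 0)"
  shows "case_i a b1 b2 z w h i \<or> case_ii a b1 b2 z w h i \<or> case_iii a b1 b2 z w h i"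
proof -
  define zi wi h11 h12 h21 h22 A B1 B2 where "zi = z i" and "wi = w i" and "h11 = h 1 1 i" and "h12 = h 1 2 i"
    and "h21 = h 2 1 i" and "h22 = h 2 2 i" and "A = complex_of_real a" and "B1 = complex_of_real b1"
    and "B2 = complex_of_real b2"
  note defs = zi_def wi_def h11_def h12_def h21_def h22_def A_def B1_def B2_def
  note d = d[folded defs] and j = j[folded defs] and s = s[folded defs] and ne = ne[folded defs]
  have J1: "A * h12 + zi * h21 = A * h21 + wi * h11"
    and J2: "B1 * h11 + B2 * h12 + zi * h22 = A * h22 + wi * h12"
    using j unfolding jacobi_eqs_def A_def B1_def B2_def by auto
  have E1: "(cnj zi + 2 * A) * (h12 - h21) = 2 * of_real (Re wi) * h11 - 2 * of_real (Re zi) * h12"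
    and F1: "cnj zi * h12 + (A + 2 * of_real (Re zi)) * (h12 - h21) = cnj wi * h11"
    using s unfolding skt_eqs_def A_def by auto
  have A0: "A \<noteq> 0" unfolding A_def using a by simp
  have zA: "zi - A \<noteq> 0" if "Re zi \<le> 0"
    using that a by (intro neq_0_of_Re) (simp add: A_def)
  have "Re zi * (2 * Re zi + a) = 0"
    using d unfolding diagonal_eqs_def by (simp add: power2_eq_square algebra_simps)
  then consider "Re zi = 0" | "Re zi = - a / 2" unfolding mult_eq_0_iff by linarith
  then show ?thesis
  proof cases
    case 1
    then have w: "Re wi = 0" using d a unfolding diagonal_eqs_def by simp
    have "cnj zi + 2 * A \<noteq> 0"
      using 1 a by (intro neq_0_of_Re) (simp add: A_def)
    then have h: "h12 = h21" using E1 1 w by simp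
    then have j1: "zi * h12 = wi * h11" using J1 by simp
    have j2: "(zi - A) * h22 = wi * h12 - B1 * h11 - B2 * h12" using J2 by (simp add: algebra_simps)
    show ?thesis
    proof (cases "zi = 0")
      case True
      then have w0: "wi \<noteq> 0" using ne by simp
      then have h11: "h11 = 0" using j1 True by simp
      then have "A * h22 = (B2 - wi) * h12" using j2 True by (simp add: algebra_simps)
      then have "h22 = (B2 - wi) / A * h12" using A0 by (simp add: field_simps)
      then have "case_ii a b1 b2 z w h i" unfolding case_ii_def defs[symmetric] using True w w0 h11 h by simp
      then show ?thesis by simp
    next
      case False
      have h12: "h12 = wi / zi * h11" using j1 False by (simp add: field_simps)
      have "zi * (zi - A) * h22 = (wi\<^sup>2 - B2 * wi - B1 * zi) * h11"
        using j1 j2 unfolding power2_eq_square by algebra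
      then have "h22 = (wi\<^sup>2 - B2 * wi - B1 * zi) / (zi * (zi - A)) * h11"
        using zA False 1 by (simp add: nonzero_eq_divide_eq mult.commute)
      then have "case_i a b1 b2 z w h i" unfolding case_i_def defs[symmetric] using False 1 w h h12 by simp
      then show ?thesis by simp
    qed
  next
    case 2
    have z0: "zi \<noteq> 0" using 2 a by auto
    have zA: "zi - A \<noteq> 0" using zA 2 a by simp
    have wq: "4 * (Re wi)\<^sup>2 + 2 * b2 * Re wi - a * b1 = 0"
      using d 2 unfolding diagonal_eqs_def by (simp add: algebra_simps)
    have "A + 2 * complex_of_real (Re zi) = 0" unfolding A_def 2 by (simp add: complex_eq_iff)
    then have f1: "cnj zi * h12 = cnj wi * h11" using F1 by simp
    then have h12: "h12 = cnj wi / cnj zi * h11" using z0 by (simp add: field_simps)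
    have n: "of_real ((cmod zi)\<^sup>2) - A * cnj zi = cnj zi * (zi - A)"
      unfolding complex_norm_square by (simp add: algebra_simps)
    have "(cnj zi * (zi - A)) * h21 = (wi * cnj zi - A * cnj wi) * h11"
      using f1 J1 by algebra
    then have h21: "h21 = (wi * cnj zi - A * cnj wi) / (cnj zi * (zi - A)) * h11"
      using zA z0 by (simp add: nonzero_eq_divide_eq mult.commute)
    have "(cnj zi * (zi - A)) * h22 = (wi * cnj wi - B1 * cnj zi - B2 * cnj wi) * h11"
      using f1 J2 by algebra
    then have h22: "h22 = (wi * cnj wi - B1 * cnj zi - B2 * cnj wi) / (cnj zi * (zi - A)) * h11"
      using zA z0 by (simp add: nonzero_eq_divide_eq mult.commute)
    \<comment> \<open>Completing the square in the quadratic for Re w; nonnegativity of the square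
      is the bound on b1.\<close>
    have "(4 * Re wi + b2)\<^sup>2 = 4 * a * b1 + b2\<^sup>2"
      using wq unfolding power2_eq_square by algebra
    then have "4 * a * b1 + b2\<^sup>2 \<ge> 0" by (metis zero_le_power2)
    then have b: "b1 \<ge> - b2\<^sup>2 / (4 * a)" using a by (simp add: field_simps)
    have "case_iii a b1 b2 z w h i"
      unfolding case_iii_def defs[symmetric] n unfolding complex_norm_square
      using 2 b h12 h21 h22 wq by (simp add: algebra_simps)
    then show ?thesis by simp
  qed
qed

text \<open>In cases (i) and (ii) z and w are purely imaginary, so conjugation is a sign and the SKT
  equations reduce to the Jacobi equations. Case (iii) is a polynomial identity after clearing
  denominators, modulo the quadratic equation for Re w.\<close>

lemma eqs_case:
  assumes a: "a > 0"
    and c: "case_i a b1 b2 z w h i \<or> case_ii a b1 b2 z w h i \<or> case_iii a b1 b2 z w h i"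
  shows "diagonal_eqs a b1 b2 (z i) (w i)"
    "jacobi_eqs a b1 b2 (z i) (w i) (h 1 1 i) (h 1 2 i) (h 2 1 i) (h 2 2 i)"
    "skt_eqs a b1 b2 (z i) (w i) (h 1 1 i) (h 1 2 i) (h 2 1 i) (h 2 2 i)"
    "\<not> (z i = 0 \<and> w i = 0)"
proof -
  define zi wi h11 h12 h21 h22 A B1 B2 where "zi = z i" and "wi = w i" and "h11 = h 1 1 i" and "h12 = h 1 2 i"
    and "h21 = h 2 1 i" and "h22 = h 2 2 i" and "A = complex_of_real a" and "B1 = complex_of_real b1"
    and "B2 = complex_of_real b2"
  note defs = zi_def wi_def h11_def h12_def h21_def h22_def A_def B1_def B2_def
  have A0: "A \<noteq> 0" unfolding A_def using a by simp
  have zA: "zi - A \<noteq> 0" if "Re zi \<le> 0"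
    using that a by (intro neq_0_of_Re) (simp add: A_def)
  have "diagonal_eqs a b1 b2 zi wi \<and> jacobi_eqs a b1 b2 zi wi h11 h12 h21 h22 \<and>
      skt_eqs a b1 b2 zi wi h11 h12 h21 h22 \<and> \<not> (zi = 0 \<and> wi = 0)"
    using c
  proof (elim disjE)
    assume "case_i a b1 b2 z w h i"
    then have r: "Re zi = 0" "Re wi = 0" "zi \<noteq> 0" and h: "h21 = h12" "h12 = wi / zi * h11"
       "h22 = (wi\<^sup>2 - B2 * wi - B1 * zi) / (zi * (zi - A)) * h11"
      unfolding case_i_def defs[symmetric] by auto
    have zA: "zi - A \<noteq> 0" using zA r by simp
    have cn: "cnj zi = - zi" "cnj wi = - wi" using r by (auto simp: complex_eq_iff)
    have j1: "zi * h12 = wi * h11" using h r by simp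
    have "(zi * (zi - A)) * h22 = (wi\<^sup>2 - B2 * wi - B1 * zi) * h11" using h(3) r zA by simp
    then have "zi * ((zi - A) * h22 - (wi * h12 - B1 * h11 - B2 * h12)) = 0"
      using j1 unfolding power2_eq_square by algebra
    then have j2: "(zi - A) * h22 = wi * h12 - B1 * h11 - B2 * h12" using r by simp
    have "jacobi_eqs a b1 b2 zi wi h11 h12 h21 h22"
      unfolding jacobi_eqs_def defs(7-9)[symmetric] using j1 j2 h(1) by (simp add: algebra_simps)
    moreover have "skt_eqs a b1 b2 zi wi h11 h12 h21 h22"
      unfolding skt_eqs_def defs(7-9)[symmetric] using j1 j2 h(1) r cn by (simp add: algebra_simps)
    ultimately show ?thesis using r unfolding diagonal_eqs_def by simp
  next
    assume "case_ii a b1 b2 z w h i"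
    then have r: "zi = 0" "Re wi = 0" "wi \<noteq> 0" and h: "h11 = 0" "h21 = h12" "h22 = (B2 - wi) / A * h12"
      unfolding case_ii_def defs[symmetric] by auto
    have cn: "cnj wi = - wi" using r by (auto simp: complex_eq_iff)
    have j2: "A * h22 = (B2 - wi) * h12" using h A0 by simp
    have "jacobi_eqs a b1 b2 zi wi h11 h12 h21 h22"
      unfolding jacobi_eqs_def defs(7-9)[symmetric] using j2 h(1,2) r by (simp add: algebra_simps)
    moreover have "skt_eqs a b1 b2 zi wi h11 h12 h21 h22"
      unfolding skt_eqs_def defs(7-9)[symmetric] using j2 h(1,2) r cn by (simp add: algebra_simps)
    ultimately show ?thesis using r unfolding diagonal_eqs_def by simp
  next
    assume "case_iii a b1 b2 z w h i"
    then have r: "Re zi = - a / 2" and wq: "2 * (Re wi)\<^sup>2 + b2 * Re wi - b1 / 2 * a = 0"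
      and h12: "h12 = cnj wi / cnj zi * h11"
      and h21: "h21 = (wi * cnj zi - A * cnj wi) / (of_real ((cmod zi)\<^sup>2) - A * cnj zi) * h11"
      and h22: "h22 = (of_real ((cmod wi)\<^sup>2) - B1 * cnj zi - B2 * cnj wi) / (of_real ((cmod zi)\<^sup>2) - A * cnj zi) * h11"
      unfolding case_iii_def defs[symmetric] by auto
    have z0: "zi \<noteq> 0" using r a by auto
    have zA: "zi - A \<noteq> 0" using zA r a by simp
    have zc: "cnj zi = - A - zi" unfolding A_def using r by (simp add: complex_eq_iff)
    have n: "of_real ((cmod zi)\<^sup>2) - A * cnj zi = cnj zi * (zi - A)"
      unfolding complex_norm_square by (simp add: algebra_simps)
    \<comment> \<open>The common denominator is absorbed into \<open>k\<close>; all four h become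
      polynomials in z, w and their conjugates times \<open>k\<close>.\<close>
    define k where "k = h11 / (cnj zi * (zi - A))"
    have k: "h11 = cnj zi * (zi - A) * k" "h12 = cnj wi * (zi - A) * k" "h21 = (wi * cnj zi - A * cnj wi) * k"
      "h22 = (wi * cnj wi - B1 * cnj zi - B2 * cnj wi) * k"
      unfolding h12 h21 h22 n unfolding complex_norm_square k_def using z0 zA by simp_all
    have w2: "2 * complex_of_real (Re wi) = wi + cnj wi" by (simp add: complex_eq_iff)
    have z2: "2 * complex_of_real (Re zi) = - A" unfolding A_def r by (simp add: complex_eq_iff)
    have "of_real (2 * (2 * (Re wi)\<^sup>2 + b2 * Re wi - b1 / 2 * a)) = (0 :: complex)" unfolding wq by simp
    then have "(2 * complex_of_real (Re wi))\<^sup>2 + B2 * (2 * complex_of_real (Re wi)) - B1 * A = 0"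
      unfolding A_def B1_def B2_def by (simp add: power2_eq_square algebra_simps)
    then have wq': "(wi + cnj wi) * (wi + cnj wi) + B2 * (wi + cnj wi) - B1 * A = 0"
      unfolding w2 power2_eq_square .
    \<comment> \<open>With cnj z replaced by -A - z, the conjugate of w is treated as an independent
      variable tied to w by \<open>wq'\<close>.\<close>
    define wb where "wb = cnj wi"
    note k = k[folded wb_def, unfolded zc] and wq' = wq'[folded wb_def] and w2 = w2[folded wb_def]
    have "jacobi_eqs a b1 b2 zi wi h11 h12 h21 h22"
      unfolding jacobi_eqs_def defs(7-9)[symmetric] k by (simp add: algebra_simps)
    moreover have "skt_eqs a b1 b2 zi wi h11 h12 h21 h22"
      unfolding skt_eqs_def defs(7-9)[symmetric] w2 z2 wb_def[symmetric] zc k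
    proof (intro conjI)
      have e: "(A + zi) * k * ((wi + wb) * (wi + wb) + B2 * (wi + wb) - B1 * A) = 0" using wq' by simp
      \<comment> \<open>In the second and fourth SKT equations the two sides differ by exactly this
        multiple of the quadratic relation.\<close>
      have sub: "x = y" if "x - y = (A + zi) * k * ((wi + wb) * (wi + wb) + B2 * (wi + wb) - B1 * A)" for x y
        using that e by simp
      show "(wb + B2) * (wb * (zi - A) * k - (wi * (- A - zi) - A * wb) * k) =
          (wi + wb) * ((wi * (- A - zi) - A * wb) * k) -
          - A * ((wi * wb - B1 * (- A - zi) - B2 * wb) * k)"
        by (rule sub) (simp add: algebra_simps)
      show "(- A - zi + A) * ((wi * wb - B1 * (- A - zi) - B2 * wb) * k) +
          (wi + wb) * (wb * (zi - A) * k - (wi * (- A - zi) - A * wb) * k) =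
          (wb + B2) * ((wi * (- A - zi) - A * wb) * k) + B1 * ((- A - zi) * (zi - A) * k)"
        by (rule sub) (simp add: algebra_simps)
    qed (simp_all add: algebra_simps)
    ultimately show ?thesis using r wq z0 unfolding diagonal_eqs_def
      by (simp add: power2_eq_square algebra_simps)
  qed
  then show "diagonal_eqs a b1 b2 (z i) (w i)"
    "jacobi_eqs a b1 b2 (z i) (w i) (h 1 1 i) (h 1 2 i) (h 2 1 i) (h 2 2 i)"
    "skt_eqs a b1 b2 (z i) (w i) (h 1 1 i) (h 1 2 i) (h 2 1 i) (h 2 2 i)"
    "\<not> (z i = 0 \<and> w i = 0)"
    unfolding defs by auto
qed

section \<open>The standard algebras in coordinates\<close>

text \<open>Projection along all other coordinates of a_J. It respects bracket and complex
  structure, so identities in the standard algebra are checked on C x R^4.\<close>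

definition coord :: "nat \<Rightarrow> std_vec \<Rightarrow> cvec" where
  "coord i p = (Poly_Mapping.lookup (fst p) i, snd p)"

lemma snd_coord [simp]: "snd (coord i p) = snd p"
  by (simp add: coord_def)

lemma linear_coord: "linear (coord i)"
  unfolding coord_def by (rule linearI) (auto simp: lookup_add lookup_scaleR prod_eq_iff)

lemma coord_std_cplx: "coord i (std_cplx p) = coord_cplx (coord i p)"
  by (cases p) (auto simp: coord_def coord_cplx_def map.rep_eq when_def)

lemma snd_std_cplx: "snd (std_cplx p) = base_cplx (snd p)"
  by (cases p) auto

lemma snd_std_bracket: "snd (std_bracket m a b1 b2 z w h p q) = base_bracket a b1 b2 (snd p) (snd q)"
  by (cases p; cases q) (simp add: Let_def)

lemma coord_std_bracket:
  "i \<in> {1..m} \<Longrightarrow> coord i (std_bracket m a b1 b2 z w h p q)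
     = coord_bracket a b1 b2 (z i) (w i) (h 1 1 i) (h 1 2 i) (h 2 1 i) (h 2 2 i) (coord i p) (coord i q)"
  by (cases p; cases q) (auto simp: coord_def coord_bracket_def Let_def lookup_aJ)

lemma std_metric_coord:
  "std_metric m \<tau> p q
     = (\<Sum>i\<in>{1..m}. Re (fst (coord i p) * cnj (fst (coord i q)))) + base_metric \<tau> (snd p) (snd q)"
  by (cases p; cases q) (simp add: coord_def)

definition std_carrier :: "nat \<Rightarrow> std_vec set" where
  "std_carrier m = {y. Poly_Mapping.keys y \<subseteq> {1..m}} \<times> UNIV"

lemma std_carrier_iff: "p \<in> std_carrier m \<longleftrightarrow> (\<forall>i. i \<notin> {1..m} \<longrightarrow> Poly_Mapping.lookup (fst p) i = 0)"
  unfolding std_carrier_def by (cases p) (auto simp: in_keys_iff)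

text \<open>The planar part is compared separately, since for \<open>m = 0\<close> no coordinate
  projection is available to see it.\<close>

lemma std_carrier_eqI:
  assumes "p \<in> std_carrier m" "q \<in> std_carrier m" "snd p = snd q"
    and "\<And>i. i \<in> {1..m} \<Longrightarrow> coord i p = coord i q"
  shows "p = q"
proof -
  have "Poly_Mapping.lookup (fst p) i = Poly_Mapping.lookup (fst q) i" for i
    using assms(1,2) assms(4)[of i] unfolding std_carrier_iff coord_def by (cases "i \<in> {1..m}") auto
  then show ?thesis using assms(3) by (simp add: prod_eq_iff poly_mapping_eqI)
qed

lemma subspace_std_carrier: "subspace (std_carrier m)"
  unfolding subspace_def by (auto simp: std_carrier_iff lookup_add lookup_scaleR)

lemma std_bracket_in: "std_bracket m a b1 b2 z w h p q \<in> std_carrier m"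
  by (cases p; cases q) (simp add: std_carrier_iff Let_def lookup_aJ)

lemma std_cplx_in: "p \<in> std_carrier m \<Longrightarrow> std_cplx p \<in> std_carrier m"
  by (cases p) (auto simp: std_carrier_iff map.rep_eq when_def)

definition Y_vec :: "nat \<Rightarrow> complex \<Rightarrow> std_vec" where
  "Y_vec i c = (Poly_Mapping.single i c, 0)"

lemma Y_vec_in: "i \<in> {1..m} \<Longrightarrow> Y_vec i c \<in> std_carrier m"
  by (auto simp: Y_vec_def std_carrier_iff lookup_single when_def)

lemma base_vec_in: "(0, v) \<in> std_carrier m"
  by (simp add: std_carrier_iff)

lemma coord_Y_vec: "coord j (Y_vec i c) = (if j = i then (c, 0) else 0)"
  by (auto simp: coord_def Y_vec_def lookup_single when_def zero_prod_def)

lemma coord_base_vec: "coord j (0, v) = (0, v)"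
  by (simp add: coord_def)

lemma std_carrier_expand:
  assumes "p \<in> std_carrier m"
  shows "p = (\<Sum>i\<in>{1..m}. Y_vec i (fst (coord i p))) + (0, snd p)"
proof (rule std_carrier_eqI[OF assms])
  show "(\<Sum>i\<in>{1..m}. Y_vec i (fst (coord i p))) + (0, snd p) \<in> std_carrier m"
    by (intro subspace_add[OF subspace_std_carrier] subspace_sum[OF subspace_std_carrier] Y_vec_in base_vec_in)
  have "snd (\<Sum>i\<in>{1..m}. Y_vec i (fst (coord i p))) = 0"
    by (simp add: linear_sum[OF linear_snd] Y_vec_def)
  then show "snd p = snd ((\<Sum>i\<in>{1..m}. Y_vec i (fst (coord i p))) + (0, snd p))" by simp
  show "coord i p = coord i ((\<Sum>i\<in>{1..m}. Y_vec i (fst (coord i p))) + (0, snd p))" if "i \<in> {1..m}" for i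
  proof -
    have "coord i (\<Sum>j\<in>{1..m}. Y_vec j (fst (coord j p))) = (\<Sum>j\<in>{1..m}. if j = i then (fst (coord j p), 0) else 0)"
      unfolding linear_sum[OF linear_coord] coord_Y_vec by (intro sum.cong) auto
    also have "\<dots> = (fst (coord i p), 0)" using that by simp
    finally show ?thesis
      by (simp add: linear_add[OF linear_coord] coord_base_vec prod_eq_iff)
  qed
qed

lemma Y_vec_split: "Y_vec i c = Re c *\<^sub>R Y_vec i 1 + Im c *\<^sub>R Y_vec i \<i>"
proof -
  have "coord j (Y_vec i c) = coord j (Re c *\<^sub>R Y_vec i 1 + Im c *\<^sub>R Y_vec i \<i>)" for j
    by (auto simp: linear_add[OF linear_coord] linear_scale[OF linear_coord] coord_Y_vec complex_eq_iff)
  then have "Poly_Mapping.lookup (fst (Y_vec i c)) j = Poly_Mapping.lookup (fst (Re c *\<^sub>R Y_vec i 1 + Im c *\<^sub>R Y_vec i \<i>)) j" for j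
    unfolding coord_def by (metis fst_conv)
  moreover have "snd (Y_vec i c) = snd (Re c *\<^sub>R Y_vec i 1 + Im c *\<^sub>R Y_vec i \<i>)" by (simp add: Y_vec_def)
  ultimately show ?thesis by (simp add: prod_eq_iff poly_mapping_eqI)
qed

definition std_basis :: "nat \<Rightarrow> std_vec set" where
  "std_basis m = (\<lambda>i. Y_vec i 1) ` {1..m} \<union> (\<lambda>i. Y_vec i \<i>) ` {1..m}
     \<union> {(0, 1, 0, 0, 0), (0, 0, 1, 0, 0), (0, 0, 0, 1, 0), (0, 0, 0, 0, 1)}"

lemma span_std_basis: "span (std_basis m) = std_carrier m"
proof (rule antisym)
  show "span (std_basis m) \<subseteq> std_carrier m"
    by (rule span_minimal[OF _ subspace_std_carrier]) (auto simp: std_basis_def Y_vec_in base_vec_in)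
  show "std_carrier m \<subseteq> span (std_basis m)"
  proof
    fix p assume p: "p \<in> std_carrier m"
    obtain y x1 x2 u1 u2 where pp: "p = (y, x1, x2, u1, u2)" by (cases p) auto
    have "(0, snd p) = x1 *\<^sub>R (0, 1, 0, 0, 0) + x2 *\<^sub>R (0, 0, 1, 0, 0) + u1 *\<^sub>R (0, 0, 0, 1, 0)
        + u2 *\<^sub>R ((0, 0, 0, 0, 1) :: std_vec)"
      unfolding pp by simp
    also have "\<dots> \<in> span (std_basis m)"
      by (intro span_add span_scale span_base) (auto simp: std_basis_def)
    finally have "(0, snd p) \<in> span (std_basis m)" .
    moreover have "Y_vec i c \<in> span (std_basis m)" if "i \<in> {1..m}" for i c
      unfolding Y_vec_split[of i c] using that by (intro span_add span_scale span_base) (auto simp: std_basis_def)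
    ultimately show "p \<in> span (std_basis m)"
      using std_carrier_expand[OF p] by (metis (no_types, lifting) span_add span_sum)
  qed
qed

lemma fin_dim_std_carrier: "fin_dim (std_carrier m)"
  unfolding fin_dim_def by (rule exI[of _ "std_basis m"]) (simp add: span_std_basis, simp add: std_basis_def)

definition std_commutator :: "nat \<Rightarrow> std_vec set" where
  "std_commutator m = {p \<in> std_carrier m. \<exists>y x1 x2. p = (y, x1, x2, 0, 0)}"

lemma subspace_std_commutator: "subspace (std_commutator m)"
  unfolding subspace_def std_commutator_def
  by (auto simp: std_carrier_iff lookup_add lookup_scaleR zero_prod_def)

lemma dim_std_commutator: "dim (std_carrier m) = dim (std_commutator m) + 2"
proof (rule dim_codim_two[OF fin_dim_std_carrier subspace_std_carrier subspace_std_commutator])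
  show "std_commutator m \<subseteq> std_carrier m" unfolding std_commutator_def by blast
  show "\<exists>c d. p - (c *\<^sub>R (0, 0, 0, 1, 0) + d *\<^sub>R (0, 0, 0, 0, 1)) \<in> std_commutator m"
    if "p \<in> std_carrier m" for p
    using that by (cases p) (auto simp: std_commutator_def std_carrier_iff)
qed (auto simp: base_vec_in std_commutator_def)

lemma dim_std_carrier_Suc: "dim (std_carrier (Suc m)) = dim (std_carrier m) + 2"
proof (rule dim_codim_two[OF fin_dim_std_carrier subspace_std_carrier subspace_std_carrier])
  show "std_carrier m \<subseteq> std_carrier (Suc m)" by (auto simp: std_carrier_iff)
  show "Y_vec (Suc m) 1 \<in> std_carrier (Suc m)" "Y_vec (Suc m) \<i> \<in> std_carrier (Suc m)"
    by (simp_all add: Y_vec_in)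
  show "\<exists>c d. p - (c *\<^sub>R Y_vec (Suc m) 1 + d *\<^sub>R Y_vec (Suc m) \<i>) \<in> std_carrier m"
    if "p \<in> std_carrier (Suc m)" for p
  proof (intro exI)
    let ?c = "Poly_Mapping.lookup (fst p) (Suc m)"
    show "p - (Re ?c *\<^sub>R Y_vec (Suc m) 1 + Im ?c *\<^sub>R Y_vec (Suc m) \<i>) \<in> std_carrier m"
      unfolding Y_vec_split[symmetric] using that
      by (auto simp: std_carrier_iff lookup_minus Y_vec_def lookup_single when_def le_Suc_eq)
  qed
  show "c = 0 \<and> d = 0" if "c *\<^sub>R Y_vec (Suc m) 1 + d *\<^sub>R Y_vec (Suc m) \<i> \<in> std_carrier m" for c d
  proof -
    have "Poly_Mapping.lookup (fst (Y_vec (Suc m) (Complex c d))) (Suc m) = 0"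
      using that Y_vec_split[of "Suc m" "Complex c d"] unfolding std_carrier_iff by simp
    then show ?thesis by (simp add: Y_vec_def complex_eq_iff)
  qed
qed

text \<open>Comparison with the dimension 2n of a given algebra identifies the number of complex
  coordinates as n - 2.\<close>

lemma dim_std_carrier: "dim (std_carrier m) = 2 * m + 4"
proof (induction m)
  case 0
  have "std_carrier 0 = (\<lambda>v. (0, v)) ` (UNIV :: real4 set)"
    by (auto simp: std_carrier_def image_iff)
  moreover have "dim ((\<lambda>v. (0 :: nat \<Rightarrow>\<^sub>0 complex, v)) ` (UNIV :: real4 set)) = dim (UNIV :: real4 set)"
  proof (rule dim_image_inj_fin)
    show "linear (\<lambda>v::real4. (0 :: nat \<Rightarrow>\<^sub>0 complex, v))" by (rule linearI) auto
    show "fin_dim (UNIV :: real4 set)" unfolding fin_dim_def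
      by (rule exI[of _ Basis]) simp
  qed (auto simp: inj_on_def)
  ultimately show ?case by (simp add: dim_UNIV)
qed (simp add: dim_std_carrier_Suc)

text \<open>The parameters are arbitrary, so that the equations can be derived from an isomorphism
  and, conversely, be assumed.\<close>

locale std_algebra =
  fixes m :: nat and a b1 b2 \<tau> :: real and z w :: "nat \<Rightarrow> complex" and h :: "nat \<Rightarrow> nat \<Rightarrow> nat \<Rightarrow> complex"
begin

declare One_nat_def [simp del]

abbreviation bra :: "std_vec \<Rightarrow> std_vec \<Rightarrow> std_vec" where "bra \<equiv> std_bracket m a b1 b2 z w h"

abbreviation alg :: "std_vec ah_data" where
  "alg \<equiv> \<lparr>vs = std_carrier m, bracket = bra, metric = std_metric m \<tau>, cplx = std_cplx\<rparr>"

abbreviation cbr :: "nat \<Rightarrow> cvec \<Rightarrow> cvec \<Rightarrow> cvec" where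
  "cbr i \<equiv> coord_bracket a b1 b2 (z i) (w i) (h 1 1 i) (h 1 2 i) (h 2 1 i) (h 2 2 i)"

abbreviation ftor :: "nat \<Rightarrow> cvec \<Rightarrow> cvec \<Rightarrow> cvec \<Rightarrow> real" where
  "ftor i \<equiv> fibre_torsion (z i) (w i) (h 1 1 i) (h 1 2 i) (h 2 1 i) (h 2 2 i)"

abbreviation jac :: "nat \<Rightarrow> bool" where
  "jac i \<equiv> jacobi_eqs a b1 b2 (z i) (w i) (h 1 1 i) (h 1 2 i) (h 2 1 i) (h 2 2 i)"

abbreviation skte :: "nat \<Rightarrow> bool" where
  "skte i \<equiv> skt_eqs a b1 b2 (z i) (w i) (h 1 1 i) (h 1 2 i) (h 2 1 i) (h 2 2 i)"

abbreviation fconst :: "nat \<Rightarrow> real" where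
  "fconst i \<equiv> fibre_const (h 1 1 i) (h 1 2 i) (h 2 1 i) (h 2 2 i)"

text \<open>The metric is the orthogonal sum of the complex coordinates and the plane, and each
  projection respects bracket and J.\<close>

lemma torsion_alg:
  "torsion alg p q r = (\<Sum>i\<in>{1..m}. ftor i (coord i p) (coord i q) (coord i r))
     + base_torsion a b1 b2 \<tau> (snd p) (snd q) (snd r)"
proof -
  have *: "std_metric m \<tau> (bra (std_cplx p) (std_cplx q)) r
     = (\<Sum>i\<in>{1..m}. Re (fibre_bracket (z i) (w i) (h 1 1 i) (h 1 2 i) (h 2 1 i) (h 2 2 i)
            (coord_cplx (coord i p)) (coord_cplx (coord i q)) * cnj (fst (coord i r))))
       + base_metric \<tau> (base_bracket a b1 b2 (base_cplx (snd p)) (base_cplx (snd q))) (snd r)" for p q r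
    unfolding std_metric_coord snd_std_bracket snd_std_cplx
    by (intro arg_cong2[where f = "(+)"] sum.cong refl)
       (simp add: coord_std_bracket coord_std_cplx coord_bracket_def)
  show ?thesis
    unfolding torsion_def fibre_torsion_def base_torsion_def by (simp add: * sum.distrib)
qed

lemma d_torsion_alg:
  "d_torsion alg p q r s
     = (\<Sum>i\<in>{1..m}. d_form (cbr i) (ftor i) (coord i p) (coord i q) (coord i r) (coord i s))
       + d_form (base_bracket a b1 b2) (base_torsion a b1 b2 \<tau>) (snd p) (snd q) (snd r) (snd s)"
proof -
  have *: "torsion alg (bra p q) r s
     = (\<Sum>i\<in>{1..m}. ftor i (cbr i (coord i p) (coord i q)) (coord i r) (coord i s))
       + base_torsion a b1 b2 \<tau> (base_bracket a b1 b2 (snd p) (snd q)) (snd r) (snd s)" for p q r s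
    unfolding torsion_alg snd_std_bracket
    by (intro arg_cong2[where f = "(+)"] sum.cong refl) (simp add: coord_std_bracket)
  show ?thesis
    unfolding d_torsion_def d_form_def ah_data.select_convs * by (simp add: sum.distrib sum_subtractf)
qed

lemma d_form_coord_zero: "d_form (cbr i) (ftor i) 0 q r s = 0"
  by (rule linear_0[OF d_form_alternating(1)[OF fibre_torsion_alternating coord_bracket_alternating]])

lemma d_form_base_zero: "d_form (base_bracket a b1 b2) (base_torsion a b1 b2 \<tau>) 0 q r s = 0"
  by (rule linear_0[OF d_form_alternating(1)[OF base_torsion_alternating base_bracket_alternating]])

text \<open>All other coordinates and the plane see a zero first argument, so the summand of Y_i is
  isolated.\<close>

lemma d_torsion_alg_Y:
  assumes i: "i \<in> {1..m}"
  shows "d_torsion alg (Y_vec i c) (0, q) (0, r) (0, s) = d_form (cbr i) (ftor i) (c, 0) (0, q) (0, r) (0, s)"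
proof -
  have "(\<Sum>j\<in>{1..m}. d_form (cbr j) (ftor j) (coord j (Y_vec i c)) (0, q) (0, r) (0, s))
     = (\<Sum>j\<in>{1..m}. if j = i then d_form (cbr j) (ftor j) (c, 0) (0, q) (0, r) (0, s) else 0)"
    unfolding coord_Y_vec by (intro sum.cong) (auto simp: d_form_coord_zero)
  also have "\<dots> = d_form (cbr i) (ftor i) (c, 0) (0, q) (0, r) (0, s)"
    using i by simp
  finally show ?thesis unfolding d_torsion_alg coord_base_vec
    by (simp add: Y_vec_def d_form_base_zero)
qed

text \<open>The equations for one i appear on arguments with a single Y_i. On X1, X2, IX1, IX2 all
  summands contribute, and the scalar equation results.\<close>

lemma necessary_equations:
  assumes jacobi: "\<And>p q r. p \<in> std_carrier m \<Longrightarrow> q \<in> std_carrier m \<Longrightarrow> r \<in> std_carrier m \<Longrightarrow>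
      bra p (bra q r) + bra q (bra r p) + bra r (bra p q) = 0"
    and skt: "\<And>p q r s. p \<in> std_carrier m \<Longrightarrow> q \<in> std_carrier m \<Longrightarrow> r \<in> std_carrier m \<Longrightarrow> s \<in> std_carrier m \<Longrightarrow>
      d_torsion alg p q r s = 0"
  shows "i \<in> {1..m} \<Longrightarrow> jac i" "i \<in> {1..m} \<Longrightarrow> skte i"
    "2 * a * (a - b1) + (\<Sum>i\<in>{1..m}. fconst i) = 0"
proof -
  show "jac i" if i: "i \<in> {1..m}" for i
  proof (rule coord_jacobi_imp[where S = "coord i ` std_carrier m"])
    fix p q r assume "p \<in> coord i ` std_carrier m" "q \<in> coord i ` std_carrier m" "r \<in> coord i ` std_carrier m"
    then obtain p' q' r' where *: "p = coord i p'" "q = coord i q'" "r = coord i r'"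
      "p' \<in> std_carrier m" "q' \<in> std_carrier m" "r' \<in> std_carrier m" by blast
    have "coord i (bra p' (bra q' r') + bra q' (bra r' p') + bra r' (bra p' q')) = 0"
      using jacobi[OF *(4-6)] by (simp add: linear_0[OF linear_coord])
    then show "cbr i p (cbr i q r) + cbr i q (cbr i r p) + cbr i r (cbr i p q) = 0"
      unfolding * by (simp add: linear_add[OF linear_coord] coord_std_bracket[OF i])
  qed (metis base_vec_in coord_base_vec image_eqI)+
  show "skte i" if i: "i \<in> {1..m}" for i
  proof -
    have v: "d_form (cbr i) (ftor i) (c, 0) (0, q) (0, r) (0, s) = 0" for c q r s
      using skt[OF Y_vec_in[OF i] base_vec_in base_vec_in base_vec_in] d_torsion_alg_Y[OF i] by metis
    note v = v[unfolded zero_prod_def]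
    show ?thesis unfolding skt_eqs_def
      using fibre_d_torsion_values(1-4)[of a b1 b2 "z i" "w i" "h 1 1 i" "h 1 2 i" "h 2 1 i" "h 2 2 i"] v
      by blast
  qed
  have "0 = d_torsion alg (0, 1, 0, 0, 0) (0, 0, 1, 0, 0) (0, 0, 0, 1, 0) (0, 0, 0, 0, 1)"
    using skt base_vec_in by metis
  also have "\<dots> = (\<Sum>i\<in>{1..m}. fconst i) + 2 * a * (a - b1) * vol4 (1, 0, 0, 0) (0, 1, 0, 0) (0, 0, 1, 0) (0, 0, 0, 1)"
    unfolding d_torsion_alg coord_base_vec fibre_d_torsion_values(5) base_d_torsion by simp
  also have "vol4 (1, 0, 0, 0) (0, 1, 0, 0) (0, 0, 1, 0) (0, 0, 0, 1) = 1"
    by (simp add: vol3_def)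
  finally show "2 * a * (a - b1) + (\<Sum>i\<in>{1..m}. fconst i) = 0" by simp
qed

lemma linear_bra_left: "linear (\<lambda>p. bra p q)"
proof (rule linearI)
  have e: "p = p'" if "p \<in> std_carrier m" "p' \<in> std_carrier m" "snd p = snd p'"
     "\<And>i. i \<in> {1..m} \<Longrightarrow> coord i p = coord i p'" for p p' using std_carrier_eqI that by blast
  note in_c = std_bracket_in subspace_add[OF subspace_std_carrier] subspace_scale[OF subspace_std_carrier]
  show "bra (p + p') q = bra p q + bra p' q" for p p'
    by (rule e) (simp_all add: in_c snd_std_bracket coord_std_bracket linear_add[OF linear_coord]
        linear_add[OF coord_bracket_alternating(1)] linear_add[OF base_bracket_alternating(1)])
  show "bra (c *\<^sub>R p) q = c *\<^sub>R bra p q" for c p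
    by (rule e) (simp_all add: in_c snd_std_bracket coord_std_bracket linear_scale[OF linear_coord]
        linear_scale[OF coord_bracket_alternating(1)] linear_scale[OF base_bracket_alternating(1)])
qed

lemma bra_commute: "bra q p = - bra p q"
  by (rule std_bracket_antisym)

lemma linear_bra_right: "linear (bra p)"
proof -
  have "bra p = (\<lambda>q. - bra q p)" by (rule ext) (rule bra_commute)
  then show ?thesis using linear_compose_neg[OF linear_bra_left[of p]] by (simp only:)
qed

lemma bra_jacobi:
  assumes "\<And>i. i \<in> {1..m} \<Longrightarrow> jac i" "p \<in> std_carrier m" "q \<in> std_carrier m" "r \<in> std_carrier m"
  shows "bra p (bra q r) + bra q (bra r p) + bra r (bra p q) = 0"
proof (rule std_carrier_eqI[of _ m])
  show "bra p (bra q r) + bra q (bra r p) + bra r (bra p q) \<in> std_carrier m"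
    by (intro subspace_add[OF subspace_std_carrier] std_bracket_in)
  show "0 \<in> std_carrier m" by (rule subspace_0[OF subspace_std_carrier])
  \<comment> \<open>The planar part is the coordinate algebra with z, w and all h equal to zero, for
    which the Jacobi equations hold trivially.\<close>
  show "snd (bra p (bra q r) + bra q (bra r p) + bra r (bra p q)) = snd 0"
    using arg_cong[OF coord_jacobi[of a b1 b2 0 0 0 0 0 0 "(0, snd p)" "(0, snd q)" "(0, snd r)"], of snd]
    by (simp add: snd_std_bracket coord_bracket_def jacobi_eqs_def)
  show "coord i (bra p (bra q r) + bra q (bra r p) + bra r (bra p q)) = coord i 0" if "i \<in> {1..m}" for i
    using coord_jacobi[OF assms(1)[OF that], of "coord i p" "coord i q" "coord i r"] that
    by (simp add: linear_add[OF linear_coord] linear_0[OF linear_coord] coord_std_bracket)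
qed

text \<open>The prescribed value i(h12 - h21) of [IX1, IX2] is what balances integrability on X1,
  X2.\<close>

lemma coord_integrable:
  "coord_bracket a b1 b2 z' w' h11 h12 h21 h22 (coord_cplx p) (coord_cplx q)
     - coord_cplx (coord_bracket a b1 b2 z' w' h11 h12 h21 h22 (coord_cplx p) q)
     - coord_cplx (coord_bracket a b1 b2 z' w' h11 h12 h21 h22 p (coord_cplx q))
     - coord_bracket a b1 b2 z' w' h11 h12 h21 h22 p q = 0"
  by (cases p; cases q) (simp add: coord_bracket_def coord_cplx_def zero_prod_def algebra_simps)

lemma std_integrable:
  assumes "p \<in> std_carrier m" "q \<in> std_carrier m"
  shows "bra (std_cplx p) (std_cplx q) - std_cplx (bra (std_cplx p) q) - std_cplx (bra p (std_cplx q)) - bra p q = 0"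
proof (rule std_carrier_eqI[of _ m])
  show "bra (std_cplx p) (std_cplx q) - std_cplx (bra (std_cplx p) q) - std_cplx (bra p (std_cplx q)) - bra p q \<in> std_carrier m"
    by (intro subspace_diff[OF subspace_std_carrier] std_bracket_in std_cplx_in)
  show "0 \<in> std_carrier m" by (rule subspace_0[OF subspace_std_carrier])
  show "snd (bra (std_cplx p) (std_cplx q) - std_cplx (bra (std_cplx p) q) - std_cplx (bra p (std_cplx q)) - bra p q) = snd 0"
    using arg_cong[OF coord_integrable[of 0 0 0 0 0 0 "(0, snd p)" "(0, snd q)"], of snd]
    by (simp add: snd_std_bracket snd_std_cplx coord_bracket_def coord_cplx_def)
  show "coord i (bra (std_cplx p) (std_cplx q) - std_cplx (bra (std_cplx p) q) - std_cplx (bra p (std_cplx q)) - bra p q) = coord i 0"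
    if "i \<in> {1..m}" for i
    using coord_integrable[of "z i" "w i" "h 1 1 i" "h 1 2 i" "h 2 1 i" "h 2 2 i" "coord i p" "coord i q"] that
    by (simp add: linear_diff[OF linear_coord] linear_0[OF linear_coord] coord_std_bracket coord_std_cplx)
qed

section \<open>The commutator ideal of a standard algebra, and sufficiency of the conditions\<close>

lemma commutator_subset: "commutator_ideal alg \<subseteq> std_commutator m"
  unfolding commutator_ideal_def
proof (rule span_minimal[OF _ subspace_std_commutator])
  have "bra p q \<in> std_commutator m" for p q
    using std_bracket_in[of m a b1 b2 z w h p q] unfolding std_commutator_def
    by (cases p; cases q) (simp add: Let_def)
  then show "{bracket alg x y |x y. x \<in> vs alg \<and> y \<in> vs alg} \<subseteq> std_commutator m" by auto
qed

text \<open>In a given algebra Y_i lies in W and hence in the commutator ideal; this rules out the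
  vanishing of both eigenvalues, which belongs to none of the three cases.\<close>

lemma Y_in_commutator_imp:
  assumes a: "a > 0" and i: "i \<in> {1..m}" and j: "jac i" and s: "skte i"
    and Y: "Y_vec i 1 \<in> commutator_ideal alg"
  shows "\<not> (z i = 0 \<and> w i = 0)"
proof
  assume zw: "z i = 0 \<and> w i = 0"
  have A0: "complex_of_real a \<noteq> 0" using a by simp
  have h: "h 1 2 i = h 2 1 i" using s zw A0 unfolding skt_eqs_def by simp
  have h22: "of_real a * h 2 2 i = of_real b1 * h 1 1 i + of_real b2 * h 1 2 i"
    using j zw unfolding jacobi_eqs_def by simp
  \<comment> \<open>For \<open>z i = w i = 0\<close> the equations make this functional vanish on all brackets.\<close>
  define F where "F = (\<lambda>p::std_vec. of_real a * Poly_Mapping.lookup (fst p) i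
      - (of_real (fst (snd p)) * h 1 1 i + of_real (fst (snd (snd p))) * h 1 2 i))"
  have sub: "subspace {p. F p = 0}"
    unfolding subspace_def F_def
    by (auto simp: lookup_add lookup_scaleR algebra_simps scaleR_conv_of_real)
  have "F (bra p q) = 0" for p q
  proof -
    obtain y x1 x2 u1 u2 y' x1' x2' u1' u2' where p: "p = (y, x1, x2, u1, u2)" "q = (y', x1', x2', u1', u2')"
      by (cases p; cases q) auto
    define k where "k = complex_of_real (u2 * x2' - u2' * x2)"
    have "F (bra p q) = k * (of_real a * h 2 2 i - of_real b1 * h 1 1 i - of_real b2 * h 1 2 i)"
      unfolding F_def p k_def using zw i by (simp add: Let_def lookup_aJ h[symmetric] algebra_simps)
    then show ?thesis using h22 by simp
  qed
  then have "commutator_ideal alg \<subseteq> {p. F p = 0}"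
    unfolding commutator_ideal_def by (intro span_minimal sub) auto
  then have "F (Y_vec i 1) = 0" using Y by blast
  then show False using A0 unfolding F_def by (simp add: Y_vec_def lookup_single)
qed

text \<open>A nonzero z_i or w_i makes Y_i a bracket with IX1 or IX2. Since a > 0, bracketing IX1
  with X1, X2 yields these two vectors up to a_J, which is already covered.\<close>

lemma commutator_eq:
  assumes a: "a > 0" and ne: "\<And>i. i \<in> {1..m} \<Longrightarrow> \<not> (z i = 0 \<and> w i = 0)"
  shows "commutator_ideal alg = std_commutator m"
proof (rule antisym[OF commutator_subset])
  have br: "bra p q \<in> commutator_ideal alg" if "p \<in> std_carrier m" "q \<in> std_carrier m" for p q
    unfolding commutator_ideal_def using that
    by (intro span_base CollectI exI[of _ p] exI[of _ q]) simp
  have sub: "subspace (commutator_ideal alg)" unfolding commutator_ideal_def by simp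
  have Y: "Y_vec i c \<in> commutator_ideal alg" if i: "i \<in> {1..m}" for i c
  proof (cases "z i = 0")
    case True
    then have "w i \<noteq> 0" using ne[OF i] by blast
    then have "bra (0, 0, 0, 0, 1) (Y_vec i (c / w i)) = Y_vec i c"
      unfolding Y_vec_def zero_prod_def using i
      by (auto simp: Let_def lookup_aJ lookup_single when_def intro!: poly_mapping_eqI)
    then show ?thesis using br[OF base_vec_in Y_vec_in[OF i]] by metis
  next
    case False
    then have "bra (0, 0, 0, 1, 0) (Y_vec i (c / z i)) = Y_vec i c"
      unfolding Y_vec_def zero_prod_def using i
      by (auto simp: Let_def lookup_aJ lookup_single when_def intro!: poly_mapping_eqI)
    then show ?thesis using br[OF base_vec_in Y_vec_in[OF i]] by metis
  qed
  have fibre: "(y, 0, 0, 0, 0) \<in> commutator_ideal alg" if "(y, v) \<in> std_carrier m" for y v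
  proof -
    have "(y, 0) \<in> std_carrier m" using that by (simp add: std_carrier_iff)
    then have "(y, 0) = (\<Sum>i\<in>{1..m}. Y_vec i (fst (coord i (y, 0)))) + (0, snd (y, 0 :: real4))"
      by (rule std_carrier_expand)
    also have "(0, snd (y, 0 :: real4)) = (0 :: std_vec)" by (simp add: zero_prod_def)
    also have "(\<Sum>i\<in>{1..m}. Y_vec i (fst (coord i (y, 0)))) + 0 \<in> commutator_ideal alg"
      using Y by (auto intro!: subspace_sum[OF sub])
    finally show ?thesis by (simp add: zero_prod_def)
  qed
  have X: "(0, x1, x2, 0, 0) \<in> commutator_ideal alg" for x1 x2
  proof -
    have e: "bra (0, 0, 0, 1, 0) (0, x1 / a, x2 / a, 0, 0) \<in> commutator_ideal alg"
      by (intro br base_vec_in)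
    obtain y where y: "bra (0, 0, 0, 1, 0) (0, x1 / a, x2 / a, 0, 0) = (y, x1, x2, 0, 0)"
      using a by (simp add: Let_def)
    have "(y, x1, x2, 0, 0) - (y, 0, 0, 0, 0) \<in> commutator_ideal alg"
      using e fibre[of y "(x1, x2, 0, 0)"] std_bracket_in[of m a b1 b2 z w h "(0, 0, 0, 1, 0)" "(0, x1 / a, x2 / a, 0, 0)"]
      unfolding y by (intro subspace_diff[OF sub]) auto
    then show ?thesis by (simp add: zero_prod_def)
  qed
  show "std_commutator m \<subseteq> commutator_ideal alg"
  proof
    fix p assume "p \<in> std_commutator m"
    then obtain y x1 x2 where p: "p \<in> std_carrier m" "p = (y, x1, x2, 0, 0)" unfolding std_commutator_def by blast
    then have "p = (y, 0, 0, 0, 0) + (0, x1, x2, 0, 0)" by simp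
    also have "\<dots> \<in> commutator_ideal alg" using fibre p X by (intro subspace_add[OF sub]) auto
    finally show "p \<in> commutator_ideal alg" .
  qed
qed

lemma std_sufficient:
  assumes a: "a > 0" and pos: "\<And>p. p \<in> std_carrier m \<Longrightarrow> p \<noteq> 0 \<Longrightarrow> std_metric m \<tau> p p > 0"
    and sc: "2 * a * (a - b1) + (\<Sum>i\<in>{1..m}. fconst i) = 0"
    and d: "\<And>i. i \<in> {1..m} \<Longrightarrow> diagonal_eqs a b1 b2 (z i) (w i)"
    and j: "\<And>i. i \<in> {1..m} \<Longrightarrow> jac i" and s: "\<And>i. i \<in> {1..m} \<Longrightarrow> skte i"
    and ne: "\<And>i. i \<in> {1..m} \<Longrightarrow> \<not> (z i = 0 \<and> w i = 0)"
  shows "skt alg" "two_step_solvable alg" "\<not> commutator_cplx_invariant alg" "commutator_codim_two alg"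
proof -
  have lie: "lie_algebra alg"
    unfolding lie_algebra_def ah_data.select_convs
  proof (intro conjI ballI)
    show "subspace (std_carrier m)" by (rule subspace_std_carrier)
    show "\<exists>B. finite B \<and> span B = std_carrier m"
      by (rule exI[of _ "std_basis m"]) (simp add: span_std_basis, simp add: std_basis_def)
    show "bra p q \<in> std_carrier m" for p q by (rule std_bracket_in)
    show "bilin_on (std_carrier m) bra"
      unfolding bilin_on_def lin_on_def
      by (simp add: linear_add[OF linear_bra_left] linear_add[OF linear_bra_right]
          linear_scale[OF linear_bra_left] linear_scale[OF linear_bra_right])
    show "bra p p = 0" for p
      using bra_commute[of p p] by (simp add: eq_neg_iff_add_eq_0 scaleR_2[symmetric])
  qed (rule bra_jacobi[OF j])
  have ip: "inner_product alg"
    unfolding inner_product_def ah_data.select_convs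
  proof (intro conjI ballI impI)
    have *: "base_metric \<tau> u v = base_metric \<tau> v u" for u v
      by (cases u; cases v) (simp add: algebra_simps)
    have sym: "std_metric m \<tau> p q = std_metric m \<tau> q p" for p q
      unfolding std_metric_coord *[of "snd p"] by (simp add: mult.commute)
    show "std_metric m \<tau> p q = std_metric m \<tau> q p" for p q by (rule sym)
    have b: "linear (\<lambda>u. base_metric \<tau> u v)" for v
      by (rule linearI; cases v; force simp: algebra_simps)
    have add: "std_metric m \<tau> (p + p') q = std_metric m \<tau> p q + std_metric m \<tau> p' q"
      and sca: "std_metric m \<tau> (c *\<^sub>R p) q = c * std_metric m \<tau> p q" for p p' q c
      unfolding std_metric_coord
      by (simp_all add: linear_add[OF linear_coord] linear_scale[OF linear_coord] linear_add[OF b] linear_scale[OF b]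
          distrib_left distrib_right sum.distrib sum_distrib_left algebra_simps)
    show "bilin_on (std_carrier m) (std_metric m \<tau>)"
      unfolding bilin_on_def lin_on_def
      by (simp add: add sca sym[of _ "_ + _"] sym[of _ "_ *\<^sub>R _"]) (simp add: sym)
  qed (rule pos)
  have ah: "almost_hermitian alg"
    unfolding almost_hermitian_def ah_data.select_convs
  proof (intro conjI ballI lie ip)
    show "lin_on (std_carrier m) std_cplx" unfolding lin_on_def
      by (auto simp: map.rep_eq when_def lookup_add lookup_scaleR distrib_left[symmetric] intro!: poly_mapping_eqI)
    show "std_cplx p \<in> std_carrier m" if "p \<in> std_carrier m" for p by (rule std_cplx_in[OF that])
    show "std_cplx (std_cplx p) = - p" for p
      by (cases p) (auto simp: map.rep_eq when_def intro!: poly_mapping_eqI)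
    have *: "base_metric \<tau> (base_cplx u) (base_cplx v) = base_metric \<tau> u v" for u v
      by (cases u; cases v) (simp add: algebra_simps)
    show "std_metric m \<tau> (std_cplx p) (std_cplx q) = std_metric m \<tau> p q" for p q
      unfolding std_metric_coord coord_std_cplx snd_std_cplx * by (simp add: coord_cplx_def algebra_simps)
  qed
  have int: "integrable_cplx alg"
    unfolding integrable_cplx_def using std_integrable by simp
  have "d_torsion alg p q r t = 0" for p q r t
  proof -
    \<comment> \<open>Every summand is a multiple of the same determinant, and the scalar equation
      says that the coefficients add up to zero.\<close>
    have "d_torsion alg p q r t = (\<Sum>i\<in>{1..m}. fconst i * vol4 (snd p) (snd q) (snd r) (snd t))
        + 2 * a * (a - b1) * vol4 (snd p) (snd q) (snd r) (snd t)"
      unfolding d_torsion_alg base_d_torsion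
      by (intro arg_cong2[where f = "(+)"] sum.cong refl) (simp add: fibre_d_torsion[OF d s])
    also have "\<dots> = ((\<Sum>i\<in>{1..m}. fconst i) + 2 * a * (a - b1)) * vol4 (snd p) (snd q) (snd r) (snd t)"
      by (simp add: sum_distrib_right distrib_right)
    also have "\<dots> = 0" using sc by (simp add: add.commute)
    finally show ?thesis .
  qed
  then show "skt alg" unfolding skt_iff using ah int by simp
  have ce: "commutator_ideal alg = std_commutator m" by (rule commutator_eq[OF a ne])
  have "bra (y, x1, x2, 0, 0) (y', x1', x2', 0, 0) = 0" for y x1 x2 y' x1' x2'
    by (simp add: Let_def zero_prod_def)
  then have "bra p q = 0" if "p \<in> std_commutator m" "q \<in> std_commutator m" for p q
    using that unfolding std_commutator_def by blast
  then show "two_step_solvable alg" unfolding two_step_solvable_def ce by simp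
  show "\<not> commutator_cplx_invariant alg"
  proof
    assume "commutator_cplx_invariant alg"
    then have "std_cplx (0, 1, 0, 0, 0) \<in> std_commutator m"
      unfolding commutator_cplx_invariant_def ce ah_data.select_convs
      using base_vec_in unfolding std_commutator_def by blast
    then show False unfolding std_commutator_def by simp
  qed
  show "commutator_codim_two alg"
    unfolding commutator_codim_two_def ce ah_data.select_convs by (rule dim_std_commutator)
qed

lemma admissible_scalar:
  "2 * a * (a - b1) + (mnorm alg (aJ_vec m (h 1 2) - aJ_vec m (h 2 1)))\<^sup>2 + (mnorm alg (aJ_vec m (h 1 2)))\<^sup>2
     + (mnorm alg (aJ_vec m (h 2 1)))\<^sup>2 - 2 * metric alg (aJ_vec m (h 1 1)) (aJ_vec m (h 2 2))
   = 2 * a * (a - b1) + (\<Sum>i\<in>{1..m}. fconst i)"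
proof -
  have d: "aJ_vec m c - aJ_vec m c' = aJ_vec m (\<lambda>i. c i - c' i)" for c c'
    by (intro prod_eqI poly_mapping_eqI) (simp_all add: aJ_vec_def lookup_minus lookup_aJ)
  have g: "std_metric m \<tau> (aJ_vec m c) (aJ_vec m c') = (\<Sum>i\<in>{1..m}. Re (c i * cnj (c' i)))" for c c'
    by (simp add: aJ_vec_def lookup_aJ)
  have n: "(mnorm alg (aJ_vec m c))\<^sup>2 = (\<Sum>i\<in>{1..m}. Re (c i * cnj (c i)))" for c
  proof -
    \<comment> \<open>The radicand is a sum of squared moduli, so squaring undoes the root in
      \<open>mnorm\<close>.\<close>
    have "(\<Sum>i\<in>{1..m}. Re (c i * cnj (c i))) \<ge> 0" by (intro sum_nonneg) simp
    then show ?thesis unfolding mnorm_def ah_data.select_convs g by simp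
  qed
  show ?thesis
    unfolding d n ah_data.select_convs g fibre_const_def
    by (simp add: sum.distrib sum_subtractf sum_distrib_left)
qed

end

section \<open>The isomorphism with a standard algebra\<close>

context hermitian_space
begin

definition lincomb :: "nat \<Rightarrow> (nat \<Rightarrow> 'v) \<Rightarrow> (nat \<Rightarrow> complex) \<Rightarrow> 'v" where
  "lincomb m Y c = (\<Sum>i\<in>{1..m}. cs (c i) (Y i))"

lemma lincomb_add: "lincomb m Y (\<lambda>i. c i + d i) = lincomb m Y c + lincomb m Y d"
  unfolding lincomb_def by (simp add: cs_add_left sum.distrib)

lemma lincomb_diff: "lincomb m Y (\<lambda>i. c i - d i) = lincomb m Y c - lincomb m Y d"
  unfolding lincomb_def by (simp add: cs_diff_left sum_subtractf)

lemma lincomb_scale: "lincomb m Y (\<lambda>i. of_real r * c i) = r *\<^sub>R lincomb m Y c"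
  unfolding lincomb_def by (simp add: cs_scale_left scaleR_sum_right)

lemma lincomb_cong: "(\<And>i. i \<in> {1..m} \<Longrightarrow> c i = d i) \<Longrightarrow> lincomb m Y c = lincomb m Y d"
  unfolding lincomb_def by (rule sum.cong) auto

lemma J_lincomb:
  assumes "\<And>i. i \<in> {1..m} \<Longrightarrow> Y i \<in> V"
  shows "J (lincomb m Y c) = lincomb m Y (\<lambda>i. \<i> * c i)"
  unfolding lincomb_def J_sum using assms by (intro sum.cong) (auto simp: cs_cs[symmetric] cs_i)

lemma hm_lincomb:
  assumes Y: "unitary_basis W m Y" and W: "complex_subspace W" and j: "j \<in> {1..m}"
  shows "hm (lincomb m Y c) (Y j) = c j"
proof -
  have V: "i \<in> {1..m} \<Longrightarrow> Y i \<in> V" for i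
    using Y W unfolding unitary_basis_def complex_subspace_def by auto
  have "hm (lincomb m Y c) (Y j) = (\<Sum>i\<in>{1..m}. c i * hm (Y i) (Y j))"
    unfolding lincomb_def using V j by (simp add: hm_sum_left hm_cs_left)
  also have "\<dots> = (\<Sum>i\<in>{1..m}. if i = j then c i else 0)"
    using Y j unfolding unitary_basis_def by (intro sum.cong) auto
  finally show ?thesis using j by simp
qed

lemma g_lincomb:
  assumes Y: "unitary_basis W m Y" and W: "complex_subspace W"
  shows "g (lincomb m Y c) (lincomb m Y d) = (\<Sum>i\<in>{1..m}. Re (c i * cnj (d i)))"
proof -
  have V: "i \<in> {1..m} \<Longrightarrow> Y i \<in> V" for i
    using Y W unfolding unitary_basis_def complex_subspace_def by auto
  have "lincomb m Y c \<in> V" unfolding lincomb_def using V cs_in_V by (intro V_sum) auto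
  then have "hm (lincomb m Y c) (lincomb m Y d) = (\<Sum>i\<in>{1..m}. cnj (d i) * hm (lincomb m Y c) (Y i))"
    unfolding lincomb_def[of m Y d] using V by (simp add: hm_sum_right hm_cs_right)
  also have "\<dots> = (\<Sum>i\<in>{1..m}. c i * cnj (d i))"
    by (intro sum.cong) (simp_all add: hm_lincomb[OF Y W])
  finally have "Re (hm (lincomb m Y c) (lincomb m Y d)) = (\<Sum>i\<in>{1..m}. Re (c i * cnj (d i)))"
    by (simp del: times_complex.simps)
  then show ?thesis unfolding hm_def by simp
qed

end

text \<open>The map runs from the standard algebra to V, where it is an explicit linear combination
  of the frame and the eigenbasis. It reads only the indices 1 to m, so bracket, metric and J are
  respected on the whole type. The last clause, that the Y_i land in A, is kept for excluding z_i =
  w_i = 0.\<close>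

lemma (in two_step_skt) isomorphism_exists:
  obtains m a b1 b2 \<tau> z w h and \<psi> :: "std_vec \<Rightarrow> 'v" where
    "a > 0" "b2 \<ge> 0" "linear \<psi>" "bij_betw \<psi> (std_carrier m) V"
    "\<And>p q. \<psi> (std_bracket m a b1 b2 z w h p q) = br (\<psi> p) (\<psi> q)"
    "\<And>p q. std_metric m \<tau> p q = g (\<psi> p) (\<psi> q)"
    "\<And>p. \<psi> (std_cplx p) = J (\<psi> p)"
    "\<And>i. i \<in> {1..m} \<Longrightarrow> diagonal_eqs a b1 b2 (z i) (w i)"
    "\<And>i. i \<in> {1..m} \<Longrightarrow> \<psi> (Y_vec i 1) \<in> A"
proof -
  obtain X1 X2 a b1 b2 where nf: "normal_frame X1 X2 a b1 b2" and a: "a > 0" and b2: "b2 \<ge> 0"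
    using normal_frame_exists by blast
  obtain m Y z w where Y: "unitary_basis W m Y" and dg: "\<And>i. i \<in> {1..m} \<Longrightarrow>
      br (J X1) (Y i) = cs (z i) (Y i) \<and> br (J X2) (Y i) = cs (w i) (Y i) \<and> diagonal_eqs a b1 b2 (z i) (w i)"
    using diagonal_basis_exists[OF nf a] by metis
  have f: "frame X1 X2" using nf unfolding normal_frame_def by blast
  note X = frameD(1-6)[OF f] and perp = frameD(7)[OF f] and tr = frameD(8)[OF f] and dec = frameD(9)[OF f]
  have XV: "X1 \<in> V" "X2 \<in> V" "J X1 \<in> V" "J X2 \<in> V" using X A_V J_in by auto
  have YW: "i \<in> {1..m} \<Longrightarrow> Y i \<in> W" for i using Y unfolding unitary_basis_def by blast
  have YV: "i \<in> {1..m} \<Longrightarrow> Y i \<in> V" for i using YW W_V by blast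
  \<comment> \<open>The Y_i-components of [JX_j, X_k]; any index other than 1 stands for 2.\<close>
  define h where "h = (\<lambda>j k i. hm (br (J (if j = (1::nat) then X1 else X2)) (if k = (1::nat) then X1 else X2)) (Y i))"
  define S where "S = lincomb m Y"
  have S_W: "S c \<in> W" for c unfolding S_def lincomb_def
    using complex_subspace_cs[OF complex_subspace_W YW] by (intro subspace_sum[OF subspace_W]) auto
  have W_S: "y = S (\<lambda>i. hm y (Y i))" if "y \<in> W" for y
    using Y that unfolding S_def lincomb_def unitary_basis_def by blast
  have hX: "hm X1 (Y i) = 0" "hm X2 (Y i) = 0" if "i \<in> {1..m}" for i
    using perp[OF YW[OF that]] perp[OF W_J[OF YW[OF that]]] g_sym
    unfolding hm_def by (auto simp: complex_eq_iff)
  have split: "v = c1 *\<^sub>R X1 + c2 *\<^sub>R X2 + S (\<lambda>i. hm v (Y i))"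
    if v: "v - (c1 *\<^sub>R X1 + c2 *\<^sub>R X2) \<in> W" for v c1 c2
  proof -
    have "v - (c1 *\<^sub>R X1 + c2 *\<^sub>R X2) = S (\<lambda>i. hm (v - (c1 *\<^sub>R X1 + c2 *\<^sub>R X2)) (Y i))" by (rule W_S[OF v])
    also have "\<dots> = S (\<lambda>i. hm v (Y i))" unfolding S_def
      by (rule lincomb_cong) (simp add: hm_diff_left hm_add_left hm_scale_left hX)
    finally show ?thesis by (simp add: algebra_simps)
  qed
  have B: "br (J X1) X1 = a *\<^sub>R X1 + S (h 1 1)" "br (J X1) X2 = a *\<^sub>R X2 + S (h 1 2)"
    "br (J X2) X1 = a *\<^sub>R X2 + S (h 2 1)" "br (J X2) X2 = b1 *\<^sub>R X1 + b2 *\<^sub>R X2 + S (h 2 2)"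
    using split[of "br (J X1) X1" a 0] split[of "br (J X1) X2" 0 a] split[of "br (J X2) X1" 0 a]
      split[of "br (J X2) X2" b1 b2] nf unfolding normal_frame_def h_def by simp_all
  have BS: "br (J X1) (S c) = S (\<lambda>i. z i * c i)" "br (J X2) (S c) = S (\<lambda>i. w i * c i)" for c
  proof -
    have "br (J X1) (S c) = (\<Sum>i\<in>{1..m}. cs (c i) (br (J X1) (Y i)))"
      "br (J X2) (S c) = (\<Sum>i\<in>{1..m}. cs (c i) (br (J X2) (Y i)))"
      unfolding S_def lincomb_def
      by (rule complex_endo_sum[OF complex_endo_ad[OF X(1)] YW], assumption,
          rule complex_endo_sum[OF complex_endo_ad[OF X(2)] YW], assumption)
    then show "br (J X1) (S c) = S (\<lambda>i. z i * c i)" "br (J X2) (S c) = S (\<lambda>i. w i * c i)"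
      unfolding S_def lincomb_def using dg YV by (simp_all add: cs_cs mult.commute)
  qed
  have JS: "J (S c) = S (\<lambda>i. \<i> * c i)" for c unfolding S_def by (rule J_lincomb[OF YV])
  \<comment> \<open>The value of [JX1, JX2] is forced by integrability: the multiples of X2 in
    [JX1, X2] and [JX2, X1] cancel, and J acts as i on the coefficients.\<close>
  have BU: "br (J X1) (J X2) = S (\<lambda>i. \<i> * (h 1 2 i - h 2 1 i))"
    unfolding br_J_J(1)[OF X(1,2)] B JS[symmetric] using lincomb_diff[of m Y "h 1 2" "h 2 1"] by (simp add: S_def)
  define \<tau> where "\<tau> = g (J X1) X2"
  define \<psi> where "\<psi> = (\<lambda>(y, x1, x2, u1, u2). S (Poly_Mapping.lookup y) + x1 *\<^sub>R X1 + x2 *\<^sub>R X2 + u1 *\<^sub>R J X1 + u2 *\<^sub>R J X2)"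
  have \<psi>: "\<psi> (y, x1, x2, u1, u2) = S (Poly_Mapping.lookup y) + x1 *\<^sub>R X1 + x2 *\<^sub>R X2 + u1 *\<^sub>R J X1 + u2 *\<^sub>R J X2"
    for y x1 x2 u1 u2 unfolding \<psi>_def by simp
  have S_add: "S (\<lambda>i. c i + d i) = S c + S d" and S_diff: "S (\<lambda>i. c i - d i) = S c - S d"
    and S_scale: "S (\<lambda>i. of_real r * c i) = r *\<^sub>R S c" for c d r
    unfolding S_def by (rule lincomb_add, rule lincomb_diff, rule lincomb_scale)
  have lin: "linear \<psi>"
  proof (rule linearI)
    show "\<psi> (p + q) = \<psi> p + \<psi> q" for p q
    proof -
      obtain y x1 x2 u1 u2 y' x1' x2' u1' u2' where p: "p = (y, x1, x2, u1, u2)" "q = (y', x1', x2', u1', u2')"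
        by (cases p; cases q) auto
      have "Poly_Mapping.lookup (y + y') = (\<lambda>i. Poly_Mapping.lookup y i + Poly_Mapping.lookup y' i)"
        by (rule ext) (rule lookup_add)
      then show ?thesis unfolding p add_Pair \<psi> by (simp add: S_add algebra_simps)
    qed
    show "\<psi> (c *\<^sub>R p) = c *\<^sub>R \<psi> p" for c p
    proof -
      obtain y x1 x2 u1 u2 where p: "p = (y, x1, x2, u1, u2)" by (cases p) auto
      have "Poly_Mapping.lookup (c *\<^sub>R y) = (\<lambda>i. of_real c * Poly_Mapping.lookup y i)"
        by (rule ext) (simp add: lookup_scaleR scaleR_conv_of_real)
      then show ?thesis unfolding p scaleR_Pair \<psi> by (simp add: S_scale algebra_simps)
    qed
  qed
  have S_aJ: "S (Poly_Mapping.lookup (aJ m c)) = S c" for c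
    unfolding S_def by (rule lincomb_cong) (simp add: lookup_aJ)
  have cplx: "\<psi> (std_cplx p) = J (\<psi> p)" for p
  proof -
    obtain y x1 x2 u1 u2 where p: "p = (y, x1, x2, u1, u2)" by (cases p) auto
    have "Poly_Mapping.lookup (Poly_Mapping.map ((*) \<i>) y) = (\<lambda>i. \<i> * Poly_Mapping.lookup y i)"
      by (rule ext) (simp add: map.rep_eq when_def)
    then show ?thesis unfolding p std_cplx.simps \<psi> using XV
      by (simp add: JS J_add J_scale J_J algebra_simps)
  qed
  have bracket: "\<psi> (std_bracket m a b1 b2 z w h p q) = br (\<psi> p) (\<psi> q)" for p q
  proof -
    obtain y x1 x2 u1 u2 y' x1' x2' u1' u2' where p: "p = (y, x1, x2, u1, u2)" and q: "q = (y', x1', x2', u1', u2')"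
      by (cases p; cases q) auto
    define c d where "c = Poly_Mapping.lookup y" and "d = Poly_Mapping.lookup y'"
    define v where "v = S c + x1 *\<^sub>R X1 + x2 *\<^sub>R X2"
    define v' where "v' = S d + x1' *\<^sub>R X1 + x2' *\<^sub>R X2"
    have v: "v \<in> A" "v' \<in> A" unfolding v_def v'_def using X W_A[OF S_W] by (auto intro!: A_add A_scale)
    have pv: "\<psi> p = v + u1 *\<^sub>R J X1 + u2 *\<^sub>R J X2" "\<psi> q = v' + u1' *\<^sub>R J X1 + u2' *\<^sub>R J X2"
      unfolding p q \<psi> v_def v'_def c_def d_def by simp_all
    have "br (\<psi> p) (\<psi> q) = br v v' + u1 *\<^sub>R br (J X1) v' + u2 *\<^sub>R br (J X2) v' - u1' *\<^sub>R br (J X1) v - u2' *\<^sub>R br (J X2) v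
          + (u1 * u2' - u1' * u2) *\<^sub>R br (J X1) (J X2)"
      unfolding pv using br_commute[of v "J X1"] br_commute[of v "J X2"] br_commute[of "J X2" "J X1"]
      by (simp add: br_linear algebra_simps)
    also have "br v v' = 0" by (rule abelian[OF v])
    finally have r: "br (\<psi> p) (\<psi> q) = u1 *\<^sub>R br (J X1) v' + u2 *\<^sub>R br (J X2) v' - u1' *\<^sub>R br (J X1) v - u2' *\<^sub>R br (J X2) v
          + (u1 * u2' - u1' * u2) *\<^sub>R br (J X1) (J X2)" by simp
    have e: "br (J X1) v = S (\<lambda>i. z i * c i) + x1 *\<^sub>R (a *\<^sub>R X1 + S (h 1 1)) + x2 *\<^sub>R (a *\<^sub>R X2 + S (h 1 2))"
      "br (J X2) v = S (\<lambda>i. w i * c i) + x1 *\<^sub>R (a *\<^sub>R X2 + S (h 2 1)) + x2 *\<^sub>R (b1 *\<^sub>R X1 + b2 *\<^sub>R X2 + S (h 2 2))"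
      "br (J X1) v' = S (\<lambda>i. z i * d i) + x1' *\<^sub>R (a *\<^sub>R X1 + S (h 1 1)) + x2' *\<^sub>R (a *\<^sub>R X2 + S (h 1 2))"
      "br (J X2) v' = S (\<lambda>i. w i * d i) + x1' *\<^sub>R (a *\<^sub>R X2 + S (h 2 1)) + x2' *\<^sub>R (b1 *\<^sub>R X1 + b2 *\<^sub>R X2 + S (h 2 2))"
      unfolding v_def v'_def by (simp_all only: br_add_right br_scale_right B BS)
    have s: "S (\<lambda>i. (of_real u1 * z i + of_real u2 * w i) * d i - (of_real u1' * z i + of_real u2' * w i) * c i
        + of_real p11 * h 1 1 i + of_real p12 * h 1 2 i + of_real p21 * h 2 1 i + of_real p22 * h 2 2 i
        + of_real k * (\<i> * (h 1 2 i - h 2 1 i)))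
      = u1 *\<^sub>R S (\<lambda>i. z i * d i) + u2 *\<^sub>R S (\<lambda>i. w i * d i) - (u1' *\<^sub>R S (\<lambda>i. z i * c i) + u2' *\<^sub>R S (\<lambda>i. w i * c i))
        + p11 *\<^sub>R S (h 1 1) + p12 *\<^sub>R S (h 1 2) + p21 *\<^sub>R S (h 2 1) + p22 *\<^sub>R S (h 2 2)
        + k *\<^sub>R S (\<lambda>i. \<i> * (h 1 2 i - h 2 1 i))" for p11 p12 p21 p22 k
      by (simp only: distrib_right mult.assoc S_add S_diff S_scale)
    show ?thesis
      unfolding r e BU unfolding p q std_bracket.simps Let_def \<psi> S_aJ c_def[symmetric] d_def[symmetric] s
      by (simp add: algebra_simps)
  qed
  have gS: "g (S c) X1 = 0" "g (S c) X2 = 0" "g (S c) (J X1) = 0" "g (S c) (J X2) = 0"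
    "g X1 (S c) = 0" "g X2 (S c) = 0" "g (J X1) (S c) = 0" "g (J X2) (S c) = 0" for c
  proof -
    have *: "g (S c) X1 = 0" "g (S c) X2 = 0" "g (J (S c)) X1 = 0" "g (J (S c)) X2 = 0"
      using perp[OF S_W] perp[OF W_J[OF S_W]] by auto
    then show "g (S c) X1 = 0" "g (S c) X2 = 0" by auto
    show "g (S c) (J X1) = 0" "g (S c) (J X2) = 0"
      using * g_J_left[OF W_V[OF S_W] XV(1)] g_J_left[OF W_V[OF S_W] XV(2)] by auto
    then show "g X1 (S c) = 0" "g X2 (S c) = 0" "g (J X1) (S c) = 0" "g (J X2) (S c) = 0"
      using * g_sym by metis+
  qed
  have gU: "g (J X1) (J X1) = 1" "g (J X2) (J X2) = 1" "g (J X1) (J X2) = 0" "g (J X2) (J X1) = 0"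
    "g (J X1) X2 = \<tau>" "g X2 (J X1) = \<tau>" "g X1 (J X2) = - \<tau>" "g (J X2) X1 = - \<tau>"
    using XV X g_J_left[OF XV(1,2)] g_sym[of X2 "J X1"] g_sym[of "J X2" X1] by (auto simp: g_J_J \<tau>_def)
  have metric: "std_metric m \<tau> p q = g (\<psi> p) (\<psi> q)" for p q
  proof -
    obtain y x1 x2 u1 u2 y' x1' x2' u1' u2' where p: "p = (y, x1, x2, u1, u2)" and q: "q = (y', x1', x2', u1', u2')"
      by (cases p; cases q) auto
    have "g (S c) (S d) = (\<Sum>i\<in>{1..m}. Re (c i * cnj (d i)))" for c d
      unfolding S_def by (rule g_lincomb[OF Y complex_subspace_W])
    then show ?thesis unfolding p q std_metric.simps \<psi>
      by (simp only: g_add_left g_add_right g_scale_left g_scale_right gS gU X(3-6) g_J_self[OF XV(1)] g_J_self[OF XV(2)])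
         (simp add: algebra_simps)
  qed
  have in_V: "\<psi> p \<in> V" for p
    unfolding \<psi>_def using W_V[OF S_W] XV by (auto intro!: V_add V_scale split: prod.split)
  have kernel: "p = 0" if p: "p \<in> std_carrier m" "\<psi> p = 0" for p
  proof -
    obtain y x1 x2 u1 u2 where pp: "p = (y, x1, x2, u1, u2)" by (cases p) auto
    have e: "S (Poly_Mapping.lookup y) + x1 *\<^sub>R X1 + x2 *\<^sub>R X2 + u1 *\<^sub>R J X1 + u2 *\<^sub>R J X2 = 0"
      using p(2) unfolding pp \<psi> .
    then have "u1 *\<^sub>R J X1 + u2 *\<^sub>R J X2 = - (S (Poly_Mapping.lookup y) + x1 *\<^sub>R X1 + x2 *\<^sub>R X2)"
      by (simp add: eq_neg_iff_add_eq_0 algebra_simps)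
    also have "\<dots> \<in> A" using X W_A[OF S_W] by (intro A_neg A_add A_scale)
    finally have u: "u1 = 0" "u2 = 0" using tr by auto
    then have e: "S (Poly_Mapping.lookup y) + x1 *\<^sub>R X1 + x2 *\<^sub>R X2 = 0" using e by simp
    have "g (S (Poly_Mapping.lookup y) + x1 *\<^sub>R X1 + x2 *\<^sub>R X2) X1 = 0"
      "g (S (Poly_Mapping.lookup y) + x1 *\<^sub>R X1 + x2 *\<^sub>R X2) X2 = 0" unfolding e by simp_all
    then have x: "x1 = 0" "x2 = 0" using X by (simp_all add: g_linear gS)
    then have "S (Poly_Mapping.lookup y) = 0" using e by simp
    then have "Poly_Mapping.lookup y i = 0" if "i \<in> {1..m}" for i
      using hm_lincomb[OF Y complex_subspace_W that, of "Poly_Mapping.lookup y"] unfolding S_def by simp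
    then have "Poly_Mapping.lookup y i = 0" for i using p(1) unfolding pp std_carrier_iff by (cases "i \<in> {1..m}") auto
    then have "y = 0" by (intro poly_mapping_eqI) simp
    then show ?thesis unfolding pp using u x by (simp add: zero_prod_def)
  qed
  have bij: "bij_betw \<psi> (std_carrier m) V"
    unfolding bij_betw_def
  proof
    show "inj_on \<psi> (std_carrier m)"
      using linear_injective_on_subspace_0[OF lin subspace_std_carrier] kernel by blast
    show "\<psi> ` std_carrier m = V"
    proof (rule antisym)
      show "\<psi> ` std_carrier m \<subseteq> V" using in_V by auto
      show "V \<subseteq> \<psi> ` std_carrier m"
      proof
        fix x assume "x \<in> V"
        then obtain y x1 x2 u1 u2 where y: "y \<in> W"
          and x: "x = y + x1 *\<^sub>R X1 + x2 *\<^sub>R X2 + u1 *\<^sub>R J X1 + u2 *\<^sub>R J X2" using dec by blast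
        have "x = \<psi> (aJ m (\<lambda>i. hm y (Y i)), x1, x2, u1, u2)"
          unfolding \<psi> S_aJ W_S[OF y, symmetric] x ..
        moreover have "(aJ m (\<lambda>i. hm y (Y i)), x1, x2, u1, u2) \<in> std_carrier m"
          by (simp add: std_carrier_iff lookup_aJ)
        ultimately show "x \<in> \<psi> ` std_carrier m" by blast
      qed
    qed
  qed
  have diag: "diagonal_eqs a b1 b2 (z i) (w i)" if "i \<in> {1..m}" for i
    using dg[OF that] by blast
  have "\<psi> (Y_vec i 1) = S (Poly_Mapping.lookup (Poly_Mapping.single i 1))" for i
    unfolding Y_vec_def zero_prod_def \<psi> by simp
  then have "\<psi> (Y_vec i 1) \<in> A" for i using W_A[OF S_W] by simp
  then show ?thesis using that[OF a b2 lin bij bracket metric cplx diag] by blast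
qed

text \<open>The constructed map starts at the standard algebra, whereas \<open>ah_isomorphic\<close>
  asks for one ending there; its inverse on the carriers inherits all compatibilities.\<close>

lemma ah_isomorphic_of_inverse:
  assumes lin: "linear \<psi>" and bij: "bij_betw \<psi> (vs M) (vs L)" and sub: "subspace (vs M)"
    and br: "\<And>p q. p \<in> vs M \<Longrightarrow> q \<in> vs M \<Longrightarrow> bracket M p q \<in> vs M"
      "\<And>p q. p \<in> vs M \<Longrightarrow> q \<in> vs M \<Longrightarrow> \<psi> (bracket M p q) = bracket L (\<psi> p) (\<psi> q)"
    and g: "\<And>p q. p \<in> vs M \<Longrightarrow> q \<in> vs M \<Longrightarrow> metric M p q = metric L (\<psi> p) (\<psi> q)"
    and J: "\<And>p. p \<in> vs M \<Longrightarrow> cplx M p \<in> vs M" "\<And>p. p \<in> vs M \<Longrightarrow> \<psi> (cplx M p) = cplx L (\<psi> p)"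
  shows "ah_isomorphic L M"
proof -
  define \<phi> where "\<phi> = inv_into (vs M) \<psi>"
  have left: "\<phi> (\<psi> p) = p" if "p \<in> vs M" for p
    unfolding \<phi>_def using bij that by (simp add: bij_betw_def)
  have ex: "\<exists>p\<in>vs M. x = \<psi> p" if "x \<in> vs L" for x using bij that unfolding bij_betw_def by blast
  show ?thesis
    unfolding ah_isomorphic_def
  proof (intro exI[of _ \<phi>] conjI ballI)
    show "bij_betw \<phi> (vs L) (vs M)" unfolding \<phi>_def by (rule bij_betw_inv_into[OF bij])
    have "\<phi> (x + y) = \<phi> x + \<phi> y" if xy: "x \<in> vs L" "y \<in> vs L" for x y
    proof -
      obtain p q where "p \<in> vs M" "x = \<psi> p" "q \<in> vs M" "y = \<psi> q" using ex xy by blast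
      then show ?thesis using left[of "p + q"] left sub by (simp add: linear_add[OF lin, symmetric] subspace_add)
    qed
    moreover have "\<phi> (c *\<^sub>R x) = c *\<^sub>R \<phi> x" if x: "x \<in> vs L" for x c
    proof -
      obtain p where "p \<in> vs M" "x = \<psi> p" using ex x by blast
      then show ?thesis using left[of "c *\<^sub>R p"] left sub by (simp add: linear_scale[OF lin, symmetric] subspace_scale)
    qed
    ultimately show "lin_on (vs L) \<phi>" unfolding lin_on_def by blast
    show "\<phi> (cplx L x) = cplx M (\<phi> x)" if x: "x \<in> vs L" for x
    proof -
      obtain p where "p \<in> vs M" "x = \<psi> p" using ex x by blast
      then show ?thesis using J left by (metis (no_types))
    qed
    fix x y assume xy: "x \<in> vs L" "y \<in> vs L"
    obtain p q where pq: "p \<in> vs M" "x = \<psi> p" "q \<in> vs M" "y = \<psi> q" using ex xy by blast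
    show "\<phi> (bracket L x y) = bracket M (\<phi> x) (\<phi> y)"
      using left[OF br(1)[OF pq(1,3)]] br(2)[OF pq(1,3)] left pq by simp
    show "metric L x y = metric M (\<phi> x) (\<phi> y)"
      using g[OF pq(1,3)] left pq by simp
  qed
qed

section \<open>Assembling the classification and its converse\<close>

lemma std_alg_eq:
  "std_alg n a b1 b2 z w h \<tau> = \<lparr>vs = std_carrier (n - 2), bracket = std_bracket (n - 2) a b1 b2 z w h,
     metric = std_metric (n - 2) \<tau>, cplx = std_cplx\<rparr>"
  by (simp add: std_alg_def std_carrier_def)

lemma admissible_iff:
  "admissible n a b1 b2 z w h \<tau> \<longleftrightarrow> a > 0 \<and> b2 \<ge> 0 \<and>
     (\<forall>p\<in>std_carrier (n - 2). p \<noteq> 0 \<longrightarrow> std_metric (n - 2) \<tau> p p > 0) \<and>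
     2 * a * (a - b1) + (\<Sum>i\<in>{1..n - 2}. fibre_const (h 1 1 i) (h 1 2 i) (h 2 1 i) (h 2 2 i)) = 0 \<and>
     (\<forall>i\<in>{1..n - 2}. case_i a b1 b2 z w h i \<or> case_ii a b1 b2 z w h i \<or> case_iii a b1 b2 z w h i)"
  unfolding admissible_def Let_def std_alg_eq std_algebra.admissible_scalar by simp

lemma classification:
  fixes L :: "'v::real_vector ah_data"
  assumes L: "skt L" "two_step_solvable L" "dim (vs L) = 2 * n" "\<not> commutator_cplx_invariant L" "commutator_codim_two L"
  shows "\<exists>a b1 b2 z w h \<tau>. admissible n a b1 b2 z w h \<tau> \<and> ah_isomorphic L (std_alg n a b1 b2 z w h \<tau>)"
proof -
  obtain g J br where G: "skt_lie (vs L) g J br"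
    and br: "\<And>x y. x \<in> vs L \<Longrightarrow> y \<in> vs L \<Longrightarrow> br x y = bracket L x y"
    and g: "\<And>x y. x \<in> vs L \<Longrightarrow> y \<in> vs L \<Longrightarrow> g x y = metric L x y"
    and J: "\<And>x. x \<in> vs L \<Longrightarrow> J x = cplx L x" using skt_lie_of_record[OF L(1)] by blast
  interpret skt_lie "vs L" g J br by (rule G)
  have A: "commutator_ideal L = span {br x y | x y. x \<in> vs L \<and> y \<in> vs L}"
    unfolding commutator_ideal_def by (intro arg_cong[where f = span] Collect_cong ex_cong1) (auto simp: br)
  have AV: "commutator_ideal L \<subseteq> vs L"
    unfolding A using br_in by (intro span_minimal subspace_V) auto
  interpret two_step_skt "vs L" g J br "commutator_ideal L"
  proof (unfold_locales, rule A)
    show "br x y = 0" if "x \<in> commutator_ideal L" "y \<in> commutator_ideal L" for x y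
      using L(2) that br[OF subsetD[OF AV that(1)] subsetD[OF AV that(2)]]
      unfolding two_step_solvable_def by simp
    show "\<exists>x\<in>commutator_ideal L. J x \<notin> commutator_ideal L"
    proof -
      obtain x where "x \<in> commutator_ideal L" "cplx L x \<notin> commutator_ideal L"
        using L(4) unfolding commutator_cplx_invariant_def by blast
      then show ?thesis using J[OF subsetD[OF AV]] by metis
    qed
    show "dim (vs L) = dim (commutator_ideal L) + 2" using L(5) unfolding commutator_codim_two_def .
  qed
  obtain m a b1 b2 \<tau> z w h and \<psi> :: "std_vec \<Rightarrow> 'v" where a: "a > 0" and b2: "b2 \<ge> 0"
    and lin: "linear \<psi>" and bij: "bij_betw \<psi> (std_carrier m) (vs L)"
    and \<psi>br: "\<And>p q. \<psi> (std_bracket m a b1 b2 z w h p q) = br (\<psi> p) (\<psi> q)"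
    and \<psi>g: "\<And>p q. std_metric m \<tau> p q = g (\<psi> p) (\<psi> q)"
    and \<psi>J: "\<And>p. \<psi> (std_cplx p) = J (\<psi> p)"
    and dg: "\<And>i. i \<in> {1..m} \<Longrightarrow> diagonal_eqs a b1 b2 (z i) (w i)"
    and YA: "\<And>i. i \<in> {1..m} \<Longrightarrow> \<psi> (Y_vec i 1) \<in> commutator_ideal L"
    by (rule isomorphism_exists) (rule that)
  interpret std_algebra m a b1 b2 \<tau> z w h .
  have inj: "inj_on \<psi> (std_carrier m)" and im: "\<psi> ` std_carrier m = vs L"
    using bij unfolding bij_betw_def by auto
  have \<psi>V: "\<psi> p \<in> vs L" if "p \<in> std_carrier m" for p using im that by blast
  have kernel: "p = 0" if "p \<in> std_carrier m" "\<psi> p = 0" for p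
    using inj that linear_0[OF lin] subspace_0[OF subspace_std_carrier] by (metis inj_onD)
  have m: "m = n - 2"
    using dim_image_inj_fin[OF lin subspace_std_carrier fin_dim_std_carrier inj] L(3)
    unfolding im dim_std_carrier by simp
  have jacobi_std: "bra p (bra q r) + bra q (bra r p) + bra r (bra p q) = 0"
    if "p \<in> std_carrier m" "q \<in> std_carrier m" "r \<in> std_carrier m" for p q r
  proof (rule kernel)
    show "bra p (bra q r) + bra q (bra r p) + bra r (bra p q) \<in> std_carrier m"
      by (intro subspace_add[OF subspace_std_carrier] std_bracket_in)
    show "\<psi> (bra p (bra q r) + bra q (bra r p) + bra r (bra p q)) = 0"
      using jacobi \<psi>V that by (simp add: linear_add[OF lin] \<psi>br)
  qed
  have skt_std: "d_torsion alg p q r s = 0"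
    if "p \<in> std_carrier m" "q \<in> std_carrier m" "r \<in> std_carrier m" "s \<in> std_carrier m" for p q r s
  proof -
    have "d_torsion alg p q r s = d_torsion rec (\<psi> p) (\<psi> q) (\<psi> r) (\<psi> s)"
      unfolding d_torsion_def torsion_def by (simp add: \<psi>br \<psi>g \<psi>J)
    then show ?thesis using skt_identity \<psi>V that by simp
  qed
  have eqs: "jac i" "skte i" if "i \<in> {1..m}" for i
  proof -
    show "jac i" by (rule necessary_equations(1)[OF jacobi_std skt_std that])
    show "skte i" by (rule necessary_equations(2)[OF jacobi_std skt_std that])
  qed
  have nz: "\<not> (z i = 0 \<and> w i = 0)" if i: "i \<in> {1..m}" for i
  proof -
    \<comment> \<open>The image of the standard commutator ideal contains all brackets of L, so Y_i,
      mapped into the commutator ideal of L, comes from the standard one; injectivity puts Y_i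
      itself there.\<close>
    have "commutator_ideal L \<subseteq> \<psi> ` commutator_ideal alg"
      unfolding A
    proof (rule span_minimal)
      show "subspace (\<psi> ` commutator_ideal alg)"
        unfolding commutator_ideal_def by (rule linear_subspace_image[OF lin]) simp
      show "{br x y |x y. x \<in> vs L \<and> y \<in> vs L} \<subseteq> \<psi> ` commutator_ideal alg"
      proof clarify
        fix x y assume "x \<in> vs L" "y \<in> vs L"
        then obtain p q where pq: "p \<in> std_carrier m" "q \<in> std_carrier m" "x = \<psi> p" "y = \<psi> q" using im by blast
        have "bra p q \<in> commutator_ideal alg"
          unfolding commutator_ideal_def using pq by (intro span_base CollectI exI[of _ p] exI[of _ q]) simp
        then show "br x y \<in> \<psi> ` commutator_ideal alg" unfolding pq using \<psi>br by (metis image_eqI)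
      qed
    qed
    then have "\<psi> (Y_vec i 1) \<in> \<psi> ` commutator_ideal alg" using YA[OF i] by (rule subsetD)
    then obtain p where p: "p \<in> commutator_ideal alg" "\<psi> (Y_vec i 1) = \<psi> p" by (rule imageE)
    have "p \<in> std_carrier m" using subsetD[OF commutator_subset p(1)] by (simp add: std_commutator_def)
    then have "Y_vec i 1 = p" by (rule inj_onD[OF inj p(2) Y_vec_in[OF i]])
    with p(1) have "Y_vec i 1 \<in> commutator_ideal alg" by simp
    then show ?thesis by (rule Y_in_commutator_imp[OF a i eqs[OF i]])
  qed
  have "admissible n a b1 b2 z w h \<tau>"
    unfolding admissible_iff m[symmetric]
  proof (intro conjI ballI impI a b2)
    show "2 * a * (a - b1) + (\<Sum>i\<in>{1..m}. fconst i) = 0"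
      by (rule necessary_equations(3)[OF jacobi_std skt_std])
    show "case_i a b1 b2 z w h i \<or> case_ii a b1 b2 z w h i \<or> case_iii a b1 b2 z w h i" if "i \<in> {1..m}" for i
      by (rule case_eqs[where z = z and w = w and h = h and i = i, OF a dg[OF that] eqs[OF that] nz[OF that]])
    show "std_metric m \<tau> p p > 0" if "p \<in> std_carrier m" "p \<noteq> 0" for p
      unfolding \<psi>g using g_pos \<psi>V kernel that by blast
  qed
  moreover have "ah_isomorphic L (std_alg n a b1 b2 z w h \<tau>)"
    unfolding std_alg_eq m[symmetric]
    by (rule ah_isomorphic_of_inverse[OF lin])
       (simp_all add: bij subspace_std_carrier std_bracket_in std_cplx_in \<psi>br \<psi>g \<psi>J \<psi>V br g J)
  ultimately show ?thesis by blast
qed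

theorem theorem4p10:
  shows
    "(\<forall>(L :: 'v::real_vector ah_data) n.
        skt L \<and> two_step_solvable L \<and> dim (vs L) = 2 * n \<and>
        \<not> commutator_cplx_invariant L \<and> commutator_codim_two L \<longrightarrow>
        (\<exists>a b1 b2 z w h \<tau>. admissible n a b1 b2 z w h \<tau> \<and>
           ah_isomorphic L (std_alg n a b1 b2 z w h \<tau>)))
     \<and>
     (\<forall>n\<ge>2. \<forall>a b1 b2 z w h \<tau>. admissible n a b1 b2 z w h \<tau> \<longrightarrow>
        skt (std_alg n a b1 b2 z w h \<tau>) \<and>
        two_step_solvable (std_alg n a b1 b2 z w h \<tau>) \<and>
        \<not> commutator_cplx_invariant (std_alg n a b1 b2 z w h \<tau>) \<and>
        commutator_codim_two (std_alg n a b1 b2 z w h \<tau>))"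
proof (intro conjI allI impI)
  fix L :: "'v ah_data" and n
  assume "skt L \<and> two_step_solvable L \<and> dim (vs L) = 2 * n \<and>
    \<not> commutator_cplx_invariant L \<and> commutator_codim_two L"
  then show "\<exists>a b1 b2 z w h \<tau>. admissible n a b1 b2 z w h \<tau> \<and> ah_isomorphic L (std_alg n a b1 b2 z w h \<tau>)"
    using classification by blast
next
  fix n :: nat and a b1 b2 z w h \<tau>
  assume "admissible n a b1 b2 z w h \<tau>"
  then have adm: "a > 0" "\<And>p. p \<in> std_carrier (n - 2) \<Longrightarrow> p \<noteq> 0 \<Longrightarrow> std_metric (n - 2) \<tau> p p > 0"
    "2 * a * (a - b1) + (\<Sum>i\<in>{1..n - 2}. fibre_const (h 1 1 i) (h 1 2 i) (h 2 1 i) (h 2 2 i)) = 0"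
    and c: "\<And>i. i \<in> {1..n - 2} \<Longrightarrow>
      case_i a b1 b2 z w h i \<or> case_ii a b1 b2 z w h i \<or> case_iii a b1 b2 z w h i"
    unfolding admissible_iff by blast+
  note std = std_algebra.std_sufficient[OF adm eqs_case(1-4)[OF adm(1) c]]
  show "skt (std_alg n a b1 b2 z w h \<tau>)" "two_step_solvable (std_alg n a b1 b2 z w h \<tau>)"
    "\<not> commutator_cplx_invariant (std_alg n a b1 b2 z w h \<tau>)" "commutator_codim_two (std_alg n a b1 b2 z w h \<tau>)"
    unfolding std_alg_eq by (rule std; assumption)+
qed

end
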